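(* For $\alpha\in\mathcal A$ let $\hat\mu_\alpha$ be the distribution of the ball configuration $\eta[\underline\varepsilon]$ with record $0$ at the origin and excursions $\underline\varepsilon=(\varepsilon^{(i)})_{i\in\mathbb Z}$ i.i.d. with law $\nu_\alpha$. (a) If $\alpha\in\mathcal A^+$, then $\hat\mu_\alpha$ concentrates on $\hat{\mathcal X}_{\lambda(\alpha)}$ and is record-translation invariant, and the measure $\mu_\alpha:=\mathrm{Palm}^{-1}(\hat\mu_\alpha)$ concentrates on $\mathcal X_{\lambda(\alpha)}$, is translation invariant and is $T$-invariant. (b) If $q\in\mathcal Q^+$, then $\hat\mu_{\alpha(q)}$ concentrates on $\hat{\mathcal X}_{\lambda(\alpha(q))}$, and $\mu_{\alpha(q)}:=\mathrm{Palm}^{-1}(\hat\mu_{\alpha(q)})$ is translation invariant, concentrates on $\mathcal X_{\lambda(\alpha(q))}$ and is $T$-invariant.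
   Context: Conventions: $0^0=1$. Excursions. An excursion is a finite integer sequence $\varepsilon=(\varepsilon(0),\dots,\varepsilon(2n))$, $n=n(\varepsilon)\ge0$, with $\varepsilon(0)=\varepsilon(2n)=0$, $\varepsilon(z)\ge0$ for $0\le z\le 2n$ and $|\varepsilon(z)-\varepsilon(z-1)|=1$ ($n=0$: empty excursion). $\mathcal E$ is the set of all excursions. The ball configuration of $\varepsilon$ is $W^{-1}\varepsilon\in\{0,1\}^{\mathbb Z}$ with $W^{-1}\varepsilon(z)=(\varepsilon(z)-\varepsilon(z-1)+1)/2$ for $1\le z\le 2n$ and $0$ for all other $z$. Solitons (Takahashi-Satsuma algorithm). A run of a configuration is a maximal (possibly infinite) interval of consecutive boxes on which the configuration is constant. Starting from the ball configuration of $\varepsilon$, as long as there are finite runs: let $k$ be the smallest size of a run, take the leftmost run of size $k$, and declare the $k$ boxes of this run together with the first $k$ boxes of the next run to be a $k$-soliton; then delete (ignore) these $2k$ boxes, recompute the runs, and repeat. $n_k(\varepsilon)$ is the number of $k$-solitons of $\varepsilon$. Measures on excursions and parameters. For $\alpha=(\alpha_k)_{k\ge1}$ with $\alpha_k\in[0,1)$ let $Z_\alpha:=\sum_{\varepsilon\in\mathcal E}\prod_{k\ge1}\alpha_k^{n_k(\varepsilon)}$, $\mathcal A:=\{\alpha:Z_\alpha<\infty\}$. For $\alpha\in\mathcal A$ let $\nu_\alpha(\varepsilon):=Z_\alpha^{-1}\prod_{k\ge1}\alpha_k^{n_k(\varepsilon)}$, $\rho_k(\alpha):=\sum_{\varepsilon}n_k(\varepsilon)\nu_\alpha(\varepsilon)$,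 and $\mathcal A^+:=\{\alpha\in\mathcal A:\sum_k2k\rho_k(\alpha)<\infty\}$. For $q=(q_k)_{k\ge1}$ with $q_k\in[0,1)$ let $\mathcal Q^+:=\{q:\sum_kkq_k<\infty\}$. For such $q$, $\alpha(q)$ is given by $\alpha_k=q_k\prod_{\ell=1}^{k-1}(1-q_\ell)^{2(k-\ell)}$, $k\ge1$; it maps $\mathcal Q^+$ bijectively onto $\mathcal A^+$. For $\alpha\in\mathcal A^+$ put $\kappa(\alpha):=1+2\sum_kk\rho_k(\alpha)<\infty$ (the mean inter-record distance $\int r(\eta,1)\,\hat\mu_\alpha(d\eta)$) and $\lambda(\alpha):=\frac{\kappa(\alpha)-1}{2\kappa(\alpha)}\in[0,\tfrac12)$. Configurations and records. For $\eta\in\{0,1\}^{\mathbb Z}$ let $W\eta=\xi$ be the walk with $\xi(0)=0$, $\xi(z)-\xi(z-1)=2\eta(z)-1$. $z$ is a record of $\eta$ if $\xi(z)<\xi(z')$ for all $z'<z$; $R\eta$ is the set of records and $r(\eta,i):=\min\{z:\xi(z)=-i\}$ is the position of record $i$. For $\lambda\in[0,1]$, $\mathcal X_\lambda$ is the set of $\eta\in\{0,1\}^{\mathbb Z}$ with $\lim_{y\to\infty}\frac1y\sum_{z=-y}^0\eta(z)=\lim_{y\to\infty}\frac1y\sum_{z=0}^y\eta(z)=\lambda$; $\mathcal X:=\bigcup_{0\le\lambda<1/2}\mathcal X_\lambda$; $\hat{\mathcal X}_\lambda:=\{\eta\in\mathcal X_\lambda:0\in R\eta\}$. For $\underline\varepsilon\in\mathcal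 E^{\mathbb Z}$, $\eta=\eta[\underline\varepsilon]$ is the configuration with $r(\eta,0)=0$, $r(\eta,i+1)-r(\eta,i)=2n(\varepsilon^{(i)})+1$, and $\eta(r(\eta,i)+z)=W^{-1}\varepsilon^{(i)}(z)$ for $0\le z\le 2n(\varepsilon^{(i)})$, $i\in\mathbb Z$. Dynamics (Box-Ball System). $T:\mathcal X\to\mathcal X$, $T\eta(z):=(1-\eta(z))\mathbf 1\{z\notin R\eta\}$. A measure $\mu$ on $\mathcal X$ is $T$-invariant if $\mu\circ T^{-1}=\mu$. Invariance and inverse Palm measure. $(\tau^y\eta)(z)=\eta(z+y)$. $\hat\mu$ is record-translation invariant if $\int f(\tau^{r(\eta,i)}\eta)\hat\mu(d\eta)=\int f\,d\hat\mu$ for all $i\in\mathbb Z$ and all bounded measurable $f$. For a record-translation invariant $\hat\mu$ with $\kappa(\hat\mu):=\int r(\eta,1)\hat\mu(d\eta)<\infty$, $\mathrm{Palm}^{-1}(\hat\mu)$ is the probability measure defined by $\int f\,d\,\mathrm{Palm}^{-1}(\hat\mu)=\frac1{\kappa(\hat\mu)}\int\sum_{z=1}^{r(\eta,1)}f(\tau^z\eta)\,\hat\mu(d\eta)$. *)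

theory Defs
  imports "HOL-Probability.Probability"
begin

section \<open>Configurations, walks and records\<close>

text \<open>\<open>\<eta> z\<close> says that box \<open>z\<close> carries a ball, that is, that the configuration has value 1 there.\<close>

type_synonym config = "int \<Rightarrow> bool"

definition config_space :: "config measure" where
  "config_space = PiM UNIV (\<lambda>_. count_space UNIV)"

definition walk :: "config \<Rightarrow> int \<Rightarrow> int" where
  "walk \<eta> z = (if 0 \<le> z then (\<Sum>x\<in>{0<..z}. 2 * of_bool (\<eta> x) - 1)
               else - (\<Sum>x\<in>{z<..0}. 2 * of_bool (\<eta> x) - 1))"

lemma walk_0 [simp]: "walk \<eta> 0 = 0"
  by (simp add: walk_def)

lemma walk_step: "walk \<eta> z - walk \<eta> (z - 1) = 2 * of_bool (\<eta> z) - 1"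
proof (cases "1 \<le> z")
  case True
  then have "{0<..z} = insert z {0<..z - 1}" by auto
  with True show ?thesis by (simp add: walk_def)
next
  case False
  then have "{z - 1<..0} = insert z {z<..0}" by auto
  with False show ?thesis by (cases "z = 0") (simp_all add: walk_def)
qed

definition records :: "config \<Rightarrow> int set" where
  "records \<eta> = {z. \<forall>z'<z. walk \<eta> z < walk \<eta> z'}"

text \<open>The minimum need not exist for an arbitrary configuration; in that case the value is an
  unspecified integer that depends on neither the configuration nor \<open>i\<close>.\<close>

definition record_pos :: "config \<Rightarrow> int \<Rightarrow> int" where
  "record_pos \<eta> i = (LEAST z. walk \<eta> z = - i)"

definition density_class :: "real \<Rightarrow> config set" where
  "density_class l = {\<eta>.
     (\<lambda>y. (\<Sum>z\<in>{- int y..0}. of_bool (\<eta> z)) / real y) \<longlonglongrightarrow> l \<and>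
     (\<lambda>y. (\<Sum>z\<in>{0..int y}. of_bool (\<eta> z)) / real y) \<longlonglongrightarrow> l}"

definition density_class_hat :: "real \<Rightarrow> config set" where
  "density_class_hat l = {\<eta> \<in> density_class l. 0 \<in> records \<eta>}"

definition subcritical :: "config set" where
  "subcritical = (\<Union>l\<in>{0..<1/2}. density_class l)"

definition BBS :: "config \<Rightarrow> config" where
  "BBS \<eta> z \<longleftrightarrow> \<not> \<eta> z \<and> z \<notin> records \<eta>"

definition shift :: "int \<Rightarrow> config \<Rightarrow> config" where
  "shift y \<eta> z = \<eta> (z + y)"


section \<open>Excursions\<close>

definition excursions :: "int list set" where
  "excursions = {e. \<exists>n. length e = 2 * n + 1 \<and> e ! 0 = 0 \<and> e ! (2 * n) = 0 \<and>
     (\<forall>z\<le>2 * n. 0 \<le> e ! z) \<and> (\<forall>z\<in>{1..2 * n}. \<bar>e ! z - e ! (z - 1)\<bar> = 1)}"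

definition half_length :: "int list \<Rightarrow> nat" where
  "half_length e = (length e - 1) div 2"

definition ball_config :: "int list \<Rightarrow> config" where
  "ball_config e z \<longleftrightarrow> 1 \<le> z \<and> z \<le> 2 * int (half_length e) \<and>
     (e ! nat z - e ! nat (z - 1) + 1) div 2 = 1"


section \<open>Solitons (Takahashi--Satsuma algorithm)\<close>

text \<open>Below, \<open>A\<close> is the set of boxes that have not been deleted yet; intervals and
  runs are taken relative to \<open>A\<close>.\<close>

definition constant_interval :: "config \<Rightarrow> int set \<Rightarrow> int set \<Rightarrow> bool" where
  "constant_interval \<eta> A I \<longleftrightarrow> I \<noteq> {} \<and> I \<subseteq> A \<and>
     (\<forall>x\<in>I. \<forall>y\<in>I. \<forall>z\<in>A. x \<le> z \<and> z \<le> y \<longrightarrow> z \<in> I) \<and>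
     (\<forall>x\<in>I. \<forall>y\<in>I. \<eta> x = \<eta> y)"

definition is_run :: "config \<Rightarrow> int set \<Rightarrow> int set \<Rightarrow> bool" where
  "is_run \<eta> A I \<longleftrightarrow> constant_interval \<eta> A I \<and>
     (\<forall>J. constant_interval \<eta> A J \<and> I \<subseteq> J \<longrightarrow> J = I)"

definition has_finite_run :: "config \<Rightarrow> int set \<Rightarrow> bool" where
  "has_finite_run \<eta> A \<longleftrightarrow> (\<exists>I. is_run \<eta> A I \<and> finite I)"

definition min_run_size :: "config \<Rightarrow> int set \<Rightarrow> nat" where
  "min_run_size \<eta> A = (LEAST k. \<exists>I. is_run \<eta> A I \<and> finite I \<and> card I = k)"

definition leftmost_min_run :: "config \<Rightarrow> int set \<Rightarrow> int set" where
  "leftmost_min_run \<eta> A = (THE I.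
     is_run \<eta> A I \<and> finite I \<and> card I = min_run_size \<eta> A \<and>
     (\<forall>J. is_run \<eta> A J \<and> finite J \<and> card J = min_run_size \<eta> A \<longrightarrow> Min I \<le> Min J))"

definition next_run :: "config \<Rightarrow> int set \<Rightarrow> int set \<Rightarrow> int set" where
  "next_run \<eta> A I = (THE J.
     is_run \<eta> A J \<and> (\<forall>x\<in>I. \<forall>y\<in>J. x < y) \<and>
     (\<forall>z\<in>A. (\<forall>x\<in>I. x < z) \<longrightarrow> (\<exists>y\<in>J. y \<le> z)))"

text \<open>The soliton removed in one step: the leftmost run of minimal size \<open>k\<close> together with the first
  \<open>k\<close> boxes of the next run, which may be infinite to the right.\<close>

definition next_soliton :: "config \<Rightarrow> int set \<Rightarrow> int set" where
  "next_soliton \<eta> A =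
     (let I = leftmost_min_run \<eta> A; J = next_run \<eta> A I
      in I \<union> {z \<in> J. card {y \<in> J. y \<le> z} \<le> min_run_size \<eta> A})"

primrec remaining_boxes :: "config \<Rightarrow> nat \<Rightarrow> int set" where
  "remaining_boxes \<eta> 0 = UNIV"
| "remaining_boxes \<eta> (Suc t) =
     (if has_finite_run \<eta> (remaining_boxes \<eta> t)
      then remaining_boxes \<eta> t - next_soliton \<eta> (remaining_boxes \<eta> t)
      else remaining_boxes \<eta> t)"

text \<open>One soliton is declared in every step before the algorithm stops, so \<open>k\<close>-solitons are counted
  by the steps \<open>t\<close> in which they are declared.\<close>

definition soliton_count :: "nat \<Rightarrow> int list \<Rightarrow> nat" where
  "soliton_count k e = card {t.
     has_finite_run (ball_config e) (remaining_boxes (ball_config e) t) \<and>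
     min_run_size (ball_config e) (remaining_boxes (ball_config e) t) = k}"


section \<open>Measures on excursions\<close>

text \<open>Sequences indexed by \<open>k \<ge> 1\<close> are functions on \<open>nat\<close> whose value at \<open>0\<close> is irrelevant.\<close>

definition weight :: "(nat \<Rightarrow> real) \<Rightarrow> int list \<Rightarrow> real" where
  "weight \<alpha> e = (\<Prod>k. \<alpha> (Suc k) ^ soliton_count (Suc k) e)"

definition partition_fun :: "(nat \<Rightarrow> real) \<Rightarrow> ennreal" where
  "partition_fun \<alpha> = (\<integral>\<^sup>+ e. ennreal (weight \<alpha> e) \<partial>count_space excursions)"

definition A_set :: "(nat \<Rightarrow> real) set" where
  "A_set = {\<alpha>. (\<forall>k\<ge>1. 0 \<le> \<alpha> k \<and> \<alpha> k < 1) \<and> partition_fun \<alpha> < \<infinity>}"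

definition exc_law :: "(nat \<Rightarrow> real) \<Rightarrow> int list measure" where
  "exc_law \<alpha> = density (count_space excursions) (\<lambda>e. ennreal (weight \<alpha> e) / partition_fun \<alpha>)"

definition soliton_density :: "nat \<Rightarrow> (nat \<Rightarrow> real) \<Rightarrow> ennreal" where
  "soliton_density k \<alpha> = (\<integral>\<^sup>+ e. of_nat (soliton_count k e) \<partial>exc_law \<alpha>)"

definition A_plus :: "(nat \<Rightarrow> real) set" where
  "A_plus = {\<alpha> \<in> A_set. (\<Sum>k. 2 * of_nat (Suc k) * soliton_density (Suc k) \<alpha>) < \<infinity>}"

definition Q_plus :: "(nat \<Rightarrow> real) set" where
  "Q_plus = {q. (\<forall>k\<ge>1. 0 \<le> q k \<and> q k < 1) \<and> summable (\<lambda>k. real (Suc k) * q (Suc k))}"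

definition alpha_of :: "(nat \<Rightarrow> real) \<Rightarrow> nat \<Rightarrow> real" where
  "alpha_of q k = q k * (\<Prod>l\<in>{1..<k}. (1 - q l) ^ (2 * (k - l)))"

definition mean_spacing :: "(nat \<Rightarrow> real) \<Rightarrow> real" where
  "mean_spacing \<alpha> = 1 + 2 * enn2real (\<Sum>k. of_nat (Suc k) * soliton_density (Suc k) \<alpha>)"

definition ball_density :: "(nat \<Rightarrow> real) \<Rightarrow> real" where
  "ball_density \<alpha> = (mean_spacing \<alpha> - 1) / (2 * mean_spacing \<alpha>)"


section \<open>Concatenating excursions\<close>

text \<open>\<open>config_of \<epsilon>\<close> puts record \<open>i\<close> at \<open>block_start \<epsilon> i\<close> and
  \<open>ball_config (\<epsilon> i)\<close> between records \<open>i\<close> and \<open>i + 1\<close>; the lemmas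
  \<open>record_pos_config_of\<close> and \<open>config_of_block\<close> give the defining properties of this configuration.\<close>

definition block_start :: "(int \<Rightarrow> int list) \<Rightarrow> int \<Rightarrow> int" where
  "block_start \<epsilon> i = (if 0 \<le> i then (\<Sum>j\<in>{0..<i}. 2 * int (half_length (\<epsilon> j)) + 1)
                      else - (\<Sum>j\<in>{i..<0}. 2 * int (half_length (\<epsilon> j)) + 1))"

definition config_of :: "(int \<Rightarrow> int list) \<Rightarrow> config" where
  "config_of \<epsilon> z \<longleftrightarrow> (\<exists>i. block_start \<epsilon> i \<le> z \<and> z < block_start \<epsilon> (i + 1) \<and>
     ball_config (\<epsilon> i) (z - block_start \<epsilon> i))"

lemma block_start_0: "block_start \<epsilon> 0 = 0"
  by (simp add: block_start_def)

lemma block_start_step: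
  "block_start \<epsilon> (i + 1) = block_start \<epsilon> i + 2 * int (half_length (\<epsilon> i)) + 1"
proof (cases "0 \<le> i")
  case True
  then have "{0..<i + 1} = insert i {0..<i}" by auto
  with True show ?thesis by (simp add: block_start_def)
next
  case False
  then have "{i..<0} = insert i {i + 1..<0}" by auto
  with False show ?thesis by (cases "i = -1") (simp_all add: block_start_def)
qed

lemma block_start_diff: "i \<le> j \<Longrightarrow> j - i \<le> block_start \<epsilon> j - block_start \<epsilon> i"
  by (induction j rule: int_ge_induct) (simp_all add: block_start_step)

lemma block_exists: "\<exists>i. block_start \<epsilon> i \<le> z \<and> z < block_start \<epsilon> (i + 1)"
proof -
  have lower: "block_start \<epsilon> (- \<bar>z\<bar>) \<le> z"
    using block_start_diff[of "- \<bar>z\<bar>" 0 \<epsilon>] by (simp add: block_start_0)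
  have "z < block_start \<epsilon> j \<Longrightarrow> \<exists>i. block_start \<epsilon> i \<le> z \<and> z < block_start \<epsilon> (i + 1)"
    if "- \<bar>z\<bar> \<le> j" for j
    using that
  proof (induction j rule: int_ge_induct)
    case base
    with lower show ?case by simp
  next
    case (step j)
    then show ?case by (cases "z < block_start \<epsilon> j") (auto simp: not_less)
  qed
  moreover have "z < block_start \<epsilon> (\<bar>z\<bar> + 1)"
    using block_start_diff[of 0 "\<bar>z\<bar> + 1" \<epsilon>] by (simp add: block_start_0)
  ultimately show ?thesis by (smt (verit))
qed

lemma config_of_block:
  assumes "0 \<le> z" "z \<le> 2 * int (half_length (\<epsilon> i))"
  shows "config_of \<epsilon> (block_start \<epsilon> i + z) \<longleftrightarrow> ball_config (\<epsilon> i) z"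
proof -
  have "j = i"
    if "block_start \<epsilon> j \<le> block_start \<epsilon> i + z" "block_start \<epsilon> i + z < block_start \<epsilon> (j + 1)" for j
  proof (rule ccontr)
    assume "j \<noteq> i"
    then consider "j + 1 \<le> i" | "i + 1 \<le> j" by linarith
    then show False
    proof cases
      case 1
      from block_start_diff[OF this, of \<epsilon>] 1 that assms show False by linarith
    next
      case 2
      from block_start_diff[OF this, of \<epsilon>] 2 that assms block_start_step[of \<epsilon> i]
      show False by linarith
    qed
  qed
  moreover have "block_start \<epsilon> i \<le> block_start \<epsilon> i + z" "block_start \<epsilon> i + z < block_start \<epsilon> (i + 1)"
    using assms block_start_step[of \<epsilon> i] by linarith+
  ultimately show ?thesis
    unfolding config_of_def by (metis add_diff_cancel_left')
qed

lemma walk_block: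
  assumes "\<forall>i. \<epsilon> i \<in> excursions" "z \<le> 2 * half_length (\<epsilon> i)"
  shows "walk (config_of \<epsilon>) (block_start \<epsilon> i + int z)
       = walk (config_of \<epsilon>) (block_start \<epsilon> i) + \<epsilon> i ! z"
  using assms(2)
proof (induction z)
  case 0
  from assms(1) have "\<epsilon> i \<in> excursions" by blast
  then show ?case by (auto simp: excursions_def)
next
  case (Suc z)
  from assms(1) have "\<epsilon> i \<in> excursions" by blast
  then obtain n where "length (\<epsilon> i) = 2 * n + 1"
    and steps: "\<forall>z\<in>{1..2 * n}. \<bar>\<epsilon> i ! z - \<epsilon> i ! (z - 1)\<bar> = 1"
    by (auto simp: excursions_def)
  with Suc.prems have "Suc z \<in> {1..2 * n}" by (simp add: half_length_def)
  with steps have "\<bar>\<epsilon> i ! Suc z - \<epsilon> i ! z\<bar> = 1" by fastforce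
  then have "\<epsilon> i ! Suc z - \<epsilon> i ! z = 1 \<or> \<epsilon> i ! Suc z - \<epsilon> i ! z = -1" by linarith
  moreover have "nat (1 + int z) = Suc z" by simp
  ultimately have "2 * of_bool (ball_config (\<epsilon> i) (1 + int z)) - 1 = \<epsilon> i ! Suc z - \<epsilon> i ! z"
    using Suc.prems by (auto simp: ball_config_def)
  with Suc walk_step[of "config_of \<epsilon>" "block_start \<epsilon> i + int (Suc z)"]
    config_of_block[of "int (Suc z)" \<epsilon> i]
  show ?case by simp
qed

lemma walk_block_start:
  assumes "\<forall>i. \<epsilon> i \<in> excursions"
  shows "walk (config_of \<epsilon>) (block_start \<epsilon> i) = - i"
proof -
  have step: "walk (config_of \<epsilon>) (block_start \<epsilon> (i + 1)) = walk (config_of \<epsilon>) (block_start \<epsilon> i) - 1" for i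
  proof -
    have "\<epsilon> i ! (2 * half_length (\<epsilon> i)) = 0"
      using assms[rule_format, of i] by (auto simp: excursions_def half_length_def)
    moreover have "\<not> config_of \<epsilon> (block_start \<epsilon> (i + 1))"
      using config_of_block[of 0 \<epsilon> "i + 1"] by (simp add: ball_config_def)
    ultimately show ?thesis
      using walk_block[OF assms, of "2 * half_length (\<epsilon> i)" i]
        walk_step[of "config_of \<epsilon>" "block_start \<epsilon> (i + 1)"]
      by (simp add: block_start_step)
  qed
  show ?thesis
  proof (induction i rule: int_induct[where k = 0])
    case base
    show ?case by (simp add: block_start_0)
  next
    case (step1 i)
    with step[of i] show ?case by simp
  next
    case (step2 i)
    with step[of "i - 1"] show ?case by simp
  qed
qed

lemma record_pos_config_of:
  assumes "\<forall>i. \<epsilon> i \<in> excursions"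
  shows "record_pos (config_of \<epsilon>) i = block_start \<epsilon> i"
  unfolding record_pos_def
proof (rule Least_equality)
  show "walk (config_of \<epsilon>) (block_start \<epsilon> i) = - i" by (rule walk_block_start[OF assms])
next
  fix z assume z: "walk (config_of \<epsilon>) z = - i"
  obtain j where j: "block_start \<epsilon> j \<le> z" "z < block_start \<epsilon> (j + 1)"
    using block_exists by blast
  define x where "x = nat (z - block_start \<epsilon> j)"
  have x: "z = block_start \<epsilon> j + int x" "x \<le> 2 * half_length (\<epsilon> j)"
    using j block_start_step[of \<epsilon> j] by (auto simp: x_def)
  have "0 \<le> \<epsilon> j ! x" using assms[rule_format, of j] x(2) by (auto simp: excursions_def half_length_def)
  with z walk_block[OF assms x(2)] walk_block_start[OF assms, of j] x(1) have "i \<le> j" by simp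
  from block_start_diff[OF this, of \<epsilon>] j(1) \<open>i \<le> j\<close> show "block_start \<epsilon> i \<le> z" by linarith
qed

definition mu_hat :: "(nat \<Rightarrow> real) \<Rightarrow> config measure" where
  "mu_hat \<alpha> = distr (PiM UNIV (\<lambda>_. exc_law \<alpha>)) config_space config_of"


section \<open>Invariance and the inverse Palm measure\<close>

definition record_translation_invariant :: "config measure \<Rightarrow> bool" where
  "record_translation_invariant M \<longleftrightarrow>
     (\<forall>i. \<forall>f :: config \<Rightarrow> real. f \<in> borel_measurable config_space \<and> bounded (range f) \<longrightarrow>
        (\<integral>\<eta>. f (shift (record_pos \<eta> i) \<eta>) \<partial>M) = (\<integral>\<eta>. f \<eta> \<partial>M))"

definition mean_record_distance :: "config measure \<Rightarrow> ennreal" where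
  "mean_record_distance M = (\<integral>\<^sup>+ \<eta>. ennreal (of_int (record_pos \<eta> 1)) \<partial>M)"

text \<open>The defining identity of the inverse Palm measure, for \<open>f\<close> the indicator function of \<open>B\<close>.\<close>

definition Palm_inv :: "config measure \<Rightarrow> config measure" where
  "Palm_inv M = measure_of (space config_space) (sets config_space)
     (\<lambda>B. (\<integral>\<^sup>+ \<eta>. (\<Sum>z\<in>{1..record_pos \<eta> 1}. indicator B (shift z \<eta>)) \<partial>M)
          / mean_record_distance M)"

definition translation_invariant :: "config measure \<Rightarrow> bool" where
  "translation_invariant M \<longleftrightarrow> (\<forall>y. distr M config_space (shift y) = M)"

definition BBS_invariant :: "config measure \<Rightarrow> bool" where
  "BBS_invariant M \<longleftrightarrow> (AE \<eta> in M. \<eta> \<in> subcritical) \<and> distr M config_space BBS = M"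

definition concentrates_on :: "config measure \<Rightarrow> config set \<Rightarrow> bool" where
  "concentrates_on M S \<longleftrightarrow> prob_space M \<and> (AE \<eta> in M. \<eta> \<in> S)"

end

theory Submission
  imports Defs
begin

text \<open>The soliton counts of a ball configuration are encoded by carriers of finite capacity. Let \<open>E\<^sub>l\<close> be
  the number of balls that find a carrier of capacity \<open>l\<close> full. Deleting a \<open>k\<close>-soliton replaces a
  pattern \<open>b\<^sup>k (\<not> b)\<^sup>k b\<^sup>k\<close> by \<open>b\<^sup>k\<close>, which does not change the load behind the pattern and lowers
  \<open>E\<^sub>l\<close> by \<open>max (k - l) 0\<close>; hence \<open>E\<^sub>l\<close> is the sum of \<open>n\<^sub>k max (k - l) 0\<close> over \<open>k\<close>, and the second
  differences of \<open>E\<close> are the soliton counts.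

  On \<open>N\<close> consecutive excursions the dynamics complements every excursion. A carrier on the
  complemented excursion mirrors the carrier on the excursion itself, so \<open>E\<^sub>l\<close> and thus the weight of
  the \<open>N\<close> excursions are preserved. Reversal of words shows that the dynamics is a bijection from the
  sequences whose \<open>j\<close>-th excursion has height at most \<open>N - 1 - j\<close> onto those whose \<open>j\<close>-th excursion
  has height at most \<open>j\<close>. Under the law of \<open>N\<close> independent excursions conditioned on either event the
  excursions stay independent, and all but a bounded number of them have almost the unconditioned
  law. Comparing the mean number of occurrences of a finite pattern per excursion, as \<open>N\<close> tends to
  infinity, gives the invariance of the inverse Palm measure; no ergodicity is needed.

  The densities come from the strong law of large numbers. For \<open>\<alpha>(q)\<close>, deleting all peaks of an
  excursion turns its soliton counts \<open>n\<^sub>k\<close> into \<open>n\<^bsub>k+1\<^esub>\<close>, and the excursions that yield a given one of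
  half length \<open>m\<close> have generating function \<open>1 / (1 - x)^(2 * m + 1)\<close> in the number of 1-solitons. This
  bounds the partition function and the mean length recursively by the shifted sequence of \<open>q\<close>.\<close>

section \<open>Carriers of finite capacity\<close>

text \<open>The obstacle is that the soliton algorithm makes global choices, while the dynamics
  displaces records, so that the excursions of the image are not images of single excursions. The
  energies \<open>spill l 0\<close> are read off letter by letter and can be followed through both.
  The height condition has a simple origin: a complemented excursion dips below its starting level
  by its height, and it must not reach the final level before the end, for otherwise the image does
  not split into the same number of excursions. The condition is severe near one end of the sequence
  only, at the opposite end after the step; statistics that are sums of local contributions
  therefore do not feel it on average. In the summability part, \<open>2 * m + 1\<close> counts the
  gaps of a word of length \<open>2 * m\<close> in which peaks can be inserted, and the factor
  \<open>(1 - q 1)^(2 * k)\<close> in \<open>alpha_of q (Suc k)\<close> is there to cancel all but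
  one of the resulting factors \<open>1 / (1 - q 1)\<close>.\<close>

fun load :: "nat \<Rightarrow> nat \<Rightarrow> bool list \<Rightarrow> nat" where
  "load l c [] = c"
| "load l c (True # w) = load l (min l (Suc c)) w"
| "load l c (False # w) = load l (c - 1) w"

fun spill :: "nat \<Rightarrow> nat \<Rightarrow> bool list \<Rightarrow> nat" where
  "spill l c [] = 0"
| "spill l c (True # w) = (if c < l then 0 else 1) + spill l (min l (Suc c)) w"
| "spill l c (False # w) = spill l (c - 1) w"

fun level :: "bool list \<Rightarrow> int" where
  "level [] = 0"
| "level (True # w) = level w + 1"
| "level (False # w) = level w - 1"

lemma load_append: "load l c (u @ v) = load l (load l c u) v"
  by (induction l c u rule: load.induct) auto

lemma spill_append: "spill l c (u @ v) = spill l c u + spill l (load l c u) v"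
  by (induction l c u rule: load.induct) auto

lemma level_append [simp]: "level (u @ v) = level u + level v"
  by (induction u rule: level.induct) auto

lemma level_Cons: "level (b # w) = (if b then 1 else -1) + level w"
  by (cases b) auto

lemma level_rev [simp]: "level (rev w) = level w"
  by (induction w rule: level.induct) auto

lemma level_map_Not [simp]: "level (map Not w) = - level w"
  by (induction w rule: level.induct) auto

lemma load_le: "c \<le> l \<Longrightarrow> load l c w \<le> l"
  by (induction l c w rule: load.induct) auto

lemma load_replicate_True: "c \<le> l \<Longrightarrow> load l c (replicate k True) = min l (c + k)"
  by (induction k arbitrary: c) (auto simp: min_def)

lemma load_replicate_False: "load l c (replicate k False) = c - k"
  by (induction k arbitrary: c) auto

lemma spill_replicate_True: "c \<le> l \<Longrightarrow> spill l c (replicate k True) = c + k - l"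
proof (induction k arbitrary: c)
  case (Suc k)
  show ?case
  proof (cases "c < l")
    case True
    with Suc.IH[of "Suc c"] show ?thesis by simp
  next
    case False
    with Suc.prems have "c = l" by simp
    with Suc.IH[of l] show ?thesis by simp
  qed
qed simp

lemma spill_replicate_False: "spill l c (replicate k False) = 0"
  by (induction k arbitrary: c) auto

lemmas carrier_simps = load_append spill_append load_replicate_True load_replicate_False
  spill_replicate_True spill_replicate_False

text \<open>The rest of the word is read with the same load in both cases, so the change stays
  local.\<close>

lemma spill_replace:
  assumes "load l (load l c u) x = load l (load l c u) y"
    and "spill l (load l c u) x = spill l (load l c u) y + a"
  shows "spill l c (u @ x @ v) = spill l c (u @ y @ v) + a"
  using assms by (simp add: spill_append load_append)

text \<open>From load \<open>d\<close>, both words lead to \<open>min l (d + k)\<close> if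
  \<open>b\<close> holds and to \<open>d - k\<close> otherwise. The extra spill comes from the block
  of \<open>k\<close> balls read right after \<open>k\<close> empty boxes: the carrier takes
  \<open>min k l\<close> of them.\<close>

lemma spill_soliton:
  assumes "c \<le> l"
  shows "spill l c (u @ replicate k b @ replicate k (\<not> b) @ replicate k b @ v)
       = spill l c (u @ replicate k b @ v) + (k - l)"
proof -
  have d: "load l c u \<le> l" by (rule load_le[OF assms])
  have "spill l c (u @ (replicate k b @ replicate k (\<not> b) @ replicate k b) @ v)
       = spill l c (u @ replicate k b @ v) + (k - l)"
    by (rule spill_replace; use d in \<open>cases b; auto simp: carrier_simps min_def\<close>)
  then show ?thesis by simp
qed

lemma spill_no_balls: "True \<notin> set w \<Longrightarrow> spill l c w = 0"
  by (induction l c w rule: spill.induct) auto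

lemma spill_0: "spill 0 0 w = count_list w True"
  by (induction w rule: level.induct) auto

lemma spill_large: "count_list w True + c \<le> l \<Longrightarrow> spill l c w = 0"
  by (induction l c w rule: spill.induct) auto

section \<open>Dyck words\<close>

definition dyck :: "bool list \<Rightarrow> bool" where
  "dyck w \<longleftrightarrow> level w = 0 \<and> (\<forall>i. 0 \<le> level (take i w))"

lemma dyck_Nil [simp]: "dyck []"
  by (simp add: dyck_def)

lemma take_rev': "take i (rev w) = rev (drop (length w - i) w)"
  by (metis append_take_drop_id diff_diff_cancel diff_is_0_eq' drop_0 linorder_not_le nat_less_le rev_take rev_rev_ident take_all length_rev)

lemma dyck_rev_Not: assumes "dyck w" shows "dyck (rev (map Not w))"
proof -
  have "0 \<le> level (take i (rev (map Not w)))" for i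
  proof -
    have "level (take (length w - i) w) + level (drop (length w - i) w) = 0"
      using assms level_append[of "take (length w - i) w" "drop (length w - i) w"] by (simp add: dyck_def)
    moreover have "0 \<le> level (take (length w - i) w)" using assms by (simp add: dyck_def)
    ultimately show ?thesis by (simp add: take_rev' drop_map del: rev_drop)
  qed
  with assms show ?thesis by (simp add: dyck_def)
qed

text \<open>A carrier follows the walk except that spilled balls are missing from it, so its load
  stays below the height. Nonnegativity excludes a down-step of the walk at height 0, where the load
  could not follow.\<close>

lemma load_dyck:
  assumes "c \<le> l" "\<forall>i. 0 \<le> int h + level (take i w)"
  shows "int c \<le> h \<Longrightarrow> int (load l c w) \<le> h + level w"
  using assms
proof (induction w arbitrary: c h)
  case (Cons b w)
  have h: "\<forall>i. 0 \<le> int h + level (take i (b # w))" by fact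
  show ?case
  proof (cases b)
    case True
    have "\<forall>i. 0 \<le> int (Suc h) + level (take i w)"
      using h[rule_format, of "Suc _"] True by (auto simp: algebra_simps)
    from Cons.IH[OF _ _ this, of "min l (Suc c)"] Cons.prems True show ?thesis
      by (simp add: algebra_simps)
  next
    case False
    from h[rule_format, of 1] False have "1 \<le> h" by simp
    have "\<forall>i. 0 \<le> int (h - 1) + level (take i w)"
      using h[rule_format, of "Suc _"] False \<open>1 \<le> h\<close> by (auto simp: algebra_simps)
    from Cons.IH[OF _ _ this, of "c - 1"] Cons.prems False \<open>1 \<le> h\<close>
    have "int (load l (c - 1) w) \<le> int (h - 1) + level w" by linarith
    with False \<open>1 \<le> h\<close> show ?thesis by simp
  qed
qed simp

lemma load_dyck_0: "dyck w \<Longrightarrow> load l 0 w = 0"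
  using load_dyck[of 0 l 0 w] by (simp add: dyck_def)

text \<open>The carrier started at \<open>d\<close> on the complemented word mirrors the carrier started at \<open>c\<close> from the
  first time the latter is full; before that time nothing spills on either side.\<close>

lemma spill_complement_aux:
  assumes "\<forall>i. 0 \<le> h + level (take i w)"
    and "d + c \<le> l" "h = int c + int e - int u" "u \<le> e" "d + c = l \<or> e = 0" "h + level w = 0"
  shows "u + spill l d (map Not w) = e + spill l c w"
  using assms
proof (induction w arbitrary: d c h e u)
  case Nil
  then show ?case by simp
next
  case (Cons b w)
  have h: "\<forall>i. 0 \<le> h + level (take i (b # w))" by fact
  show ?case
  proof (cases b)
    case True
    have *: "\<forall>i. 0 \<le> (h + 1) + level (take i w)"
      using h[rule_format, of "Suc _"] True by (auto simp: algebra_simps)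
    show ?thesis
    proof (cases "c < l")
      case True
      have "(d - 1) + Suc c \<le> l" "h + 1 = int (Suc c) + int e - int u"
        "(d - 1) + Suc c = l \<or> e = 0" "(h + 1) + level w = 0"
        using Cons.prems \<open>b\<close> True by auto
      from Cons.IH[OF * this(1,2) Cons.prems(4) this(3,4)] True \<open>b\<close> show ?thesis by simp
    next
      case False
      with Cons.prems have "c = l" "d = 0" by auto
      have "d + c \<le> l" "h + 1 = int c + int (e + 1) - int u" "u \<le> e + 1"
        "d + c = l \<or> e + 1 = 0" "(h + 1) + level w = 0"
        using Cons.prems \<open>b\<close> \<open>c = l\<close> \<open>d = 0\<close> by auto
      from Cons.IH[OF * this] \<open>c = l\<close> \<open>d = 0\<close> \<open>b\<close> show ?thesis by simp
    qed
  next
    case False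
    have *: "\<forall>i. 0 \<le> (h - 1) + level (take i w)"
      using h[rule_format, of "Suc _"] False by (auto simp: algebra_simps)
    from h[rule_format, of 1] False have h1: "1 \<le> h" by simp
    show ?thesis
    proof (cases "c = 0")
      case False
      have "Suc d + (c - 1) \<le> l" "h - 1 = int (c - 1) + int e - int u"
        "Suc d + (c - 1) = l \<or> e = 0" "(h - 1) + level w = 0"
        using Cons.prems \<open>\<not> b\<close> False by auto
      from Cons.IH[OF * this(1,2) Cons.prems(4) this(3,4)]
      have "u + spill l (Suc d) (map Not w) = e + spill l (c - 1) w" .
      moreover have "d < l" "min l (Suc d) = Suc d" using Cons.prems False by auto
      ultimately show ?thesis using \<open>\<not> b\<close> by simp
    next
      case True
      \<comment> \<open>An empty carrier at positive height \<open>h = e - u\<close> has spilled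
        before; hence the mirrored carrier is complementary to it, that is full, and spills
        now.\<close>
      with Cons.prems h1 have "e > 0" "d = l" by auto
      have "d + c \<le> l" "h - 1 = int c + int e - int (u + 1)" "u + 1 \<le> e"
        "d + c = l \<or> e = 0" "(h - 1) + level w = 0"
        using Cons.prems \<open>\<not> b\<close> True h1 by auto
      from Cons.IH[OF * this] True \<open>d = l\<close> \<open>\<not> b\<close> show ?thesis by simp
    qed
  qed
qed

text \<open>The load \<open>d\<close> is arbitrary because a carrier need not return empty from a
  complemented Dyck word and meets the next one with whatever it holds.\<close>

lemma spill_complement:
  assumes "dyck w" "d \<le> l"
  shows "spill l d (map Not w) = spill l 0 w"
  using spill_complement_aux[of 0 w d 0 l 0 0] assms by (simp add: dyck_def)

section \<open>The Takahashi--Satsuma algorithm\<close>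

lemma int_set_has_least:
  fixes X :: "int set"
  assumes "X \<noteq> {}" "\<forall>x\<in>X. b \<le> x"
  obtains m where "m \<in> X" "\<forall>x\<in>X. m \<le> x"
proof -
  obtain x0 where x0: "x0 \<in> X" using assms by blast
  have fin: "finite (X \<inter> {..x0})"
    by (rule finite_subset[of _ "{b..x0}"]) (use assms in auto)
  have ne: "X \<inter> {..x0} \<noteq> {}" using x0 by auto
  show ?thesis
  proof (rule that)
    show "Min (X \<inter> {..x0}) \<in> X" using Min_in[OF fin ne] by auto
    show "\<forall>x\<in>X. Min (X \<inter> {..x0}) \<le> x"
    proof
      fix x assume "x \<in> X"
      then show "Min (X \<inter> {..x0}) \<le> x"
        using Min_le[OF fin, of x] Min_le[OF fin, of x0] x0 by (cases "x \<le> x0") auto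
    qed
  qed
qed

lemma int_set_has_greatest:
  fixes X :: "int set"
  assumes "X \<noteq> {}" "\<forall>x\<in>X. x \<le> b"
  obtains m where "m \<in> X" "\<forall>x\<in>X. x \<le> m"
proof -
  obtain m where "m \<in> uminus ` X" "\<forall>x\<in>uminus ` X. m \<le> x"
    using int_set_has_least[of "uminus ` X" "- b"] assms by auto
  then show ?thesis using that[of "- m"] by (auto simp: minus_le_iff)
qed

text \<open>Used for the first \<open>k\<close> boxes of a run that may be infinite to the right,
  where \<open>card\<close> would be 0.\<close>

lemma int_set_initial_segment:
  fixes X :: "int set"
  assumes "\<forall>x\<in>X. b \<le> x" "1 \<le> k" "infinite X \<or> k \<le> card X"
  obtains j where "j \<in> X" "finite (X \<inter> {..j})" "card (X \<inter> {..j}) = k"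
proof -
  have "\<exists>j\<in>X. finite (X \<inter> {..j}) \<and> card (X \<inter> {..j}) = k"
    using assms(2,3)
  proof (induction k rule: dec_induct)
    case base
    then have "X \<noteq> {}" by auto
    then obtain m where m: "m \<in> X" "\<forall>x\<in>X. m \<le> x" using int_set_has_least assms(1) by metis
    then have "X \<inter> {..m} = {m}" by force
    with m show ?case by (intro bexI[of _ m]) auto
  next
    case (step k)
    then have "infinite X \<or> k \<le> card X" by auto
    with step.IH obtain j where j: "j \<in> X" "finite (X \<inter> {..j})" "card (X \<inter> {..j}) = k" by blast
    have "X \<inter> {j<..} \<noteq> {}"
    proof
      assume "X \<inter> {j<..} = {}"
      then have "X \<inter> {..j} = X" by auto
      with j step.prems show False by auto
    qed
    then obtain m where m: "m \<in> X \<inter> {j<..}" "\<forall>x\<in>X \<inter> {j<..}. m \<le> x"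
      using int_set_has_least[of "X \<inter> {j<..}" b] assms(1) by auto
    have "X \<inter> {..m} = insert m (X \<inter> {..j})" using m by force
    with j m show ?case by (intro bexI[of _ m]) auto
  qed
  then show ?thesis using that by blast
qed

lemma int_set_final_segment:
  fixes X :: "int set"
  assumes "\<forall>x\<in>X. x \<le> b" "1 \<le> k" "infinite X \<or> k \<le> card X"
  obtains j where "j \<in> X" "finite (X \<inter> {j..})" "card (X \<inter> {j..}) = k"
proof -
  have inj: "inj_on uminus Y" for Y :: "int set" by simp
  have "infinite (uminus ` X) \<or> k \<le> card (uminus ` X)"
    using assms(3) by (simp add: card_image finite_image_iff)
  then obtain j where j: "j \<in> uminus ` X" "finite (uminus ` X \<inter> {..j})" "card (uminus ` X \<inter> {..j}) = k"
    using int_set_initial_segment[of "uminus ` X" "- b" k] assms by auto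
  have "uminus ` X \<inter> {..j} = uminus ` (X \<inter> {- j..})" by force
  with j show ?thesis using that[of "- j"]
    by (auto simp: card_image finite_image_iff)
qed

lemma sorted_list_of_set_Un_less:
  fixes X Y :: "int set"
  assumes "finite X" "finite Y" "\<forall>x\<in>X. \<forall>y\<in>Y. x < y"
  shows "sorted_list_of_set (X \<union> Y) = sorted_list_of_set X @ sorted_list_of_set Y"
proof (rule sorted_distinct_set_unique)
  show "sorted (sorted_list_of_set X @ sorted_list_of_set Y)"
    using assms by (auto simp: sorted_append less_imp_le)
  show "distinct (sorted_list_of_set X @ sorted_list_of_set Y)"
    using assms by auto
qed (use assms in auto)

definition box_word :: "config \<Rightarrow> int set \<Rightarrow> bool list" where
  "box_word \<eta> X = map \<eta> (sorted_list_of_set X)"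

lemma box_word_Un_less:
  "finite X \<Longrightarrow> finite Y \<Longrightarrow> \<forall>x\<in>X. \<forall>y\<in>Y. x < y \<Longrightarrow>
    box_word \<eta> (X \<union> Y) = box_word \<eta> X @ box_word \<eta> Y"
  by (simp add: box_word_def sorted_list_of_set_Un_less)

lemma box_word_const:
  assumes "finite X" "\<forall>x\<in>X. \<eta> x = b"
  shows "box_word \<eta> X = replicate (card X) b"
proof -
  have "map \<eta> (sorted_list_of_set X) = map (\<lambda>_. b) (sorted_list_of_set X)"
    using assms by (intro map_cong) auto
  then show ?thesis by (simp add: box_word_def map_replicate_const assms(1))
qed

section \<open>Runs among the remaining boxes\<close>

definition run_of :: "config \<Rightarrow> int set \<Rightarrow> int \<Rightarrow> int set" where
  "run_of \<eta> A x = {y \<in> A. \<forall>z\<in>A. min x y \<le> z \<and> z \<le> max x y \<longrightarrow> \<eta> z = \<eta> x}"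

lemma mem_run_of: "x \<in> A \<Longrightarrow> x \<in> run_of \<eta> A x"
proof -
  assume x: "x \<in> A"
  have "z = x" if "min x x \<le> z \<and> z \<le> max x x" for z using that by simp
  with x show ?thesis unfolding run_of_def by blast
qed

lemma run_of_subset: "run_of \<eta> A x \<subseteq> A"
  unfolding run_of_def by blast

lemma run_of_const:
  assumes "y \<in> run_of \<eta> A x"
  shows "\<eta> y = \<eta> x"
proof -
  have "min x y \<le> y \<and> y \<le> max x y" by simp
  with assms show ?thesis unfolding run_of_def by blast
qed

lemma run_of_between:
  assumes "y1 \<in> run_of \<eta> A x" "y2 \<in> run_of \<eta> A x" "z \<in> A" "y1 \<le> z" "z \<le> y2"
  shows "z \<in> run_of \<eta> A x"
proof -
  have "\<eta> z' = \<eta> x" if z': "z' \<in> A" "min x z \<le> z'" "z' \<le> max x z" for z'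
  proof -
    have "min x y1 \<le> z' \<and> z' \<le> max x y1 \<or> min x y2 \<le> z' \<and> z' \<le> max x y2"
      using z'(2,3) assms(4,5) by linarith
    with assms(1,2) z'(1) show ?thesis unfolding run_of_def by blast
  qed
  with assms(3) show ?thesis unfolding run_of_def by blast
qed

lemma constant_interval_run_of:
  assumes "x \<in> A" shows "constant_interval \<eta> A (run_of \<eta> A x)"
  unfolding constant_interval_def
proof (intro conjI ballI impI)
  show "run_of \<eta> A x \<noteq> {}" using mem_run_of[OF assms] by blast
  show "run_of \<eta> A x \<subseteq> A" by (rule run_of_subset)
  show "\<eta> y = \<eta> z" if "y \<in> run_of \<eta> A x" "z \<in> run_of \<eta> A x" for y z
    using that[THEN run_of_const] by simp
  show "z \<in> run_of \<eta> A x" if "y1 \<in> run_of \<eta> A x" "y2 \<in> run_of \<eta> A x" "z \<in> A" "y1 \<le> z \<and> z \<le> y2"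
    for y1 y2 z using run_of_between that by blast
qed

lemma constant_interval_subset_run_of:
  assumes "constant_interval \<eta> A J" "x \<in> J"
  shows "J \<subseteq> run_of \<eta> A x"
proof
  fix y assume y: "y \<in> J"
  have J: "J \<subseteq> A" "\<And>x y z. x \<in> J \<Longrightarrow> y \<in> J \<Longrightarrow> z \<in> A \<Longrightarrow> x \<le> z \<Longrightarrow> z \<le> y \<Longrightarrow> z \<in> J"
    "\<And>x y. x \<in> J \<Longrightarrow> y \<in> J \<Longrightarrow> \<eta> x = \<eta> y"
    using assms(1) unfolding constant_interval_def by blast+
  have "\<eta> z = \<eta> x" if "z \<in> A" "min x y \<le> z" "z \<le> max x y" for z
  proof -
    have "z \<in> J" using J(2)[of "min x y" "max x y" z] that y assms(2) by (auto simp: min_def max_def)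
    then show ?thesis using J(3) assms(2) by blast
  qed
  then show "y \<in> run_of \<eta> A x" using y J(1) unfolding run_of_def by blast
qed

text \<open>Every constant interval through \<open>x\<close> is contained in
  \<open>run_of \<eta> A x\<close>, which is itself one. Hence a run is determined by any of its
  boxes.\<close>

lemma is_run_eq_run_of:
  assumes "is_run \<eta> A I" "x \<in> I"
  shows "I = run_of \<eta> A x"
proof -
  have I: "constant_interval \<eta> A I" "\<And>J. constant_interval \<eta> A J \<Longrightarrow> I \<subseteq> J \<Longrightarrow> J = I"
    using assms(1) unfolding is_run_def by blast+
  have "x \<in> A" using I(1) assms(2) unfolding constant_interval_def by blast
  from I(2)[OF constant_interval_run_of[OF this] constant_interval_subset_run_of[OF I(1) assms(2)]]
  show ?thesis by simp
qed

lemma is_run_run_of: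
  assumes "x \<in> A" shows "is_run \<eta> A (run_of \<eta> A x)"
  unfolding is_run_def
proof (intro conjI allI impI)
  show "constant_interval \<eta> A (run_of \<eta> A x)" by (rule constant_interval_run_of[OF assms])
  fix J assume J: "constant_interval \<eta> A J \<and> run_of \<eta> A x \<subseteq> J"
  then have "J \<subseteq> run_of \<eta> A x"
    using constant_interval_subset_run_of[of \<eta> A J x] mem_run_of[OF assms] by blast
  with J show "J = run_of \<eta> A x" by blast
qed

lemma is_run_nonempty: "is_run \<eta> A I \<Longrightarrow> I \<noteq> {}" and is_run_subset: "is_run \<eta> A I \<Longrightarrow> I \<subseteq> A"
  unfolding is_run_def constant_interval_def by blast+

lemma run_of_infinite_left:
  assumes "x \<in> A" "\<forall>z\<le>x. z \<in> A \<and> \<eta> z = \<eta> x"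
  shows "infinite (run_of \<eta> A x)"
proof
  assume "finite (run_of \<eta> A x)"
  moreover have "{..x} \<subseteq> run_of \<eta> A x"
  proof
    fix y assume "y \<in> {..x}"
    then have "z \<le> x" if "min x y \<le> z \<and> z \<le> max x y" for z
      using that by simp
    with \<open>y \<in> {..x}\<close> assms(2) show "y \<in> run_of \<eta> A x" unfolding run_of_def by blast
  qed
  ultimately have "finite {..x}" by (rule finite_subset[rotated])
  then show False by (simp add: infinite_Iic)
qed

text \<open>The run of a ball consists of balls, of which there are finitely many; without balls the
  only run is all of \<open>A\<close>, which is infinite. So the algorithm stops exactly when every
  ball has been deleted.\<close>

lemma has_finite_run_iff:
  assumes "finite (- A)" "finite {z. \<eta> z}"
  shows "has_finite_run \<eta> A \<longleftrightarrow> (\<exists>z\<in>A. \<eta> z)"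
proof
  assume "\<exists>z\<in>A. \<eta> z"
  then obtain z where z: "z \<in> A" "\<eta> z" by blast
  have "run_of \<eta> A z \<subseteq> {z. \<eta> z}" using run_of_const[of _ \<eta> A z] z(2) by auto
  then show "has_finite_run \<eta> A"
    unfolding has_finite_run_def using is_run_run_of[OF z(1)] assms(2) finite_subset by metis
next
  assume "has_finite_run \<eta> A"
  then obtain I where I: "is_run \<eta> A I" "finite I" unfolding has_finite_run_def by blast
  obtain x where x: "x \<in> I" using is_run_nonempty[OF I(1)] by blast
  show "\<exists>z\<in>A. \<eta> z"
  proof (rule ccontr)
    assume no: "\<not> (\<exists>z\<in>A. \<eta> z)"
    have "x \<in> A" using is_run_subset[OF I(1)] x by blast
    then have "A \<subseteq> run_of \<eta> A x" using no unfolding run_of_def by blast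
    then have "finite A" using I x is_run_eq_run_of finite_subset by metis
    with assms(1) show False
      by (metis Compl_partition finite_UnI infinite_UNIV_int)
  qed
qed

text \<open>The boxes deleted in one step form the middle of a pattern
  \<open>\<not>b\<^sup>k b\<^sup>k \<not>b\<^sup>k\<close>, since both neighbouring runs have size at least \<open>k\<close>.\<close>

lemma next_soliton_pattern:
  assumes cofin: "finite (- A)" and fin: "finite {z. \<eta> z}" and hfr: "has_finite_run \<eta> A"
  defines "k \<equiv> min_run_size \<eta> A"
  obtains b p i1 i2 j where "1 \<le> k" "p < i1" "i1 \<le> i2" "i2 < j"
    "card (A \<inter> {p..<i1}) = k" "card (A \<inter> {i1..i2}) = k" "card (A \<inter> {i2<..j}) = k"
    "\<forall>z\<in>A \<inter> {p..<i1}. \<eta> z = (\<not> b)" "\<forall>z\<in>A \<inter> {i1..i2}. \<eta> z = b" "\<forall>z\<in>A \<inter> {i2<..j}. \<eta> z = (\<not> b)"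
    "next_soliton \<eta> A = A \<inter> {i1..j}"
proof -
  let ?P = "\<lambda>I. is_run \<eta> A I \<and> finite I \<and> card I = k"
  have "\<exists>k I. is_run \<eta> A I \<and> finite I \<and> card I = k" using hfr by (auto simp: has_finite_run_def)
  then have "\<exists>I. ?P I" unfolding k_def min_run_size_def by (rule LeastI_ex)
  then obtain I0 where I0: "?P I0" by blast
  have min: "k \<le> card J" if "is_run \<eta> A J" "finite J" for J
    unfolding k_def min_run_size_def by (rule Least_le) (use that in blast)
  have k1: "1 \<le> k" using I0 is_run_nonempty by (metis One_nat_def Suc_leI card_gt_0_iff)
  \<comment> \<open>Far to the left all boxes remain and are empty, so the leftmost run is infinite.
    Finite runs therefore start at \<open>B\<close> or later, and a leftmost one of size
    \<open>k\<close> exists.\<close>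
  obtain B where B: "\<forall>z<B. z \<in> A \<and> \<not> \<eta> z"
  proof -
    have "finite (- A \<union> {z. \<eta> z})" using cofin fin by auto
    then obtain B where "\<forall>z\<in>- A \<union> {z. \<eta> z}. B \<le> z"
      by (meson bdd_below.unfold bdd_below_finite)
    then show ?thesis using that[of B] by force
  qed
  have bound: "B \<le> Min I" if "is_run \<eta> A I" "finite I" for I
  proof (rule ccontr)
    assume "\<not> B \<le> Min I"
    moreover have x: "Min I \<in> I" using that is_run_nonempty by auto
    ultimately have "infinite (run_of \<eta> A (Min I))"
      using B by (intro run_of_infinite_left) auto
    with is_run_eq_run_of[OF that(1) x] that(2) show False by simp
  qed
  have inA: "\<exists>z\<in>A. z < x" for x
    using B by (intro bexI[of _ "min (x - 1) (B - 1)"]) auto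
  have supA: "\<exists>z\<in>A. x < z" for x
  proof -
    obtain C where C: "\<forall>z\<in>- A. z \<le> C"
      using cofin by (meson bdd_above.unfold bdd_above_finite)
    then have "max (x + 1) (C + 1) \<in> A" by force
    then show ?thesis by (intro bexI[of _ "max (x + 1) (C + 1)"]) auto
  qed
  obtain m where m: "m \<in> Min ` {I. ?P I}" "\<forall>x\<in>Min ` {I. ?P I}. m \<le> x"
    by (rule int_set_has_least[of "Min ` {I. ?P I}" B]) (use I0 bound in auto)
  then obtain I where I: "is_run \<eta> A I" "finite I" "card I = k" "m = Min I" by blast
  have Ine: "I \<noteq> {}" using I is_run_nonempty by blast
  have lmr: "leftmost_min_run \<eta> A = I"
    unfolding leftmost_min_run_def k_def[symmetric]
  proof (rule the_equality)
    show "is_run \<eta> A I \<and> finite I \<and> card I = k \<and>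
      (\<forall>J. is_run \<eta> A J \<and> finite J \<and> card J = k \<longrightarrow> Min I \<le> Min J)"
      using I m by auto
  next
    fix J assume J: "is_run \<eta> A J \<and> finite J \<and> card J = k \<and>
      (\<forall>J'. is_run \<eta> A J' \<and> finite J' \<and> card J' = k \<longrightarrow> Min J \<le> Min J')"
    then have "Min I = Min J" using I m by (intro antisym) auto
    moreover have "Min I \<in> I" "Min J \<in> J" using Ine J I is_run_nonempty by auto
    ultimately show "J = I" using is_run_eq_run_of I J by metis
  qed
  define i1 i2 where "i1 = Min I" and "i2 = Max I"
  have i12: "i1 \<in> I" "i2 \<in> I" "i1 \<le> i2" "\<And>x. x \<in> I \<Longrightarrow> i1 \<le> x \<and> x \<le> i2"
    using Ine I by (auto simp: i1_def i2_def)
  have IA: "I \<subseteq> A" using I is_run_subset by blast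
  have Ieq: "I = A \<inter> {i1..i2}"
  proof -
    have "z \<in> I" if "z \<in> A" "i1 \<le> z" "z \<le> i2" for z
      using I(1) i12 that unfolding is_run_def constant_interval_def by blast
    with IA i12 show ?thesis by auto
  qed
  define b where "b = \<eta> i1"
  have Ib: "\<eta> x = b" if "x \<in> I" for x
    using run_of_const[of x \<eta> A i1] is_run_eq_run_of[OF I(1) i12(1)] IA i12(1) that b_def by auto
  \<comment> \<open>The first remaining box behind the run; by maximality of the run its content
    differs, so the run of \<open>z0\<close> is the next run.\<close>
  obtain z0 where z0: "z0 \<in> A \<inter> {i2<..}" "\<forall>x\<in>A \<inter> {i2<..}. z0 \<le> x"
    by (rule int_set_has_least[of "A \<inter> {i2<..}" i2]) (use supA[of i2] in auto)
  have z0b: "\<eta> z0 = (\<not> b)"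
  proof (rule ccontr)
    assume "\<eta> z0 \<noteq> (\<not> b)"
    then have "\<eta> z0 = \<eta> i2" using Ib[OF i12(2)] by auto
    moreover have "z = i2 \<or> z = z0" if "z \<in> A" "i2 \<le> z" "z \<le> z0" for z
      using z0 that by force
    then have "\<eta> z = \<eta> i2" if "z \<in> A" "min i2 z0 \<le> z \<and> z \<le> max i2 z0" for z
      using that z0 calculation by (auto simp: min_def max_def)
    ultimately have "z0 \<in> run_of \<eta> A i2" using z0 unfolding run_of_def by blast
    then have "z0 \<in> I" using is_run_eq_run_of[OF I(1) i12(2)] by simp
    then show False using i12 z0 by force
  qed
  define J where "J = run_of \<eta> A z0"
  have J: "is_run \<eta> A J" "z0 \<in> J" "J \<subseteq> A"
    using is_run_run_of[of z0 A \<eta>] mem_run_of[of z0 A \<eta>] z0 run_of_subset by (simp_all add: J_def)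
  have Jb: "\<eta> x = (\<not> b)" if "x \<in> J" for x
    using run_of_const[of x \<eta> A z0] z0 z0b that J_def by auto
  have Jgt: "i2 < x" if "x \<in> J" for x
  proof (rule ccontr)
    assume "\<not> i2 < x"
    then have "i2 \<in> J" using run_of_between[of x \<eta> A z0 z0 i2] that J z0 IA i12
      by (auto simp: J_def)
    then show False using Jb Ib i12 by blast
  qed
  have Jinit: "z \<in> J" if "z \<in> A" "i2 < z" "z \<le> x" "x \<in> J" for z x
    using run_of_between[of z0 \<eta> A z0 x z] z0(2) that J(2) unfolding J_def by simp
  have nr: "next_run \<eta> A I = J"
    unfolding next_run_def
  proof (rule the_equality)
    show "is_run \<eta> A J \<and> (\<forall>x\<in>I. \<forall>y\<in>J. x < y) \<and> (\<forall>z\<in>A. (\<forall>x\<in>I. x < z) \<longrightarrow> (\<exists>y\<in>J. y \<le> z))"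
    proof (intro conjI ballI impI)
      show "is_run \<eta> A J" by fact
      show "x < y" if "x \<in> I" "y \<in> J" for x y
        using i12(4)[OF that(1)] Jgt[OF that(2)] by simp
      show "\<exists>y\<in>J. y \<le> z" if "z \<in> A" "\<forall>x\<in>I. x < z" for z
        using that i12(2) z0(2) J(2) by blast
    qed
  next
    fix J' assume J': "is_run \<eta> A J' \<and> (\<forall>x\<in>I. \<forall>y\<in>J'. x < y) \<and>
      (\<forall>z\<in>A. (\<forall>x\<in>I. x < z) \<longrightarrow> (\<exists>y\<in>J'. y \<le> z))"
    have "x < z0" if "x \<in> I" for x using z0(1) i12(4)[OF that] by simp
    then obtain y where y: "y \<in> J'" "y \<le> z0" using J' z0 by blast
    have "i2 < y" "y \<in> A" using J' y i12 is_run_subset by blast+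
    then have "y = z0" using z0(2) y(2) by (simp add: antisym)
    then show "J' = J" using is_run_eq_run_of[of \<eta> A J' y] J' y(1) unfolding J_def by blast
  qed
  \<comment> \<open>The size \<open>k\<close> is minimal among the finite runs only; an infinite
    next run is long enough anyway.\<close>
  have "infinite J \<or> k \<le> card J" using min J by blast
  then obtain j where j: "j \<in> J" "finite (J \<inter> {..j})" "card (J \<inter> {..j}) = k"
    using int_set_initial_segment[of J i2 k] Jgt k1 by (metis less_imp_le)
  have Jj: "J \<inter> {..j} = A \<inter> {i2<..j}" using J Jgt Jinit j by auto
  have Jk: "{z \<in> J. card {y \<in> J. y \<le> z} \<le> k} = J \<inter> {..j}"
  proof -
    have eq: "{y \<in> J. y \<le> z} = J \<inter> {..z}" for z by auto
    have finz: "finite (J \<inter> {..z})" for z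
      by (rule finite_subset[of _ "{i2..z}"]) (use Jgt in force)+
    have "card (J \<inter> {..z}) \<le> k" if "z \<le> j" for z
      using card_mono[OF finz[of j], of "J \<inter> {..z}"] that j by fastforce
    moreover have "\<not> card (J \<inter> {..z}) \<le> k" if "z \<in> J" "j < z" for z
    proof -
      have "insert z (J \<inter> {..j}) \<subseteq> J \<inter> {..z}" using that by auto
      from card_mono[OF finz this] j that show ?thesis by simp
    qed
    ultimately show ?thesis by (auto simp: eq not_le[symmetric])
  qed
  \<comment> \<open>The run in front is not part of the soliton. Its last \<open>k\<close> boxes
    supply the block that survives in \<open>spill_soliton\<close>.\<close>
  obtain p0 where p0: "p0 \<in> A \<inter> {..<i1}" "\<forall>x\<in>A \<inter> {..<i1}. x \<le> p0"
    by (rule int_set_has_greatest[of "A \<inter> {..<i1}" i1]) (use inA[of i1] in auto)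
  have p0b: "\<eta> p0 = (\<not> b)"
  proof (rule ccontr)
    assume "\<eta> p0 \<noteq> (\<not> b)"
    then have "\<eta> p0 = \<eta> i1" using Ib[OF i12(1)] by auto
    moreover have "z = i1 \<or> z = p0" if "z \<in> A" "p0 \<le> z" "z \<le> i1" for z
      using p0 that by force
    then have "\<eta> z = \<eta> i1" if "z \<in> A" "min i1 p0 \<le> z \<and> z \<le> max i1 p0" for z
      using that p0 calculation by (auto simp: min_def max_def)
    ultimately have "p0 \<in> run_of \<eta> A i1" using p0 unfolding run_of_def by blast
    then have "p0 \<in> I" using is_run_eq_run_of[OF I(1) i12(1)] by simp
    then show False using i12 p0 by force
  qed
  define P where "P = run_of \<eta> A p0"
  have P: "is_run \<eta> A P" "p0 \<in> P" "P \<subseteq> A"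
    using is_run_run_of[of p0 A \<eta>] mem_run_of[of p0 A \<eta>] p0 run_of_subset by (simp_all add: P_def)
  have Pb: "\<eta> x = (\<not> b)" if "x \<in> P" for x
    using run_of_const[of x \<eta> A p0] p0 p0b that P_def by auto
  have Plt: "x < i1" if "x \<in> P" for x
  proof (rule ccontr)
    assume "\<not> x < i1"
    then have "i1 \<in> P" using run_of_between[of p0 \<eta> A p0 x i1] that P p0 IA i12
      by (auto simp: P_def)
    then show False using Pb Ib i12 by blast
  qed
  have Pfinal: "z \<in> P" if "z \<in> A" "z < i1" "x \<le> z" "x \<in> P" for z x
    using run_of_between[of x \<eta> A p0 p0 z] p0(2) that P(2) unfolding P_def by simp
  have "infinite P \<or> k \<le> card P" using min P by blast
  then obtain p where p: "p \<in> P" "finite (P \<inter> {p..})" "card (P \<inter> {p..}) = k"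
    using int_set_final_segment[of P i1 k] Plt k1 by (metis less_imp_le)
  have Pp: "P \<inter> {p..} = A \<inter> {p..<i1}" using P Plt Pfinal p by auto
  have "next_soliton \<eta> A = I \<union> (J \<inter> {..j})"
    unfolding next_soliton_def Let_def lmr nr k_def[symmetric] Jk ..
  also have "\<dots> = A \<inter> {i1..j}"
    unfolding Jj using Ieq i12(3) Jgt[OF j(1)] by auto
  finally have "next_soliton \<eta> A = A \<inter> {i1..j}" .
  moreover have "\<forall>z\<in>A \<inter> {p..<i1}. \<eta> z = (\<not> b)" using Pb unfolding Pp[symmetric] by blast
  moreover have "\<forall>z\<in>A \<inter> {i2<..j}. \<eta> z = (\<not> b)" using Jb unfolding Jj[symmetric] by blast
  moreover have "\<forall>z\<in>A \<inter> {i1..i2}. \<eta> z = b" using Ib unfolding Ieq[symmetric] by blast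
  ultimately show ?thesis
    using that k1 Plt[OF p(1)] i12(3) Jgt[OF j(1)] p(3)[unfolded Pp] j(3)[unfolded Jj] I(3)[unfolded Ieq]
    by blast
qed

text \<open>Of the three blocks of the pattern the last two are deleted. Any finite window that
  contains the pattern shows the same loss of energy, so later windows may be enlarged at
  will.\<close>

lemma box_word_next_soliton:
  assumes "finite (- A)" "finite {z. \<eta> z}" "has_finite_run \<eta> A"
  defines "k \<equiv> min_run_size \<eta> A"
  obtains lo hi where "1 \<le> k" "finite (next_soliton \<eta> A)" 
    "\<And>lo' hi' l. lo' \<le> lo \<Longrightarrow> hi \<le> hi' \<Longrightarrow> spill l 0 (box_word \<eta> (A \<inter> {lo'..hi'}))
       = spill l 0 (box_word \<eta> ((A - next_soliton \<eta> A) \<inter> {lo'..hi'})) + (k - l)"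
proof -
  obtain b p i1 i2 j where k: "1 \<le> k" and ord: "p < i1" "i1 \<le> i2" "i2 < j"
    and c: "card (A \<inter> {p..<i1}) = k" "card (A \<inter> {i1..i2}) = k" "card (A \<inter> {i2<..j}) = k"
    and v: "\<forall>z\<in>A \<inter> {p..<i1}. \<eta> z = (\<not> b)" "\<forall>z\<in>A \<inter> {i1..i2}. \<eta> z = b" "\<forall>z\<in>A \<inter> {i2<..j}. \<eta> z = (\<not> b)"
    and ns: "next_soliton \<eta> A = A \<inter> {i1..j}"
    unfolding k_def by (rule next_soliton_pattern[OF assms(1-3)])
  show ?thesis
  proof (rule that[of p j])
    fix lo hi l assume lo: "lo \<le> p" "j \<le> hi"
    let ?B = "box_word \<eta> (A \<inter> {lo..<p})" and ?C = "box_word \<eta> (A \<inter> {j<..hi})"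
    have "A \<inter> {lo..hi} = (A \<inter> {lo..<p}) \<union> ((A \<inter> {p..<i1}) \<union>
      ((A \<inter> {i1..i2}) \<union> ((A \<inter> {i2<..j}) \<union> (A \<inter> {j<..hi}))))"
      using lo ord by auto
    also have "box_word \<eta> \<dots> = ?B @ box_word \<eta> (A \<inter> {p..<i1}) @ box_word \<eta> (A \<inter> {i1..i2}) @
      box_word \<eta> (A \<inter> {i2<..j}) @ ?C"
    proof -
      have "box_word \<eta> ((A \<inter> {i2<..j}) \<union> (A \<inter> {j<..hi})) = box_word \<eta> (A \<inter> {i2<..j}) @ ?C"
        by (rule box_word_Un_less) auto
      moreover have "box_word \<eta> ((A \<inter> {i1..i2}) \<union> ((A \<inter> {i2<..j}) \<union> (A \<inter> {j<..hi})))
        = box_word \<eta> (A \<inter> {i1..i2}) @ box_word \<eta> ((A \<inter> {i2<..j}) \<union> (A \<inter> {j<..hi}))"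
        by (rule box_word_Un_less) (use ord in auto)
      moreover have "box_word \<eta> ((A \<inter> {p..<i1}) \<union> ((A \<inter> {i1..i2}) \<union> ((A \<inter> {i2<..j}) \<union> (A \<inter> {j<..hi}))))
        = box_word \<eta> (A \<inter> {p..<i1}) @ box_word \<eta> ((A \<inter> {i1..i2}) \<union> ((A \<inter> {i2<..j}) \<union> (A \<inter> {j<..hi})))"
        by (rule box_word_Un_less) (use ord in auto)
      moreover have "box_word \<eta> ((A \<inter> {lo..<p}) \<union> ((A \<inter> {p..<i1}) \<union>
          ((A \<inter> {i1..i2}) \<union> ((A \<inter> {i2<..j}) \<union> (A \<inter> {j<..hi})))))
        = ?B @ box_word \<eta> ((A \<inter> {p..<i1}) \<union> ((A \<inter> {i1..i2}) \<union> ((A \<inter> {i2<..j}) \<union> (A \<inter> {j<..hi}))))"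
        by (rule box_word_Un_less) (use ord in auto)
      ultimately show ?thesis by (simp only:)
    qed
    \<comment> \<open>The double negation brings the middle block into the form of
      \<open>spill_soliton\<close> taken at \<open>\<not> b\<close>.\<close>
    also have "\<dots> = ?B @ replicate k (\<not> b) @ replicate k (\<not> \<not> b) @ replicate k (\<not> b) @ ?C"
      using box_word_const[OF _ v(1)] box_word_const[OF _ v(2)] box_word_const[OF _ v(3)] c by simp
    finally have 1: "box_word \<eta> (A \<inter> {lo..hi})
      = ?B @ replicate k (\<not> b) @ replicate k (\<not> \<not> b) @ replicate k (\<not> b) @ ?C" .
    have "(A - next_soliton \<eta> A) \<inter> {lo..hi} = (A \<inter> {lo..<p}) \<union> ((A \<inter> {p..<i1}) \<union> (A \<inter> {j<..hi}))"
      unfolding ns using lo ord by auto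
    also have "box_word \<eta> \<dots> = ?B @ box_word \<eta> (A \<inter> {p..<i1}) @ ?C"
    proof -
      have "box_word \<eta> ((A \<inter> {p..<i1}) \<union> (A \<inter> {j<..hi})) = box_word \<eta> (A \<inter> {p..<i1}) @ ?C"
        by (rule box_word_Un_less) (use ord in auto)
      moreover have "box_word \<eta> ((A \<inter> {lo..<p}) \<union> ((A \<inter> {p..<i1}) \<union> (A \<inter> {j<..hi})))
        = ?B @ box_word \<eta> ((A \<inter> {p..<i1}) \<union> (A \<inter> {j<..hi}))"
        by (rule box_word_Un_less) (use ord in auto)
      ultimately show ?thesis by (simp only:)
    qed
    also have "\<dots> = ?B @ replicate k (\<not> b) @ ?C"
      using box_word_const[OF _ v(1)] c by simp
    finally show "spill l 0 (box_word \<eta> (A \<inter> {lo..hi}))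
       = spill l 0 (box_word \<eta> ((A - next_soliton \<eta> A) \<inter> {lo..hi})) + (k - l)"
      unfolding 1 by (simp only: spill_soliton[OF le0])
  qed (use k ns in auto)
qed

section \<open>Excursions as words\<close>

definition steps :: "int list \<Rightarrow> bool list" where
  "steps e = map (\<lambda>i. e ! i < e ! Suc i) [0..<length e - 1]"

lemma length_steps: "e \<in> excursions \<Longrightarrow> length (steps e) = 2 * half_length e"
  by (auto simp: steps_def excursions_def half_length_def)

lemma excursion_step:
  assumes "e \<in> excursions" "i < 2 * half_length e"
  shows "e ! Suc i = e ! i + (if steps e ! i then 1 else -1)"
proof -
  from assms have "Suc i \<in> {1..2 * half_length e}" by auto
  with assms have "\<bar>e ! Suc i - e ! (Suc i - 1)\<bar> = 1"
    unfolding excursions_def half_length_def by fastforce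
  with assms show ?thesis by (auto simp: steps_def half_length_def)
qed

lemma ball_config_steps:
  assumes "e \<in> excursions"
  shows "ball_config e z \<longleftrightarrow> 1 \<le> z \<and> z \<le> 2 * int (half_length e) \<and> steps e ! nat (z - 1)"
proof (cases "1 \<le> z \<and> z \<le> 2 * int (half_length e)")
  case True
  define i where "i = nat (z - 1)"
  have z: "nat z = Suc i" "nat (z - 1) = i" "i < 2 * half_length e" using True by (auto simp: i_def)
  from excursion_step[OF assms z(3)] z True show ?thesis by (auto simp: ball_config_def)
qed (auto simp: ball_config_def)

lemma sorted_list_of_set_int: "sorted_list_of_set {1..int m} = map (\<lambda>i. int i + 1) [0..<m]"
proof (rule sorted_distinct_set_unique)
  show "set (sorted_list_of_set {1..int m}) = set (map (\<lambda>i. int i + 1) [0..<m])"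
    using image_iff by (force simp: image_def intro: bexI[of _ "nat (_ - 1)"])
qed (auto simp: sorted_map distinct_map inj_on_def sorted_wrt_iff_nth_less)

text \<open>The empty boxes around the excursion do not change the energy, so windows of the
  configuration have the energy of \<open>steps e\<close>.\<close>

lemma box_word_ball_config:
  assumes e: "e \<in> excursions" and "lo \<le> 1" "2 * int (half_length e) \<le> hi"
  shows "box_word (ball_config e) {lo..hi}
    = replicate (nat (1 - lo)) False @ steps e @ replicate (nat (hi - 2 * int (half_length e))) False"
proof -
  let ?n = "2 * half_length e"
  have "{lo..hi} = {lo..0} \<union> ({1..int ?n} \<union> {int ?n + 1..hi})" using assms by auto
  then have "box_word (ball_config e) {lo..hi} = box_word (ball_config e) {lo..0} @
      box_word (ball_config e) ({1..int ?n} \<union> {int ?n + 1..hi})"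
    by (simp only:) (rule box_word_Un_less; auto)
  also have "box_word (ball_config e) ({1..int ?n} \<union> {int ?n + 1..hi})
      = box_word (ball_config e) {1..int ?n} @ box_word (ball_config e) {int ?n + 1..hi}"
    by (rule box_word_Un_less) auto
  also have "box_word (ball_config e) {1..int ?n} = steps e"
    by (rule nth_equalityI)
       (auto simp: box_word_def sorted_list_of_set_int length_steps[OF e] ball_config_steps[OF e]
         simp del: of_nat_mult)
  also have "box_word (ball_config e) {lo..0} = replicate (nat (1 - lo)) False"
    by (subst box_word_const[of _ _ False]) (auto simp: ball_config_def)
  also have "box_word (ball_config e) {int ?n + 1..hi} = replicate (nat (hi - 2 * int (half_length e))) False"
    by (subst box_word_const[of _ _ False]) (auto simp: ball_config_def)
  finally show ?thesis .
qed

lemma finite_ball_config: "finite {z. ball_config e z}"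
  by (rule finite_subset[of _ "{1..2 * int (half_length e)}"]) (auto simp: ball_config_def)

lemma remaining_boxes_cofinite:
  assumes "finite {z. \<eta> z}" shows "finite (- remaining_boxes \<eta> t)"
proof (induction t)
  case (Suc t)
  show ?case
  proof (cases "has_finite_run \<eta> (remaining_boxes \<eta> t)")
    case True
    then have "finite (next_soliton \<eta> (remaining_boxes \<eta> t))"
      using box_word_next_soliton[OF Suc assms] by metis
    with Suc True show ?thesis by (simp add: Compl_Diff_eq)
  qed (use Suc in simp)
qed simp

text \<open>Telescopes the loss of energy over the first \<open>t\<close> steps. The bounds may
  depend on \<open>t\<close>, since every further step requires a window that contains its
  pattern.\<close>

lemma spill_remaining_boxes:
  assumes fin: "finite {z. \<eta> z}"
  shows "\<exists>lo hi. \<forall>lo' hi' l. lo' \<le> lo \<longrightarrow> hi \<le> hi' \<longrightarrow> spill l 0 (box_word \<eta> {lo'..hi'})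
    = spill l 0 (box_word \<eta> (remaining_boxes \<eta> t \<inter> {lo'..hi'}))
      + (\<Sum>s | s < t \<and> has_finite_run \<eta> (remaining_boxes \<eta> s). min_run_size \<eta> (remaining_boxes \<eta> s) - l)"
proof (induction t)
  case (Suc t)
  let ?A = "remaining_boxes \<eta> t"
  let ?S = "\<lambda>t. {s. s < t \<and> has_finite_run \<eta> (remaining_boxes \<eta> s)}"
  let ?k = "\<lambda>s. min_run_size \<eta> (remaining_boxes \<eta> s)"
  obtain lo1 hi1 where 1: "\<And>lo' hi' l. lo' \<le> lo1 \<Longrightarrow> hi1 \<le> hi' \<Longrightarrow> spill l 0 (box_word \<eta> {lo'..hi'})
    = spill l 0 (box_word \<eta> (?A \<inter> {lo'..hi'})) + (\<Sum>s\<in>?S t. ?k s - l)"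
    using Suc.IH by blast
  show ?case
  proof (cases "has_finite_run \<eta> ?A")
    case True
    obtain lo2 hi2 where 2: "\<And>lo' hi' l. lo' \<le> lo2 \<Longrightarrow> hi2 \<le> hi' \<Longrightarrow>
       spill l 0 (box_word \<eta> (?A \<inter> {lo'..hi'}))
       = spill l 0 (box_word \<eta> ((?A - next_soliton \<eta> ?A) \<inter> {lo'..hi'})) + (?k t - l)"
      using box_word_next_soliton[OF remaining_boxes_cofinite[OF fin] fin True] by metis
    have S: "?S (Suc t) = insert t (?S t)" using True by (auto simp: less_Suc_eq)
    show ?thesis
      by (rule exI[of _ "min lo1 lo2"], rule exI[of _ "max hi1 hi2"], unfold S)
         (simp add: 1 2 True)
  next
    case False
    have S: "?S (Suc t) = ?S t" using False by (auto simp: less_Suc_eq)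
    show ?thesis unfolding S
      by (rule exI[of _ lo1], rule exI[of _ hi1]) (simp add: 1 False)
  qed
qed simp

text \<open>When the algorithm stops no ball remains, so the whole energy has been used up by the
  deletions, each \<open>k\<close>-soliton accounting for \<open>k - l\<close>.\<close>

lemma soliton_count_energy:
  assumes e: "e \<in> excursions"
  shows "spill l 0 (steps e) = (\<Sum>k\<in>{1..count_list (steps e) True}. soliton_count k e * (k - l))" (is ?thesis1)
    and "soliton_count 0 e = 0"
    and "k > count_list (steps e) True \<Longrightarrow> soliton_count k e = 0"
proof -
  define \<eta> where "\<eta> = ball_config e"
  define k where "k s = min_run_size \<eta> (remaining_boxes \<eta> s)" for s
  define F where "F = {s. has_finite_run \<eta> (remaining_boxes \<eta> s)}"
  have fin: "finite {z. \<eta> z}" by (simp add: \<eta>_def finite_ball_config)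
  have k1: "1 \<le> k s" if "s \<in> F" for s
    using box_word_next_soliton[OF remaining_boxes_cofinite[OF fin] fin, of s] that
    unfolding F_def k_def by (metis mem_Collect_eq)
  have main: "\<exists>X. finite X \<and> spill l 0 (steps e) = spill l 0 (box_word \<eta> (remaining_boxes \<eta> t \<inter> X))
     + (\<Sum>s\<in>{..<t} \<inter> F. k s - l)" for t l
  proof -
    obtain lo hi where *: "\<And>lo' hi' l. lo' \<le> lo \<Longrightarrow> hi \<le> hi' \<Longrightarrow> spill l 0 (box_word \<eta> {lo'..hi'})
      = spill l 0 (box_word \<eta> (remaining_boxes \<eta> t \<inter> {lo'..hi'})) 
      + (\<Sum>s | s < t \<and> has_finite_run \<eta> (remaining_boxes \<eta> s). k s - l)"
      using spill_remaining_boxes[OF fin] unfolding k_def by blast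
    have S: "{s. s < t \<and> has_finite_run \<eta> (remaining_boxes \<eta> s)} = {..<t} \<inter> F"
      by (auto simp: F_def)
    let ?lo = "min lo 1" and ?hi = "max hi (2 * int (half_length e))"
    have "spill l 0 (steps e) = spill l 0 (box_word \<eta> {?lo..?hi})"
      unfolding \<eta>_def by (subst box_word_ball_config[OF e]) (auto simp: carrier_simps)
    also have "\<dots> = spill l 0 (box_word \<eta> (remaining_boxes \<eta> t \<inter> {?lo..?hi}))
     + (\<Sum>s\<in>{..<t} \<inter> F. k s - l)" using *[of ?lo ?hi l] unfolding S by simp
    finally show ?thesis by blast
  qed
  \<comment> \<open>At capacity 0 the energy is the number of balls, and every step uses up at least
    one; this forces termination.\<close>
  have "t \<le> count_list (steps e) True" if "{..<t} \<subseteq> F" for t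
  proof -
    have "t = (\<Sum>s\<in>{..<t}. 1)" by simp
    also have "\<dots> \<le> (\<Sum>s\<in>{..<t}. k s)" using k1 that by (intro sum_mono) auto
    also have "{..<t} = {..<t} \<inter> F" using that by auto
    also have "(\<Sum>s\<in>{..<t} \<inter> F. k s) \<le> spill 0 0 (steps e)" using main[of 0 t] by auto
    finally show ?thesis by (simp add: spill_0)
  qed
  then have "\<not> {..<Suc (count_list (steps e) True)} \<subseteq> F" by (metis not_less_eq_eq order_refl)
  then have ex: "\<exists>t. t \<notin> F" by blast
  define t where "t = (LEAST t. t \<notin> F)"
  have t: "t \<notin> F" "s < t \<Longrightarrow> s \<in> F" for s
    using LeastI_ex[OF ex] not_less_Least[of s "\<lambda>t. t \<notin> F"] by (auto simp: t_def)
  \<comment> \<open>Nothing changes after the first idle step, so the active steps form an initial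
    segment.\<close>
  have "remaining_boxes \<eta> s = remaining_boxes \<eta> t" if "t \<le> s" for s
    using that by (induction s rule: dec_induct) (use t(1) in \<open>auto simp: F_def\<close>)
  then have F: "F = {..<t}"
    using t unfolding F_def by (metis (no_types, lifting) Collect_cong lessThan_def mem_Collect_eq not_less)
  have total: "spill l 0 (steps e) = (\<Sum>s<t. k s - l)" for l
  proof -
    obtain X where X: "finite X" "spill l 0 (steps e) = spill l 0 (box_word \<eta> (remaining_boxes \<eta> t \<inter> X))
     + (\<Sum>s\<in>{..<t} \<inter> F. k s - l)" using main by blast
    have "True \<notin> set (box_word \<eta> (remaining_boxes \<eta> t \<inter> X))"
      using t(1) X(1) has_finite_run_iff[OF remaining_boxes_cofinite[OF fin] fin]
      unfolding F_def box_word_def by auto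
    with X F show ?thesis by (simp add: spill_no_balls)
  qed
  have sc: "soliton_count j e = card {s. s < t \<and> k s = j}" for j
    using F unfolding soliton_count_def \<eta>_def[symmetric] k_def[symmetric] F_def
    by (metis (mono_tags, lifting) lessThan_iff mem_Collect_eq)
  have bound: "k s \<in> {1..count_list (steps e) True}" if "s < t" for s
  proof -
    have "k s \<le> (\<Sum>s<t. k s)" using that by (intro member_le_sum) auto
    with total[of 0] k1[of s] that F show ?thesis by (auto simp: spill_0)
  qed
  show ?thesis1
  proof -
    have "(\<Sum>s<t. k s - l) = (\<Sum>j\<in>{1..count_list (steps e) True}. \<Sum>s\<in>{s\<in>{..<t}. k s = j}. k s - l)"
      by (rule sum.group[symmetric]) (use bound in auto)
    also have "\<dots> = (\<Sum>j\<in>{1..count_list (steps e) True}. soliton_count j e * (j - l))"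
      by (intro sum.cong) (auto simp: sc)
    finally show ?thesis by (simp add: total)
  qed
  show "soliton_count 0 e = 0" using bound by (force simp: sc)
  show "soliton_count j e = 0" if "j > count_list (steps e) True" for j
  proof -
    have "{s. s < t \<and> k s = j} = {}" using bound that by force
    then show ?thesis by (simp add: sc)
  qed
qed

text \<open>The second difference of the energy in the capacity. That the truncated subtraction is
  exact on Dyck words is the content of \<open>solitons_spill\<close>.\<close>

definition solitons :: "nat \<Rightarrow> bool list \<Rightarrow> nat" where
  "solitons k w = (spill (k - 1) 0 w + spill (k + 1) 0 w) - 2 * spill k 0 w"

lemma soliton_count_eq:
  assumes "e \<in> excursions" "1 \<le> k"
  shows "soliton_count k e = solitons k (steps e)"
proof -
  let ?n = "count_list (steps e) True"
  have "spill (k - 1) 0 (steps e) + spill (k + 1) 0 (steps e)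
    = (\<Sum>j\<in>{1..?n}. soliton_count j e * ((j - (k - 1)) + (j - (k + 1))))"
    unfolding soliton_count_energy(1)[OF assms(1)] by (simp add: sum.distrib distrib_left)
  \<comment> \<open>The second difference in \<open>k\<close> of the truncated \<open>j - k\<close>
    is 1 for \<open>j = k\<close> and 0 otherwise.\<close>
  also have "\<dots> = (\<Sum>j\<in>{1..?n}. 2 * (soliton_count j e * (j - k)) + (if j = k then soliton_count j e else 0))"
    using assms(2) by (intro sum.cong) auto
  also have "\<dots> = 2 * spill k 0 (steps e) + soliton_count k e"
    unfolding soliton_count_energy(1)[OF assms(1)] sum.distrib sum_distrib_left[symmetric]
    using assms(2) soliton_count_energy(3)[OF assms(1), of k] by (auto simp: not_le)
  finally show ?thesis by (simp add: solitons_def)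
qed

section \<open>Excursions correspond to Dyck words\<close>

lemma level_steps:
  assumes "e \<in> excursions" "i \<le> 2 * half_length e"
  shows "level (take i (steps e)) = e ! i"
  using assms(2)
proof (induction i)
  case 0
  from assms(1) show ?case by (auto simp: excursions_def)
next
  case (Suc i)
  with assms show ?case
    by (simp add: take_Suc_conv_app_nth length_steps excursion_step level_Cons)
qed

lemma level_count: "level w = 2 * int (count_list w True) - int (length w)"
  by (induction w rule: level.induct) auto

lemma dyck_length: "dyck w \<Longrightarrow> length w = 2 * count_list w True"
  using level_count[of w] by (simp add: dyck_def)

lemma dyck_steps: assumes "e \<in> excursions" shows "dyck (steps e)"
proof -
  have e: "e ! (2 * half_length e) = 0" "\<And>i. i \<le> 2 * half_length e \<Longrightarrow> 0 \<le> e ! i"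
    using assms by (auto simp: excursions_def half_length_def)
  have "0 \<le> level (take i (steps e))" for i
  proof (cases "i \<le> 2 * half_length e")
    case True
    with level_steps[OF assms True] e(2) show ?thesis by simp
  next
    case False
    with level_steps[OF assms order_refl] e(1) length_steps[OF assms] show ?thesis by simp
  qed
  moreover have "level (steps e) = 0"
    using level_steps[OF assms order_refl] e(1) length_steps[OF assms] by simp
  ultimately show ?thesis by (simp add: dyck_def)
qed

lemma half_length_steps: "e \<in> excursions \<Longrightarrow> half_length e = count_list (steps e) True"
  using dyck_length[OF dyck_steps] length_steps by simp

definition heights :: "bool list \<Rightarrow> int list" where
  "heights w = map (\<lambda>i. level (take i w)) [0..<Suc (length w)]"

lemma nth_heights: "i \<le> length w \<Longrightarrow> heights w ! i = level (take i w)"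
  by (simp add: heights_def del: upt_Suc)

lemma level_take_Suc: "i < length w \<Longrightarrow> level (take (Suc i) w) = level (take i w) + (if w ! i then 1 else -1)"
  by (simp add: take_Suc_conv_app_nth level_Cons)

lemma heights_excursion: assumes "dyck w" shows "heights w \<in> excursions"
proof -
  have "\<bar>heights w ! z - heights w ! (z - 1)\<bar> = 1" if "z \<in> {1..length w}" for z
    using that level_take_Suc[of "z - 1" w] by (auto simp: nth_heights)
  then show ?thesis
    unfolding excursions_def using assms dyck_length[OF assms]
    by (intro CollectI exI[of _ "count_list w True"]) (auto simp: nth_heights dyck_def heights_def simp del: upt_Suc)
qed

lemma steps_heights: "steps (heights w) = w"
proof (rule nth_equalityI)
  show l: "length (steps (heights w)) = length w" by (simp add: steps_def heights_def)
  fix i assume "i < length (steps (heights w))"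
  then have "i < length w" by (simp only: l)
  then show "steps (heights w) ! i = w ! i"
    using nth_heights[of i w] nth_heights[of "Suc i" w] level_take_Suc[of i w] l
    by (simp add: steps_def split: if_splits)
qed

lemma heights_steps: assumes "e \<in> excursions" shows "heights (steps e) = e"
proof (rule nth_equalityI)
  have "length e = Suc (2 * half_length e)" using assms by (auto simp: excursions_def half_length_def)
  then show "length (heights (steps e)) = length e" using length_steps[OF assms] by (simp add: heights_def)
  then show "heights (steps e) ! i = e ! i" if "i < length (heights (steps e))" for i
    using that length_steps[OF assms] \<open>length e = _\<close> by (simp add: nth_heights level_steps[OF assms])
qed

lemma bij_betw_steps: "bij_betw steps excursions {w. dyck w}"
  by (rule bij_betwI[where g = heights]) (auto simp: dyck_steps heights_excursion steps_heights heights_steps)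

section \<open>Soliton counts and weights of Dyck words\<close>

lemma spill_solitons:
  assumes "dyck w" "count_list w True \<le> n"
  shows "spill l 0 w = (\<Sum>k\<in>{1..n}. solitons k w * (k - l))"
proof -
  have e: "heights w \<in> excursions" by (rule heights_excursion[OF assms(1)])
  have s: "steps (heights w) = w" by (rule steps_heights)
  have "spill l 0 w = (\<Sum>k\<in>{1..count_list w True}. soliton_count k (heights w) * (k - l))"
    using soliton_count_energy(1)[OF e, of l] by (simp add: s)
  also have "\<dots> = (\<Sum>k\<in>{1..n}. soliton_count k (heights w) * (k - l))"
    using soliton_count_energy(3)[OF e] assms(2) by (intro sum.mono_neutral_left) (auto simp: s)
  also have "\<dots> = (\<Sum>k\<in>{1..n}. solitons k w * (k - l))"
    using soliton_count_eq[OF e] by (intro sum.cong) (auto simp: s)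
  finally show ?thesis .
qed

text \<open>The energy is a nonnegative combination of the functions \<open>k - l\<close>, truncated
  at 0 and thus convex in the capacity \<open>l\<close>; so its second difference is
  nonnegative.\<close>

lemma solitons_spill:
  assumes "dyck w" "1 \<le> k"
  shows "solitons k w + 2 * spill k 0 w = spill (k - 1) 0 w + spill (k + 1) 0 w"
proof -
  let ?n = "count_list w True"
  have "2 * spill k 0 w = (\<Sum>j\<in>{1..?n}. solitons j w * (2 * (j - k)))"
    by (simp add: spill_solitons[OF assms(1) order_refl] sum_distrib_left algebra_simps)
  also have "\<dots> \<le> (\<Sum>j\<in>{1..?n}. solitons j w * ((j - (k - 1)) + (j - (k + 1))))"
    using assms(2) by (intro sum_mono mult_left_mono) linarith+
  also have "\<dots> = spill (k - 1) 0 w + spill (k + 1) 0 w"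
    by (simp add: spill_solitons[OF assms(1) order_refl] sum.distrib distrib_left)
  finally show ?thesis by (simp add: solitons_def)
qed

lemma solitons_large: "count_list w True < k \<Longrightarrow> solitons k w = 0"
  by (simp add: solitons_def spill_large)

lemma count_solitons: "dyck w \<Longrightarrow> count_list w True \<le> n \<Longrightarrow> count_list w True = (\<Sum>k\<in>{1..n}. k * solitons k w)"
  using spill_solitons[of w n 0] by (simp add: spill_0 mult.commute)

definition word_weight :: "(nat \<Rightarrow> real) \<Rightarrow> bool list \<Rightarrow> real" where
  "word_weight \<alpha> w = (\<Prod>k\<in>{1..count_list w True}. \<alpha> k ^ solitons k w)"

lemma word_weight_eq: "count_list w True \<le> n \<Longrightarrow> word_weight \<alpha> w = (\<Prod>k\<in>{1..n}. \<alpha> k ^ solitons k w)"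
  unfolding word_weight_def
  by (intro prod.mono_neutral_left) (auto simp: solitons_large)

lemma weight_eq: assumes "e \<in> excursions" shows "weight \<alpha> e = word_weight \<alpha> (steps e)"
proof -
  let ?n = "count_list (steps e) True"
  have *: "\<alpha> (Suc k) ^ soliton_count (Suc k) e = 1" if "k \<notin> {..<?n}" for k
    using soliton_count_energy(3)[OF assms, of "Suc k"] that by simp
  have "weight \<alpha> e = (\<Prod>k<?n. \<alpha> (Suc k) ^ soliton_count (Suc k) e)"
    unfolding weight_def by (rule prodinf_finite) (use * in auto)
  also have "\<dots> = (\<Prod>k<?n. \<alpha> (Suc k) ^ solitons (Suc k) (steps e))"
    by (intro prod.cong) (auto simp: soliton_count_eq[OF assms])
  also have "\<dots> = (\<Prod>k\<in>{1..?n}. \<alpha> k ^ solitons k (steps e))"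
    by (rule prod.reindex_bij_witness[of _ "\<lambda>k. k - 1" Suc]) auto
  finally show ?thesis by (simp add: word_weight_def)
qed

text \<open>The total weight depends only on the total soliton counts, which are second differences
  of the total energies. The single words of the two lists need not correspond to each
  other.\<close>

lemma prod_word_weight_eq:
  assumes "\<forall>w\<in>set ws. dyck w" "\<forall>w\<in>set ws'. dyck w"
    and "\<And>l. (\<Sum>w\<leftarrow>ws. spill l 0 w) = (\<Sum>w\<leftarrow>ws'. spill l 0 w)"
  shows "(\<Prod>w\<leftarrow>ws. word_weight \<alpha> w) = (\<Prod>w\<leftarrow>ws'. word_weight \<alpha> w)"
proof -
  \<comment> \<open>A common bound for all numbers of balls, so that all weights are products over
    the same range.\<close>
  define n where "n = (\<Sum>w\<leftarrow>ws. count_list w True) + (\<Sum>w\<leftarrow>ws'. count_list w True)"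
  have n: "count_list w True \<le> n" if "w \<in> set ws \<union> set ws'" for w
    using that member_le_sum_list[of "count_list w True" "map (\<lambda>w. count_list w True) ws"]
      member_le_sum_list[of "count_list w True" "map (\<lambda>w. count_list w True) ws'"]
    by (auto simp: n_def)
  have prod: "(\<Prod>w\<leftarrow>us. word_weight \<alpha> w) = (\<Prod>k\<in>{1..n}. \<alpha> k ^ (\<Sum>w\<leftarrow>us. solitons k w))"
    if "\<forall>w\<in>set us. count_list w True \<le> n" for us
    using that by (induction us) (auto simp: word_weight_eq power_add prod.distrib)
  have eq: "(\<Sum>w\<leftarrow>us. solitons k w) + 2 * (\<Sum>w\<leftarrow>us. spill k 0 w)
    = (\<Sum>w\<leftarrow>us. spill (k - 1) 0 w) + (\<Sum>w\<leftarrow>us. spill (k + 1) 0 w)"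
    if "\<forall>w\<in>set us. dyck w" "1 \<le> k" for us k
    using that(1)
  proof (induction us)
    case (Cons w us)
    from solitons_spill[of w k] Cons that(2) show ?case by simp
  qed simp
  have "(\<Sum>w\<leftarrow>ws. solitons k w) = (\<Sum>w\<leftarrow>ws'. solitons k w)" if "1 \<le> k" for k
    using eq[OF assms(1) that] eq[OF assms(2) that] assms(3) by simp
  then show ?thesis using n by (simp add: prod)
qed

lemma word_weight_nonneg: "(\<And>k. 1 \<le> k \<Longrightarrow> 0 \<le> \<alpha> k) \<Longrightarrow> 0 \<le> word_weight \<alpha> w"
  unfolding word_weight_def by (intro prod_nonneg) auto

lemma word_weight_Nil [simp]: "word_weight \<alpha> [] = 1"
  by (simp add: word_weight_def)

section \<open>Eliminating peaks\<close>

text \<open>A single pass: peaks that arise only through the removal of others are kept.\<close>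

fun elim :: "bool list \<Rightarrow> bool list" where
  "elim [] = []"
| "elim (False # w) = False # elim w"
| "elim [True] = [True]"
| "elim (True # False # w) = elim w"
| "elim (True # True # w) = True # elim (True # w)"

fun peaks :: "bool list \<Rightarrow> nat" where
  "peaks [] = 0"
| "peaks (False # w) = peaks w"
| "peaks [True] = 0"
| "peaks (True # False # w) = Suc (peaks w)"
| "peaks (True # True # w) = peaks (True # w)"

lemma length_elim: "length w = length (elim w) + 2 * peaks w"
  by (induction w rule: elim.induct) auto

lemma count_elim: "count_list w True = count_list (elim w) True + peaks w"
  by (induction w rule: elim.induct) auto

lemma level_elim [simp]: "level (elim w) = level w"
  by (induction w rule: elim.induct) (auto simp: level_Cons)

lemma level_take_elim: "\<exists>j. level (take i (elim w)) = level (take j w)"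
proof (induction w arbitrary: i rule: elim.induct)
  case (2 w)
  show ?case
  proof (cases i)
    case (Suc i')
    obtain j where "level (take i' (elim w)) = level (take j w)" using "2.IH"[of i'] by blast
    with Suc show ?thesis by (intro exI[of _ "Suc j"]) simp
  qed (auto intro: exI[of _ 0])
next
  case (4 w)
  obtain j where "level (take i (elim w)) = level (take j w)" using "4.IH"[of i] by blast
  then show ?case by (intro exI[of _ "Suc (Suc j)"]) simp
next
  case (5 w)
  show ?case
  proof (cases i)
    case (Suc i')
    obtain j where "level (take i' (elim (True # w))) = level (take j (True # w))" using "5.IH"[of i'] by blast
    with Suc show ?thesis by (intro exI[of _ "Suc j"]) simp
  qed (auto intro: exI[of _ 0])
qed auto

lemma dyck_elim: assumes "dyck w" shows "dyck (elim w)"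
  using assms level_take_elim[of _ w] unfolding dyck_def by (metis level_elim)

text \<open>Along \<open>elim w\<close> the smaller carrier holds the same load, except inside a run of balls after the
  larger carrier has become full, where it is one spill ahead.\<close>

lemma spill_Suc_aux:
  assumes "w = [] \<or> \<not> last w"
  shows "(c \<le> l \<longrightarrow> spill (Suc l) c w = spill l c (elim w)) \<and>
    (w \<noteq> [] \<and> hd w \<longrightarrow> spill (Suc l) (Suc l) w = spill l l (elim w) + 1)"
  using assms
proof (induction w arbitrary: c rule: elim.induct)
  case (2 w)
  then have "w = [] \<or> \<not> last w" by auto
  with "2.IH"[of "c - 1"] show ?case by auto
next
  case (4 w)
  then have "w = [] \<or> \<not> last w" by auto
  with "4.IH"[of c] "4.IH"[of l] show ?case by auto
next
  case (5 w)
  then have "spill (Suc l) (Suc l) (True # w) = spill l l (elim (True # w)) + 1"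
    "Suc c \<le> l \<Longrightarrow> spill (Suc l) (Suc c) (True # w) = spill l (Suc c) (elim (True # w))"
    using "5.IH" by auto
  then show ?case by (auto simp: min_def not_less_eq_eq le_Suc_eq)
qed auto

lemma dyck_last: assumes "dyck w" "w \<noteq> []" shows "\<not> last w"
proof -
  have "level (butlast w) + (if last w then 1 else -1) = 0"
    using assms level_append[of "butlast w" "[last w]"] by (simp add: dyck_def level_Cons)
  moreover have "0 \<le> level (butlast w)" using assms by (simp add: dyck_def butlast_conv_take)
  ultimately show ?thesis by auto
qed

lemma spill_elim: "dyck w \<Longrightarrow> spill l 0 (elim w) = spill (Suc l) 0 w"
  using spill_Suc_aux[of w 0 l] dyck_last[of w] by (cases "w = []") auto

lemma solitons_elim: "dyck w \<Longrightarrow> 1 \<le> k \<Longrightarrow> solitons k (elim w) = solitons (Suc k) w"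
  by (simp add: solitons_def spill_elim)

text \<open>By \<open>spill_elim\<close> the energies at the capacities 0, 1 and 2 are the ball
  counts of \<open>w\<close>, \<open>elim w\<close> and \<open>elim (elim w)\<close>, and each
  elimination loses one ball per peak.\<close>

lemma solitons_1: assumes "dyck w" shows "solitons 1 w = peaks w - peaks (elim w)"
  using spill_elim[OF dyck_elim[OF assms], of 0] spill_elim[OF assms] count_elim[of w] count_elim[of "elim w"]
    spill_0[of w] spill_0[of "elim w"] spill_0[of "elim (elim w)"] spill_elim[OF assms, of 1]
  by (simp add: solitons_def numeral_2_eq_2)

lemma peaks_pos: assumes "dyck w" "w \<noteq> []" shows "0 < peaks w"
proof -
  have "0 < peaks w" if "w \<noteq> []" "hd w" "\<not> last w" for w
    using that by (induction w rule: elim.induct) (auto split: if_splits)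
  moreover have "hd w" using assms by (cases w) (auto simp: dyck_def level_Cons dest!: spec[of _ 1] split: if_splits)
  ultimately show ?thesis using dyck_last[OF assms] assms(2) by blast
qed

section \<open>Words with a prescribed result of peak elimination\<close>

definition fibre :: "nat \<Rightarrow> bool list \<Rightarrow> bool list set" where
  "fibre n v = {w. elim w = v \<and> length w \<le> n}"

lemma finite_fibre: "finite (fibre n v)"
  by (rule finite_subset[OF _ finite_lists_length_le[of "UNIV :: bool set" n]]) (auto simp: fibre_def)

text \<open>On Dyck words this is the number of 1-solitons (\<open>solitons_1\<close>). The form by
  peaks makes sense for all words, as the induction over suffixes in \<open>fibre_sums\<close>
  requires.\<close>

definition excess :: "bool list \<Rightarrow> nat" where
  "excess w = peaks w - peaks (elim w)"

lemma peaks_Cons: "peaks (b # w) = peaks w + of_bool (b \<and> w \<noteq> [] \<and> \<not> hd w)"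
  by (cases "b # w" rule: peaks.cases) auto

lemma peaks_elim_le_aux: "peaks (elim w) \<le> peaks w \<and> (w \<noteq> [] \<and> hd w \<longrightarrow> peaks (True # elim w) \<le> peaks w)"
  by (induction w rule: elim.induct) (auto simp: peaks_Cons)

lemma peaks_elim_le: "peaks (elim w) \<le> peaks w"
  using peaks_elim_le_aux by blast

lemma excess_peak: "excess (True # False # u) = Suc (excess u)"
  using peaks_elim_le[of u] by (simp add: excess_def)

lemma fibre_Nil_subset: "fibre n [] \<subseteq> (\<lambda>u. True # False # u) ` fibre n [] \<union> {[]}"
proof
  fix w assume "w \<in> fibre n []"
  then show "w \<in> (\<lambda>u. True # False # u) ` fibre n [] \<union> {[]}"
    by (cases w rule: elim.cases) (auto simp: fibre_def)
qed

text \<open>A word over \<open>b # v\<close> that does not start with a peak starts with \<open>b\<close>; if \<open>b # v\<close> starts with a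
  peak, then that peak must have been separated by another one.\<close>

lemma fibre_Cons_subset:
  obtains g where
    "fibre n (b # v) \<subseteq> (\<lambda>u. True # False # u) ` fibre n (b # v) \<union> g ` fibre n v"
    "\<And>u. elim u = v \<Longrightarrow> excess (g u) = excess u"
proof (cases "b \<and> v \<noteq> [] \<and> \<not> hd v")
  case True
  \<comment> \<open>Here \<open>b # v\<close> starts with a peak, which an inserted peak must keep
    from being eliminated. Prefixing the three letters adds one peak to the word and one to its
    elimination, so the excess stays the same.\<close>
  show ?thesis
  proof (rule that[of "\<lambda>u. True # True # False # u"])
    show "fibre n (b # v) \<subseteq> (\<lambda>u. True # False # u) ` fibre n (b # v) \<union> (\<lambda>u. True # True # False # u) ` fibre n v"
    proof
      fix w assume w: "w \<in> fibre n (b # v)"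
      show "w \<in> (\<lambda>u. True # False # u) ` fibre n (b # v) \<union> (\<lambda>u. True # True # False # u) ` fibre n v"
      proof (cases w rule: elim.cases)
        case (5 u)
        with w True have u: "elim (True # u) = v" "length u + 2 \<le> n" by (auto simp: fibre_def)
        with True obtain u' where "u = False # u'" by (cases "True # u" rule: elim.cases) auto
        with u 5 show ?thesis by (auto simp: fibre_def)
      qed (use w True in \<open>auto simp: fibre_def\<close>)
    qed
    show "excess (True # True # False # u) = excess u" if "elim u = v" for u
      using that True by (auto simp: excess_def peaks_Cons)
  qed
next
  case False
  \<comment> \<open>If \<open>elim u = v\<close>, the guard cannot hold, since \<open>v\<close>
    would then start with an empty box. Returning \<open>u\<close> there is a default for which the
    equation of the excesses is trivial.\<close>
  show ?thesis
  proof (rule that[of "\<lambda>u. if b \<and> u \<noteq> [] \<and> \<not> hd u then u else b # u"])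
    show "fibre n (b # v) \<subseteq> (\<lambda>u. True # False # u) ` fibre n (b # v) \<union>
      (\<lambda>u. if b \<and> u \<noteq> [] \<and> \<not> hd u then u else b # u) ` fibre n v"
    proof
      fix w assume w: "w \<in> fibre n (b # v)"
      show "w \<in> (\<lambda>u. True # False # u) ` fibre n (b # v) \<union>
        (\<lambda>u. if b \<and> u \<noteq> [] \<and> \<not> hd u then u else b # u) ` fibre n v"
        by (cases w rule: elim.cases; use w in \<open>force simp: fibre_def image_iff\<close>)
    qed
    show "excess (if b \<and> u \<noteq> [] \<and> \<not> hd u then u else b # u) = excess u" if "elim u = v" for u
    proof (cases "b \<and> u \<noteq> [] \<and> \<not> hd u")
      case nc: False
      have "elim (b # u) = b # v" using nc that by (cases "b # u" rule: elim.cases) auto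
      with nc False that show ?thesis by (auto simp: excess_def peaks_Cons)
    qed auto
  qed
qed

text \<open>Only upper bounds are wanted, so the cover need be neither disjoint nor injectively
  parametrised.\<close>

lemma sum_cover_le:
  fixes f :: "'a \<Rightarrow> real"
  assumes "finite X" "finite Y" "W \<subseteq> h ` X \<union> g ` Y" "\<And>w. 0 \<le> f w"
  shows "sum f W \<le> (\<Sum>u\<in>X. f (h u)) + (\<Sum>u\<in>Y. f (g u))"
proof -
  have "sum f W \<le> sum f (h ` X \<union> g ` Y)" by (rule sum_mono2) (use assms in auto)
  also have "\<dots> \<le> sum f (h ` X) + sum f (g ` Y)"
    using sum_Un[of "h ` X" "g ` Y" f] assms by (simp add: sum_nonneg)
  also have "\<dots> \<le> (\<Sum>u\<in>X. f (h u)) + (\<Sum>u\<in>Y. f (g u))"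
    by (intro add_mono order_trans[OF sum_image_le]) (use assms in auto)
  finally show ?thesis .
qed

text \<open>Splitting off a leading peak gives \<open>a v \<le> x * a v + a'\<close>, hence one
  factor \<open>1 / (1 - x)\<close> for each letter of \<open>v\<close> and one for its end. The
  second bound is \<open>x\<close> times the derivative of the first. The restriction to length
  \<open>n\<close> makes the sums finite, so that the inequality can be solved for
  \<open>a v\<close>.\<close>

lemma fibre_sums:
  fixes x :: real
  assumes x: "0 \<le> x" "x < 1"
  defines "s \<equiv> \<lambda>v. Suc (length v)"
  shows "(\<Sum>w\<in>fibre n v. x ^ excess w) \<le> 1 / (1 - x) ^ s v \<and>
    (\<Sum>w\<in>fibre n v. excess w * x ^ excess w) \<le> s v * (x / (1 - x)) / (1 - x) ^ s v"
proof -
  define a where "a v = (\<Sum>w\<in>fibre n v. x ^ excess w)" for v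
  define b where "b v = (\<Sum>w\<in>fibre n v. excess w * x ^ excess w)" for v
  have x1: "0 < 1 - x" using x by simp
  have step: "a v \<le> 1 / (1 - x) ^ Suc m \<and> b v \<le> real (Suc m) * (x / (1 - x)) / (1 - x) ^ Suc m"
    if a: "a v \<le> x * a v + a'" and b: "b v \<le> x * (a v + b v) + b'"
      and a': "a' \<le> 1 / (1 - x) ^ m" and b': "b' \<le> m * (x / (1 - x)) / (1 - x) ^ m" for v m a' b'
  proof -
    have "(1 - x) * a v \<le> a'" using a by (simp add: algebra_simps)
    then have "a v \<le> a' / (1 - x)" using x1 by (simp add: pos_le_divide_eq mult.commute)
    also have "\<dots> \<le> (1 / (1 - x) ^ m) / (1 - x)" using a' x1 by (intro divide_right_mono) auto
    also have "\<dots> = 1 / (1 - x) ^ Suc m" by simp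
    finally have av: "a v \<le> 1 / (1 - x) ^ Suc m" .
    have "(1 - x) * b v \<le> x * a v + b'" using b by (simp add: algebra_simps)
    then have "b v \<le> (x * a v + b') / (1 - x)" using x1 by (simp add: pos_le_divide_eq mult.commute)
    also have "\<dots> \<le> (x * (1 / (1 - x) ^ Suc m) + m * (x / (1 - x)) / (1 - x) ^ m) / (1 - x)"
      using av b' x x1 by (intro divide_right_mono add_mono mult_left_mono) auto
    also have "\<dots> = real (Suc m) * (x / (1 - x)) / (1 - x) ^ Suc m"
    proof -
      have "(x * (1 / (y * P)) + m * (x / y) / P) / y = (1 + real m) * (x / y) / (y * P)"
        if "y \<noteq> 0" "P \<noteq> 0" for y P :: real
        using that by (simp add: field_simps)
      from this[of "1 - x" "(1 - x) ^ m"] x1 show ?thesis by simp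
    qed
    finally show ?thesis using av by simp
  qed
  have sum_TF: "(\<Sum>u\<in>fibre n v. x ^ excess (True # False # u)) = x * a v"
    "(\<Sum>u\<in>fibre n v. real (excess (True # False # u)) * x ^ excess (True # False # u)) = x * (a v + b v)" for v
    unfolding excess_peak a_def b_def
    by (simp_all add: sum_distrib_left distrib_left flip: sum.distrib) (simp_all add: algebra_simps)
  have "a v \<le> 1 / (1 - x) ^ s v \<and> b v \<le> s v * (x / (1 - x)) / (1 - x) ^ s v"
  proof (induction v)
    case Nil
    have cover: "fibre n [] \<subseteq> (\<lambda>u. True # False # u) ` fibre n [] \<union> (\<lambda>u. u) ` {[]}"
      using fibre_Nil_subset by simp
    have "a [] \<le> x * a [] + 1"
      using sum_cover_le[OF finite_fibre _ cover, of "\<lambda>w. x ^ excess w"] x sum_TF(1)[of "[]"]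
      by (simp add: a_def excess_def)
    moreover have "b [] \<le> x * (a [] + b []) + 0"
      using sum_cover_le[OF finite_fibre _ cover, of "\<lambda>w. excess w * x ^ excess w"] x sum_TF(2)[of "[]"]
      by (simp add: b_def excess_def)
    ultimately show ?case using step[of "[]" 1 0 0] by (simp add: s_def)
  next
    case (Cons c v)
    obtain g where g: "fibre n (c # v) \<subseteq> (\<lambda>u. True # False # u) ` fibre n (c # v) \<union> g ` fibre n v"
      "\<And>u. elim u = v \<Longrightarrow> excess (g u) = excess u"
      using fibre_Cons_subset by blast
    have eg: "u \<in> fibre n v \<Longrightarrow> excess (g u) = excess u" for u
      by (rule g(2)) (simp add: fibre_def)
    have "a (c # v) \<le> x * a (c # v) + a v"
      using sum_cover_le[OF finite_fibre finite_fibre g(1), of "\<lambda>w. x ^ excess w"] x sum_TF(1)[of "c # v"]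
      by (simp add: a_def eg)
    moreover have "b (c # v) \<le> x * (a (c # v) + b (c # v)) + b v"
      using sum_cover_le[OF finite_fibre finite_fibre g(1), of "\<lambda>w. excess w * x ^ excess w"] x sum_TF(2)[of "c # v"]
      by (simp add: b_def eg)
    ultimately show ?case using step[of "c # v" "a v" "b v" "s v"] Cons by (simp add: s_def)
  qed
  then show ?thesis by (simp add: a_def b_def)
qed

section \<open>Recursive bound on the partition sums of \<open>alpha_of q\<close>\<close>

definition dyck_upto :: "nat \<Rightarrow> bool list set" where
  "dyck_upto n = {w. dyck w \<and> length w \<le> 2 * n}"

lemma finite_dyck_upto: "finite (dyck_upto n)"
  by (rule finite_subset[OF _ finite_lists_length_le[of "UNIV :: bool set" "2 * n"]]) (auto simp: dyck_upto_def)

text \<open>The parameter \<open>t\<close> makes the bound self-reproducing: eliminating the peaks turns \<open>t\<close> into \<open>t + 1\<close>.\<close>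

definition partial_sum :: "nat \<Rightarrow> (nat \<Rightarrow> real) \<Rightarrow> real \<Rightarrow> real" where
  "partial_sum n q t = (\<Sum>w\<in>dyck_upto n. (real (Suc (length w)) + 2 * t * peaks w) * word_weight (alpha_of q) w)"

lemma alpha_of_Suc: "alpha_of q (Suc k) = alpha_of (\<lambda>j. q (Suc j)) k * (1 - q 1) ^ (2 * k)" if "1 \<le> k"
proof -
  have "(\<Prod>l\<in>{1..<Suc k}. (1 - q l) ^ (2 * (Suc k - l)))
    = (1 - q 1) ^ (2 * k) * (\<Prod>l\<in>{2..<Suc k}. (1 - q l) ^ (2 * (Suc k - l)))"
    using that by (subst prod.atLeast_Suc_lessThan) (auto simp: numeral_2_eq_2)
  also have "(\<Prod>l\<in>{2..<Suc k}. (1 - q l) ^ (2 * (Suc k - l))) = (\<Prod>l\<in>{1..<k}. (1 - q (Suc l)) ^ (2 * (k - l)))"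
    by (rule prod.reindex_bij_witness[of _ Suc "\<lambda>l. l - 1"]) auto
  finally show ?thesis by (simp add: alpha_of_def)
qed

lemma alpha_of_1: "alpha_of q 1 = q 1"
  by (simp add: alpha_of_def)

lemma alpha_of_bounds:
  assumes "\<forall>k\<ge>1. 0 \<le> q k \<and> q k < 1" "1 \<le> k"
  shows "0 \<le> alpha_of q k" "alpha_of q k < 1"
proof -
  have *: "0 \<le> (\<Prod>l\<in>{1..<k}. (1 - q l) ^ (2 * (k - l)))" "(\<Prod>l\<in>{1..<k}. (1 - q l) ^ (2 * (k - l))) \<le> 1"
    using assms(1) by (auto intro!: prod_nonneg prod_le_1 power_le_one simp: less_imp_le)
  have q: "0 \<le> q k" "q k < 1" using assms by auto
  show "0 \<le> alpha_of q k" using * q by (simp add: alpha_of_def)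
  have "alpha_of q k \<le> q k * 1" unfolding alpha_of_def using * q by (intro mult_left_mono) auto
  with q show "alpha_of q k < 1" by simp
qed

text \<open>The weights lose a factor \<open>(1 - q 1)^(2 * k)\<close> for every
  \<open>k\<close>-soliton of \<open>elim w\<close> when \<open>q\<close> is shifted by one
  (\<open>alpha_of_Suc\<close>); the exponents add up to the length of
  \<open>elim w\<close>.\<close>

lemma word_weight_elim:
  assumes w: "dyck w" and q: "\<forall>k\<ge>1. 0 \<le> q k \<and> q k < 1"
  shows "word_weight (alpha_of q) w = q 1 ^ excess w *
    (word_weight (alpha_of (\<lambda>k. q (Suc k))) (elim w) * (1 - q 1) ^ length (elim w))"
proof -
  define n where "n = count_list w True"
  have c: "count_list (elim w) True \<le> n" using count_elim[of w] by (simp add: n_def)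
  have "word_weight (alpha_of q) w = (\<Prod>k\<in>{1..Suc n}. alpha_of q k ^ solitons k w)"
    by (rule word_weight_eq) (simp add: n_def)
  also have "\<dots> = q 1 ^ solitons 1 w * (\<Prod>k\<in>{Suc 1..Suc n}. alpha_of q k ^ solitons k w)"
    by (subst prod.atLeast_Suc_atMost) (simp_all add: alpha_of_1[simplified])
  also have "(\<Prod>k\<in>{Suc 1..Suc n}. alpha_of q k ^ solitons k w)
    = (\<Prod>k\<in>{1..n}. alpha_of q (Suc k) ^ solitons (Suc k) w)"
    by (rule prod.shift_bounds_cl_Suc_ivl)
  also have "\<dots> = (\<Prod>k\<in>{1..n}. alpha_of (\<lambda>k. q (Suc k)) k ^ solitons k (elim w) *
      (1 - q 1) ^ (2 * (k * solitons k (elim w))))"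
    by (intro prod.cong) (simp_all add: alpha_of_Suc solitons_elim[OF w] power_mult_distrib mult.assoc flip: power_mult)
  also have "\<dots> = word_weight (alpha_of (\<lambda>k. q (Suc k))) (elim w)
      * (1 - q 1) ^ (\<Sum>k\<in>{1..n}. 2 * (k * solitons k (elim w)))"
    by (simp add: prod.distrib word_weight_eq[OF c] power_sum)
  also have "(\<Sum>k\<in>{1..n}. 2 * (k * solitons k (elim w))) = length (elim w)"
    using count_solitons[OF dyck_elim[OF w] c] dyck_length[OF dyck_elim[OF w]]
    by (simp flip: sum_distrib_left)
  finally show ?thesis by (simp add: solitons_1[OF w, simplified] excess_def)
qed

text \<open>Dyck words are grouped by their image under \<open>elim\<close>. The power of
  \<open>1 - q 1\<close> in \<open>word_weight_elim\<close> cancels all but one factor of the bound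
  in \<open>fibre_sums\<close>, and the two boxes of each eliminated peak raise the factor
  \<open>2 * t\<close> per peak to \<open>2 * (t + 1)\<close>.\<close>

lemma partial_sum_Suc:
  assumes q: "\<forall>k\<ge>1. 0 \<le> q k \<and> q k < 1" and "0 \<le> t"
  shows "partial_sum (Suc n) q t
    \<le> (1 + 2 * (q 1 / (1 - q 1)) * (1 + t)) / (1 - q 1) * partial_sum n (\<lambda>k. q (Suc k)) (t + 1)"
proof -
  define x where "x = q 1"
  define W where "W = word_weight (alpha_of (\<lambda>k. q (Suc k)))"
  have x: "0 \<le> x" "x < 1" "0 < 1 - x" using q by (auto simp: x_def)
  have W: "0 \<le> W v" for v unfolding W_def
    by (rule word_weight_nonneg) (use alpha_of_bounds[of "\<lambda>k. q (Suc k)"] q in auto)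
  define f where "f v w = (real (Suc (length v)) + 2 * (1 + t) * (real (peaks v) + excess w)) * (x ^ excess w * (W v * (1 - x) ^ length v))" for v w
  have f: "(real (Suc (length w)) + 2 * t * peaks w) * word_weight (alpha_of q) w = f (elim w) w" if "dyck w" for w
  proof -
    have "peaks w = peaks (elim w) + excess w" using peaks_elim_le[of w] by (simp add: excess_def)
    then show ?thesis
      using length_elim[of w] unfolding word_weight_elim[OF that q] f_def x_def W_def
      by (simp add: algebra_simps)
  qed
  have f0: "0 \<le> f v w" for v w unfolding f_def using x W[of v] assms(2) by simp
  \<comment> \<open>A nonempty Dyck word has a peak, so elimination shortens it by at least two
    letters.\<close>
  have elim: "elim w \<in> dyck_upto n" if "w \<in> dyck_upto (Suc n)" for w
  proof (cases "w = []")
    case False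
    with that peaks_pos[of w] length_elim[of w] show ?thesis
      by (auto simp: dyck_upto_def dyck_elim)
  qed (simp add: dyck_upto_def)
  have fibre: "(\<Sum>w\<in>fibre (2 * Suc n) v. f v w)
      \<le> (1 + 2 * (x / (1 - x)) * (1 + t)) / (1 - x) * ((real (Suc (length v)) + 2 * (t + 1) * peaks v) * W v)" for v
  proof -
    define s where "s = real (Suc (length v))"
    define A where "A = s + 2 * (1 + t) * peaks v"
    define P where "P = 1 / (1 - x) ^ Suc (length v)"
    have A: "s \<le> A" "0 \<le> s" using assms(2) by (auto simp: A_def s_def)
    have P: "0 \<le> P" using x by (simp add: P_def)
    have r: "0 \<le> x / (1 - x)" using x by simp
    have "(\<Sum>w\<in>fibre (2 * Suc n) v. f v w) = (W v * (1 - x) ^ length v) *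
      (A * (\<Sum>w\<in>fibre (2 * Suc n) v. x ^ excess w)
        + 2 * (1 + t) * (\<Sum>w\<in>fibre (2 * Suc n) v. excess w * x ^ excess w))"
      unfolding f_def A_def s_def sum_distrib_left sum.distrib[symmetric]
      by (intro sum.cong) (simp_all add: algebra_simps)
    also have "\<dots> \<le> (W v * (1 - x) ^ length v) * (A * P + 2 * (1 + t) * (s * (x / (1 - x)) * P))"
      using fibre_sums[OF x(1,2), of "2 * Suc n" v] x W[of v] assms(2) A
      by (intro mult_left_mono add_mono) (auto simp: P_def s_def)
    \<comment> \<open>Enlarging \<open>s\<close> to \<open>A\<close> lets \<open>A\<close> factor
      out, which restores the form of the summands of \<open>partial_sum\<close>.\<close>
    also have "\<dots> \<le> (W v * (1 - x) ^ length v) * (A * P + 2 * (1 + t) * (A * (x / (1 - x)) * P))"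
      using x W[of v] assms(2) A P r
      by (intro mult_left_mono add_mono mult_right_mono order_refl) auto
    also have "\<dots> = (1 + 2 * (x / (1 - x)) * (1 + t)) * A * W v * ((1 - x) ^ length v * P)"
      by (simp add: algebra_simps)
    also have "(1 - x) ^ length v * P = 1 / (1 - x)" using x by (simp add: P_def)
    also have "(1 + 2 * (x / (1 - x)) * (1 + t)) * A * W v * (1 / (1 - x))
      = (1 + 2 * (x / (1 - x)) * (1 + t)) / (1 - x) * (A * W v)" by simp
    also have "A = real (Suc (length v)) + 2 * (t + 1) * peaks v" by (simp add: A_def s_def algebra_simps)
    finally show ?thesis .
  qed
  have "partial_sum (Suc n) q t = (\<Sum>w\<in>dyck_upto (Suc n). f (elim w) w)"
    unfolding partial_sum_def by (intro sum.cong refl f) (simp add: dyck_upto_def)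
  also have "\<dots> = (\<Sum>v\<in>dyck_upto n. \<Sum>w\<in>{w \<in> dyck_upto (Suc n). elim w = v}. f (elim w) w)"
    by (rule sum.group[symmetric]) (use elim finite_dyck_upto in auto)
  also have "\<dots> \<le> (\<Sum>v\<in>dyck_upto n. \<Sum>w\<in>fibre (2 * Suc n) v. f v w)"
  proof (rule sum_mono)
    fix v
    have "(\<Sum>w\<in>{w \<in> dyck_upto (Suc n). elim w = v}. f (elim w) w)
      = (\<Sum>w\<in>{w \<in> dyck_upto (Suc n). elim w = v}. f v w)" by (intro sum.cong) auto
    also have "\<dots> \<le> (\<Sum>w\<in>fibre (2 * Suc n) v. f v w)"
      by (rule sum_mono2[OF finite_fibre]) (auto simp: f0 fibre_def dyck_upto_def)
    finally show "(\<Sum>w\<in>{w \<in> dyck_upto (Suc n). elim w = v}. f (elim w) w) \<le> (\<Sum>w\<in>fibre (2 * Suc n) v. f v w)" .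
  qed
  also have "\<dots> \<le> (\<Sum>v\<in>dyck_upto n. (1 + 2 * (x / (1 - x)) * (1 + t)) / (1 - x) *
      ((real (Suc (length v)) + 2 * (t + 1) * peaks v) * W v))"
    by (rule sum_mono) (rule fibre)
  finally show ?thesis unfolding partial_sum_def W_def x_def sum_distrib_left .
qed

lemma partial_sum_le:
  assumes "\<forall>k\<ge>1. 0 \<le> q k \<and> q k < 1" "0 \<le> t"
  shows "partial_sum n q t \<le> (\<Prod>j\<in>{1..n}. (1 + 2 * (q j / (1 - q j)) * (real j + t)) / (1 - q j))"
  using assms
proof (induction n arbitrary: q t)
  case 0
  have "dyck_upto 0 = {[]}" by (auto simp: dyck_upto_def)
  then show ?case by (simp add: partial_sum_def)
next
  case (Suc n)
  define C where "C = (1 + 2 * (q 1 / (1 - q 1)) * (1 + t)) / (1 - q 1)"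
  have "0 \<le> C" unfolding C_def using Suc.prems by (auto intro!: divide_nonneg_nonneg add_nonneg_nonneg mult_nonneg_nonneg simp: less_imp_le)
  have "partial_sum (Suc n) q t \<le> C * partial_sum n (\<lambda>k. q (Suc k)) (t + 1)"
    unfolding C_def by (rule partial_sum_Suc[OF Suc.prems])
  also have "\<dots> \<le> C * (\<Prod>j\<in>{1..n}. (1 + 2 * (q (Suc j) / (1 - q (Suc j))) * (real j + (t + 1))) / (1 - q (Suc j)))"
    using Suc.IH[of "\<lambda>k. q (Suc k)" "t + 1"] Suc.prems \<open>0 \<le> C\<close> by (intro mult_left_mono) auto
  also have "\<dots> = C * (\<Prod>j\<in>{Suc 1..Suc n}. (1 + 2 * (q j / (1 - q j)) * (real j + t)) / (1 - q j))"
    by (simp add: prod.shift_bounds_cl_Suc_ivl add_ac del: prod.cl_ivl_Suc)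
  also have "\<dots> = (\<Prod>j\<in>{1..Suc n}. (1 + 2 * (q j / (1 - q j)) * (real j + t)) / (1 - q j))"
    by (subst (2) prod.atLeast_Suc_atMost) (simp_all add: C_def)
  finally show ?case .
qed

lemma partial_sum_bounded:
  assumes "q \<in> Q_plus"
  obtains C where "\<And>n. partial_sum n q 0 \<le> C"
proof -
  have q: "\<forall>k\<ge>1. 0 \<le> q k \<and> q k < 1" and sq: "summable (\<lambda>k. real (Suc k) * q (Suc k))"
    using assms by (auto simp: Q_plus_def)
  define r where "r k = q k / (1 - q k)" for k
  have r: "0 \<le> r k" if "1 \<le> k" for k using q that by (auto simp: r_def)
  have "(\<lambda>k. real (Suc k) * q (Suc k)) \<longlonglongrightarrow> 0" by (rule summable_LIMSEQ_zero[OF sq])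
  then have "eventually (\<lambda>k. real (Suc k) * q (Suc k) < 1/2) sequentially"
    by (rule order_tendstoD) simp
  \<comment> \<open>Once \<open>q (Suc k) \<le> 1/2\<close>, the ratio \<open>r (Suc k)\<close> is
    at most \<open>2 * q (Suc k)\<close>.\<close>
  then have "eventually (\<lambda>k. norm (real (Suc k) * r (Suc k)) \<le> 2 * (real (Suc k) * q (Suc k))) sequentially"
  proof eventually_elim
    case (elim k)
    have q0: "0 \<le> q (Suc k)" "q (Suc k) < 1" using q by auto
    then have "q (Suc k) * 1 \<le> real (Suc k) * q (Suc k)" by (simp add: algebra_simps)
    then have "1/2 \<le> 1 - q (Suc k)" using elim by simp
    then have "q (Suc k) / (1 - q (Suc k)) \<le> q (Suc k) / (1/2)"
      using q0 by (intro divide_left_mono) auto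
    then have "r (Suc k) \<le> 2 * q (Suc k)" by (simp add: r_def)
    then have "real (Suc k) * r (Suc k) \<le> real (Suc k) * (2 * q (Suc k))" by (rule mult_left_mono) simp
    with r[of "Suc k"] show ?case by simp
  qed
  then have sr: "summable (\<lambda>k. real (Suc k) * r (Suc k))"
    by (rule summable_comparison_test_ev) (intro summable_mult sq)
  show ?thesis
  proof (rule that)
    fix n
    have "partial_sum n q 0 \<le> (\<Prod>j\<in>{1..n}. (1 + 2 * r j * real j) / (1 - q j))"
      using partial_sum_le[OF q, of 0 n] by (simp add: r_def)
    also have "\<dots> \<le> (\<Prod>j\<in>{1..n}. exp (3 * (real j * r j)))"
    proof (rule prod_mono, intro conjI)
      fix j assume j: "j \<in> {1..n}"
      then have qj: "0 \<le> q j" "q j < 1" and rj: "0 \<le> r j" using q r by auto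
      show "0 \<le> (1 + 2 * r j * real j) / (1 - q j)" using qj rj by simp
      \<comment> \<open>The identity \<open>1 / (1 - q j) = 1 + r j\<close> makes both factors
        amenable to \<open>1 + x \<le> exp x\<close>. The constant 3 then comes from
        \<open>2 * r j * j + r j\<close> and \<open>1 \<le> j\<close>.\<close>
      have "(1 + 2 * r j * real j) / (1 - q j) = (1 + 2 * r j * real j) * (1 + r j)"
        using qj by (simp add: r_def field_simps)
      also have "\<dots> \<le> exp (2 * r j * real j) * exp (r j)"
        using rj by (intro mult_mono exp_ge_add_one_self) auto
      also have "\<dots> = exp (2 * r j * real j + r j)" by (simp add: exp_add)
      also have "\<dots> \<le> exp (3 * (real j * r j))"
        using j rj mult_right_mono[of 1 "real j" "r j"] by simp
      finally show "(1 + 2 * r j * real j) / (1 - q j) \<le> exp (3 * (real j * r j))" .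
    qed
    also have "\<dots> = exp (3 * (\<Sum>j\<in>{1..n}. real j * r j))"
      by (simp add: exp_sum sum_distrib_left)
    also have "(\<Sum>j\<in>{1..n}. real j * r j) = (\<Sum>j<n. real (Suc j) * r (Suc j))"
      by (rule sum.reindex_bij_witness[of _ Suc "\<lambda>j. j - 1"]) auto
    also have "exp (3 * (\<Sum>j<n. real (Suc j) * r (Suc j))) \<le> exp (3 * (\<Sum>j. real (Suc j) * r (Suc j)))"
      using sum_le_suminf[OF sr, of "{..<n}"] r by simp
    finally show "partial_sum n q 0 \<le> exp (3 * (\<Sum>j. real (Suc j) * r (Suc j)))" .
  qed
qed

lemma nn_integral_dyck_le:
  fixes f :: "bool list \<Rightarrow> ennreal"
  assumes "\<And>n. (\<Sum>w\<in>dyck_upto n. f w) \<le> C"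
  shows "(\<integral>\<^sup>+ w. f w \<partial>count_space {w. dyck w}) \<le> C"
proof -
  have "(\<integral>\<^sup>+ w. f w \<partial>count_space {w. dyck w}) = (\<integral>\<^sup>+ w. (SUP n. f w * indicator (dyck_upto n) w) \<partial>count_space {w. dyck w})"
  proof (rule nn_integral_cong)
    fix w assume "w \<in> space (count_space {w. dyck w})"
    then have w: "w \<in> dyck_upto (length w)" by (simp add: dyck_upto_def)
    show "f w = (SUP n. f w * indicator (dyck_upto n) w)"
    proof (rule antisym)
      show "f w \<le> (SUP n. f w * indicator (dyck_upto n) w)"
        by (rule SUP_upper2[of "length w"]) (use w in auto)
    qed (auto intro!: SUP_least split: split_indicator)
  qed
  also have "\<dots> = (SUP n. \<integral>\<^sup>+ w. f w * indicator (dyck_upto n) w \<partial>count_space {w. dyck w})"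
    by (rule nn_integral_monotone_convergence_SUP)
       (auto simp: incseq_def le_fun_def dyck_upto_def split: split_indicator)
  also have "\<dots> \<le> C"
  proof (rule SUP_least)
    fix n
    have "(\<integral>\<^sup>+ w. f w * indicator (dyck_upto n) w \<partial>count_space {w. dyck w}) = (\<Sum>w\<in>dyck_upto n. f w)"
      by (subst nn_integral_count_space'[OF finite_dyck_upto[of n]]) (auto simp: dyck_upto_def)
    with assms show "(\<integral>\<^sup>+ w. f w * indicator (dyck_upto n) w \<partial>count_space {w. dyck w}) \<le> C" by simp
  qed
  finally show ?thesis .
qed

section \<open>The law of an excursion\<close>

lemma A_set_nonneg: "\<alpha> \<in> A_set \<Longrightarrow> 1 \<le> k \<Longrightarrow> 0 \<le> \<alpha> k"
  by (simp add: A_set_def)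

lemma partition_fun_dyck:
  "partition_fun \<alpha> = (\<integral>\<^sup>+ w. ennreal (word_weight \<alpha> w) \<partial>count_space {w. dyck w})"
  unfolding partition_fun_def
  by (subst nn_integral_bij_count_space[OF bij_betw_steps, symmetric])
     (intro nn_integral_cong, simp add: weight_eq)

lemma partition_fun_finite: "\<alpha> \<in> A_set \<Longrightarrow> partition_fun \<alpha> < \<infinity>"
  by (simp add: A_set_def)

lemma partition_fun_ge_1: "1 \<le> partition_fun \<alpha>"
proof -
  have "(\<integral>\<^sup>+ w. indicator {[]} w \<partial>count_space {w. dyck w}) \<le> partition_fun \<alpha>"
    unfolding partition_fun_dyck by (intro nn_integral_mono) (auto split: split_indicator)
  then show ?thesis by simp
qed

lemma partition_fun_pos:
  assumes "\<alpha> \<in> A_set"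
  shows "0 < enn2real (partition_fun \<alpha>)"
  using partition_fun_finite[OF assms] partition_fun_ge_1[of \<alpha>]
  by (auto simp: enn2real_positive_iff intro: less_le_trans[of 0 1])

lemma divide_partition_fun:
  assumes "\<alpha> \<in> A_set" "0 \<le> a"
  shows "ennreal a / partition_fun \<alpha> = ennreal (a / enn2real (partition_fun \<alpha>))"
proof -
  have "ennreal a / partition_fun \<alpha> = ennreal a / ennreal (enn2real (partition_fun \<alpha>))"
    using partition_fun_finite[OF assms(1)] by simp
  with assms(2) partition_fun_pos[OF assms(1)] show ?thesis by (simp add: divide_ennreal)
qed

lemma space_exc_law [simp]: "space (exc_law \<alpha>) = excursions"
  and sets_exc_law [simp, measurable_cong]: "sets (exc_law \<alpha>) = sets (count_space excursions)"
  by (simp_all add: exc_law_def)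

lemma measurable_exc_law: "f \<in> excursions \<rightarrow> space N \<Longrightarrow> f \<in> measurable (exc_law \<alpha>) N"
  by (subst measurable_cong_sets[OF sets_exc_law refl]) simp

lemma nn_integral_exc_law:
  "(\<integral>\<^sup>+ e. f e \<partial>exc_law \<alpha>) = (\<integral>\<^sup>+ e. ennreal (weight \<alpha> e) * f e \<partial>count_space excursions) / partition_fun \<alpha>"
  unfolding exc_law_def
  by (subst nn_integral_density, simp, simp, subst nn_integral_divide[symmetric], simp)
     (intro nn_integral_cong, simp add: divide_ennreal_def mult_ac)

lemma nn_integral_exc_law_steps:
  "(\<integral>\<^sup>+ e. f (steps e) \<partial>exc_law \<alpha>)
    = (\<integral>\<^sup>+ w. ennreal (word_weight \<alpha> w) * f w \<partial>count_space {w. dyck w}) / partition_fun \<alpha>"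
  unfolding nn_integral_exc_law
  by (subst nn_integral_bij_count_space[OF bij_betw_steps, symmetric])
     (intro arg_cong2[where f = "(/)"] refl nn_integral_cong, simp add: weight_eq)

lemma prob_space_exc_law: assumes "\<alpha> \<in> A_set" shows "prob_space (exc_law \<alpha>)"
proof
  have "emeasure (exc_law \<alpha>) (space (exc_law \<alpha>)) = (\<integral>\<^sup>+ e. 1 \<partial>exc_law \<alpha>)" by simp
  also have "\<dots> = partition_fun \<alpha> / partition_fun \<alpha>"
    unfolding nn_integral_exc_law by (simp add: partition_fun_def)
  also have "\<dots> = 1"
    using partition_fun_finite[OF assms] partition_fun_ge_1[of \<alpha>] by (intro ennreal_divide_self) auto
  finally show "emeasure (exc_law \<alpha>) (space (exc_law \<alpha>)) = 1" .
qed

lemma sum_soliton_count: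
  assumes "e \<in> excursions"
  shows "(\<Sum>k. of_nat (Suc k) * of_nat (soliton_count (Suc k) e)) = (of_nat (half_length e) :: ennreal)"
proof -
  let ?n = "count_list (steps e) True"
  have "(\<Sum>k. of_nat (Suc k) * of_nat (soliton_count (Suc k) e)) =
      (\<Sum>k<?n. of_nat (Suc k) * of_nat (soliton_count (Suc k) e) :: ennreal)"
    by (rule suminf_finite) (auto simp: soliton_count_energy(3)[OF assms])
  also have "\<dots> = of_nat (\<Sum>k<?n. Suc k * soliton_count (Suc k) e)"
    by (simp only: of_nat_sum of_nat_mult)
  also have "(\<Sum>k<?n. Suc k * soliton_count (Suc k) e) = (\<Sum>k\<in>{1..?n}. soliton_count k e * k)"
    by (rule sum.reindex_bij_witness[of _ "\<lambda>k. k - 1" Suc]) auto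
  also have "\<dots> = half_length e"
    using soliton_count_energy(1)[OF assms, of 0] by (simp add: half_length_steps[OF assms] spill_0)
  finally show ?thesis .
qed

lemma sum_soliton_density:
  "(\<Sum>k. of_nat (Suc k) * soliton_density (Suc k) \<alpha>) = (\<integral>\<^sup>+ e. of_nat (half_length e) \<partial>exc_law \<alpha>)"
proof -
  have [measurable]: "f \<in> borel_measurable (exc_law \<alpha>)" for f :: "int list \<Rightarrow> ennreal"
    by (simp add: measurable_exc_law)
  have "(\<Sum>k. of_nat (Suc k) * soliton_density (Suc k) \<alpha>)
    = (\<Sum>k. \<integral>\<^sup>+ e. of_nat (Suc k) * of_nat (soliton_count (Suc k) e) \<partial>exc_law \<alpha>)"
    unfolding soliton_density_def by (subst nn_integral_cmult) auto
  also have "\<dots> = (\<integral>\<^sup>+ e. (\<Sum>k. of_nat (Suc k) * of_nat (soliton_count (Suc k) e)) \<partial>exc_law \<alpha>)"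
    by (rule nn_integral_suminf[symmetric]) simp
  also have "\<dots> = (\<integral>\<^sup>+ e. of_nat (half_length e) \<partial>exc_law \<alpha>)"
    by (intro nn_integral_cong) (simp only: space_exc_law sum_soliton_count)
  finally show ?thesis .
qed

text \<open>Half of the length of an excursion is the sum of \<open>k\<close> times its number of
  \<open>k\<close>-solitons, so the summability condition says that the mean length is
  finite.\<close>

lemma A_plus_iff:
  "\<alpha> \<in> A_plus \<longleftrightarrow> \<alpha> \<in> A_set \<and> (\<integral>\<^sup>+ e. of_nat (half_length e) \<partial>exc_law \<alpha>) < \<infinity>"
proof -
  have "(\<Sum>k. 2 * of_nat (Suc k) * soliton_density (Suc k) \<alpha>)
      = 2 * (\<integral>\<^sup>+ e. of_nat (half_length e) \<partial>exc_law \<alpha>)"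
    unfolding sum_soliton_density[symmetric] by (subst ennreal_suminf_cmult[symmetric]) (simp only: mult.assoc)
  then show ?thesis by (auto simp: A_plus_def ennreal_mult_less_top)
qed

lemma A_plus_imp_A_set: "\<alpha> \<in> A_plus \<Longrightarrow> \<alpha> \<in> A_set"
  by (simp add: A_plus_iff)

lemma mean_spacing_eq:
  "mean_spacing \<alpha> = 1 + 2 * enn2real (\<integral>\<^sup>+ e. of_nat (half_length e) \<partial>exc_law \<alpha>)"
  unfolding mean_spacing_def sum_soliton_density ..

text \<open>At \<open>t = 0\<close> the summands of \<open>partial_sum\<close> carry the factor
  \<open>length w + 1\<close>, which dominates both 1 and half of the length; one bound gives both
  the finite partition function and the finite mean length.\<close>

lemma alpha_of_Q_plus: assumes "q \<in> Q_plus" shows "alpha_of q \<in> A_plus"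
proof -
  have q: "\<forall>k\<ge>1. 0 \<le> q k \<and> q k < 1" using assms by (simp add: Q_plus_def)
  obtain C where C: "\<And>n. partial_sum n q 0 \<le> C" using partial_sum_bounded[OF assms] by blast
  have W: "0 \<le> word_weight (alpha_of q) w" for w
    by (rule word_weight_nonneg) (rule alpha_of_bounds[OF q])
  have le: "(\<integral>\<^sup>+ w. ennreal (word_weight (alpha_of q) w * g w) \<partial>count_space {w. dyck w}) \<le> ennreal C"
    if g: "\<And>w. 0 \<le> g w" "\<And>w. g w \<le> real (Suc (length w))" for g
  proof (rule nn_integral_dyck_le)
    fix n
    have "(\<Sum>w\<in>dyck_upto n. word_weight (alpha_of q) w * g w) \<le> partial_sum n q 0"
      unfolding partial_sum_def using g W
      by (intro sum_mono) (simp add: mult.commute[of "word_weight _ _"] mult_right_mono)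
    with C[of n] show "(\<Sum>w\<in>dyck_upto n. ennreal (word_weight (alpha_of q) w * g w)) \<le> ennreal C"
      using g W by (subst sum_ennreal) (auto intro: ennreal_leI order_trans)
  qed
  have "partition_fun (alpha_of q) \<le> ennreal C"
    unfolding partition_fun_dyck using le[of "\<lambda>_. 1"] by simp
  then have A: "alpha_of q \<in> A_set"
    using alpha_of_bounds[OF q] by (auto simp: A_set_def intro: le_less_trans)
  have "(\<integral>\<^sup>+ e. of_nat (half_length e) \<partial>exc_law (alpha_of q))
    = (\<integral>\<^sup>+ e. of_nat (count_list (steps e) True) \<partial>exc_law (alpha_of q))"
    by (intro nn_integral_cong) (simp add: half_length_steps)
  also have "\<dots> = (\<integral>\<^sup>+ w. ennreal (word_weight (alpha_of q) w) * of_nat (count_list w True) \<partial>count_space {w. dyck w})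
      / partition_fun (alpha_of q)"
    by (rule nn_integral_exc_law_steps)
  also have "(\<integral>\<^sup>+ w. ennreal (word_weight (alpha_of q) w) * of_nat (count_list w True) \<partial>count_space {w. dyck w})
    = (\<integral>\<^sup>+ w. ennreal (word_weight (alpha_of q) w * count_list w True) \<partial>count_space {w. dyck w})"
    by (intro nn_integral_cong) (simp add: ennreal_mult W flip: ennreal_of_nat_eq_real_of_nat)
  also have "\<dots> / partition_fun (alpha_of q) \<le> ennreal C / partition_fun (alpha_of q)"
  proof (intro divide_right_mono_ennreal le)
    show "real (count_list w True) \<le> real (Suc (length w))" for w
      using count_le_length[of w True] by simp
  qed simp
  also have "\<dots> < \<infinity>"
    using partition_fun_ge_1[of "alpha_of q"]
    by (auto simp: ennreal_divide_eq_top_iff simp flip: less_top)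
  finally show ?thesis using A by (simp add: A_plus_iff)
qed

text \<open>A \<open>pmf\<close> on all words, so that conditioning on heights and the comparison of
  laws can be done with point masses.\<close>

definition word_law :: "(nat \<Rightarrow> real) \<Rightarrow> bool list pmf" where
  "word_law \<alpha> = embed_pmf (\<lambda>w. if dyck w then word_weight \<alpha> w / enn2real (partition_fun \<alpha>) else 0)"

lemma pmf_word_law:
  assumes "\<alpha> \<in> A_set"
  shows "pmf (word_law \<alpha>) w = (if dyck w then word_weight \<alpha> w / enn2real (partition_fun \<alpha>) else 0)"
  unfolding word_law_def
proof (rule pmf_embed_pmf)
  have W: "0 \<le> word_weight \<alpha> w" for w using assms by (intro word_weight_nonneg A_set_nonneg)
  let ?Z = "partition_fun \<alpha>"
  note Z = partition_fun_pos[OF assms] and div = divide_partition_fun[OF assms]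
  show "0 \<le> (if dyck w then word_weight \<alpha> w / enn2real ?Z else 0)" for w using W Z by simp
  have "(\<integral>\<^sup>+ w. ennreal (if dyck w then word_weight \<alpha> w / enn2real ?Z else 0) \<partial>count_space UNIV)
    = (\<integral>\<^sup>+ w. ennreal (word_weight \<alpha> w) / ?Z \<partial>count_space {w. dyck w})"
    by (subst (2) nn_integral_count_space_indicator, simp, intro nn_integral_cong)
       (use W in \<open>auto simp: div split: split_indicator\<close>)
  also have "\<dots> = ?Z / ?Z" by (subst nn_integral_divide) (simp_all add: partition_fun_dyck)
  also have "\<dots> = 1"
    using partition_fun_finite[OF assms] partition_fun_ge_1[of \<alpha>] by (intro ennreal_divide_self) auto
  finally show "(\<integral>\<^sup>+ w. ennreal (if dyck w then word_weight \<alpha> w / enn2real ?Z else 0) \<partial>count_space UNIV) = 1" .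
qed

lemma emeasure_exc_law_steps:
  assumes "\<alpha> \<in> A_set"
  shows "emeasure (exc_law \<alpha>) {e \<in> excursions. steps e = w} = ennreal (pmf (word_law \<alpha>) w)"
proof -
  let ?Z = "partition_fun \<alpha>"
  have W: "0 \<le> word_weight \<alpha> w" for w using assms by (intro word_weight_nonneg A_set_nonneg)
  note Z = partition_fun_pos[OF assms] and div = divide_partition_fun[OF assms]
  have "emeasure (exc_law \<alpha>) {e \<in> excursions. steps e = w} = (\<integral>\<^sup>+ e. indicator {w} (steps e) \<partial>exc_law \<alpha>)"
    by (subst nn_integral_indicator[symmetric], simp, intro nn_integral_cong) (auto split: split_indicator)
  also have "\<dots> = (\<integral>\<^sup>+ v. ennreal (word_weight \<alpha> v) * indicator {w} v \<partial>count_space {w. dyck w}) / ?Z"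
    by (rule nn_integral_exc_law_steps)
  also have "(\<integral>\<^sup>+ v. ennreal (word_weight \<alpha> v) * indicator {w} v \<partial>count_space {w. dyck w})
    = (if dyck w then ennreal (word_weight \<alpha> w) else 0)"
  proof (cases "dyck w")
    case True
    then show ?thesis by (subst nn_integral_count_space'[of "{w}"]) auto
  next
    case False
    then have "(\<integral>\<^sup>+ v. ennreal (word_weight \<alpha> v) * indicator {w} v \<partial>count_space {w. dyck w})
      = (\<integral>\<^sup>+ v. 0 \<partial>count_space {w. dyck w})"
      by (intro nn_integral_cong) (auto split: split_indicator)
    with False show ?thesis by simp
  qed
  also have "\<dots> / ?Z = ennreal (pmf (word_law \<alpha>) w)"
    unfolding pmf_word_law[OF assms] using W by (simp add: div)
  finally show ?thesis .
qed

section \<open>The dynamics on concatenated Dyck words\<close>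

text \<open>The separator behind a word is the record that ends the excursion; the record at the
  origin lies in front of the first word and is left out.\<close>

definition cat :: "bool list list \<Rightarrow> bool list" where
  "cat ws = concat (map (\<lambda>w. w @ [False]) ws)"

lemma cat_simps [simp]: "cat [] = []" "cat (w # ws) = w @ False # cat ws"
  by (simp_all add: cat_def)

lemma cat_append [simp]: "cat (us @ vs) = cat us @ cat vs"
  by (simp add: cat_def)

text \<open>First passage of the walk from 0 to \<open>- n\<close>.\<close>

definition fits :: "nat \<Rightarrow> bool list \<Rightarrow> bool" where
  "fits n w \<longleftrightarrow> level w = - int n \<and> (\<forall>i<length w. - int n < level (take i w))"

lemma fits_cat: "\<forall>w\<in>set ws. dyck w \<Longrightarrow> fits (length ws) (cat ws)"
proof (induction ws)
  case (Cons w ws)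
  then have IH: "fits (length ws) (cat ws)" and w: "dyck w" by auto
  have "- int (Suc (length ws)) < level (take i (cat (w # ws)))" if "i < length (cat (w # ws))" for i
  proof (cases "i \<le> length w")
    case True
    with w show ?thesis by (auto simp: dyck_def intro: less_le_trans[of _ 0])
  next
    case False
    then obtain j where j: "i = length w + Suc j" by (metis add_Suc_right less_imp_Suc_add not_le)
    with that IH w show ?thesis by (auto simp: fits_def dyck_def)
  qed
  with IH w show ?case by (auto simp: fits_def dyck_def)
qed (simp add: fits_def)

text \<open>First-passage decomposition: the part before the step to the first negative level is a
  Dyck word, and what follows that step is a first passage over one level less.\<close>

lemma fits_obtain:
  assumes "fits n w"
  obtains ws where "length ws = n" "\<forall>w\<in>set ws. dyck w" "w = cat ws"
proof -
  have "\<exists>ws. length ws = n \<and> (\<forall>w\<in>set ws. dyck w) \<and> w = cat ws"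
    using assms
  proof (induction n arbitrary: w)
    case 0
    then have "w = []" by (cases w) (auto simp: fits_def)
    then show ?case by simp
  next
    case (Suc n)
    define i where "i = (LEAST i. level (take i w) < 0)"
    have "level (take (length w) w) < 0" using Suc.prems by (simp add: fits_def)
    then have i: "level (take i w) < 0" "i \<le> length w"
      unfolding i_def by (rule LeastI, rule Least_le)
    have before: "0 \<le> level (take j w)" if "j < i" for j
      using not_less_Least[of j "\<lambda>i. level (take i w) < 0"] that by (simp add: i_def not_less)
    from i(1) obtain i' where i': "i = Suc i'" by (cases i) auto
    define u where "u = take i' w"
    have "level (take i w) = level u + (if w ! i' then 1 else -1)"
      using i(2) i' by (simp add: level_take_Suc u_def)
    with before[of i'] i i' have u: "level u = 0" "\<not> w ! i'" by (auto simp: u_def split: if_splits)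
    have "0 \<le> level (take j u)" for j
      using before[of "min i' j"] i' by (simp add: u_def min.commute)
    with u have "dyck u" by (simp add: dyck_def)
    have w: "w = u @ False # drop i w"
      using i(2) i' u(2) id_take_nth_drop[of i' w] by (simp add: u_def)
    have "fits n (drop i w)"
      unfolding fits_def
    proof (intro conjI allI impI)
      show "level (drop i w) = - int n"
        using Suc.prems u(1) arg_cong[OF w, of level] by (simp add: fits_def)
      fix j assume "j < length (drop i w)"
      then have "- int (Suc n) < level (take (i + j) w)" using Suc.prems by (auto simp: fits_def)
      also have "take (i + j) w = take i w @ take j (drop i w)" by (rule take_add)
      also have "take i w = u @ [False]" using i(2) i' u(2) by (simp add: u_def take_Suc_conv_app_nth)
      finally show "- int n < level (take j (drop i w))" using u(1) by simp
    qed
    from Suc.IH[OF this] obtain ws where "length ws = n" "\<forall>w\<in>set ws. dyck w" "drop i w = cat ws" by blast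
    with w \<open>dyck u\<close> show ?case by (intro exI[of _ "u # ws"]) auto
  qed
  then show ?thesis using that by blast
qed

text \<open>Were one of the prefixes shorter, the other would contain its separator and reach level
  -1.\<close>

lemma dyck_False_prefix:
  assumes "dyck w" "dyck w'" "w @ False # x = w' @ False # x'"
  shows "w = w'"
proof -
  have *: "\<not> length u < length v" if "dyck u" "dyck v" "u @ False # x = v @ False # x'" for u v x x'
  proof
    assume l: "length u < length v"
    have "take (Suc (length u)) (u @ False # x) = u @ [False]" by simp
    moreover have "take (Suc (length u)) (v @ False # x') = take (Suc (length u)) v" using l by simp
    ultimately have "take (Suc (length u)) v = u @ [False]" using that(3) by simp
    then have "level (take (Suc (length u)) v) = -1" using that(1) by (simp add: dyck_def)
    moreover have "0 \<le> level (take (Suc (length u)) v)" using that(2) by (simp only: dyck_def)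
    ultimately show False by linarith
  qed
  have "length w = length w'" using *[OF assms] *[OF assms(2,1) assms(3)[symmetric]] by simp
  with assms(3) show ?thesis using append_eq_append_conv by blast
qed

lemma cat_inject:
  assumes "\<forall>w\<in>set ws. dyck w" "\<forall>w\<in>set ws'. dyck w" "cat ws = cat ws'"
  shows "ws = ws'"
  using assms
proof (induction ws arbitrary: ws')
  case Nil
  then show ?case by (cases ws') auto
next
  case (Cons w ws)
  then obtain w' ws'' where ws': "ws' = w' # ws''" by (cases ws') auto
  with Cons.prems have "w = w'" by (intro dyck_False_prefix[of w w' "cat ws" "cat ws''"]) auto
  moreover have "ws = ws''" 
  proof (rule Cons.IH)
    show "cat ws = cat ws''" using Cons.prems(3) ws' \<open>w = w'\<close> by simp
  qed (use Cons.prems ws' in auto)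
  ultimately show ?case using ws' by simp
qed

section \<open>Height conditions and mirror images\<close>

definition below :: "nat \<Rightarrow> bool list \<Rightarrow> bool" where
  "below h w \<longleftrightarrow> (\<forall>i. level (take i w) \<le> int h)"

abbreviation compl_words :: "bool list list \<Rightarrow> bool list list" where
  "compl_words \<equiv> map (map Not)"

lemma level_cat_comp: "\<forall>w\<in>set ws. dyck w \<Longrightarrow> level (cat (compl_words ws)) = - int (length ws)"
  by (induction ws) (auto simp: dyck_def)

text \<open>The \<open>j\<close>-th complemented word starts at level \<open>- j\<close> and
  descends by the height of \<open>ws ! j\<close>; it stays above the final level iff that height is
  at most \<open>length ws - 1 - j\<close>.\<close>

lemma fits_cat_comp:
  assumes "\<forall>w\<in>set ws. dyck w"
  shows "fits (length ws) (cat (compl_words ws)) \<longleftrightarrow> (\<forall>j<length ws. below (length ws - 1 - j) (ws ! j))"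
  using assms
proof (induction ws)
  case (Cons w ws)
  then have w: "dyck w" and ws: "\<forall>w\<in>set ws. dyck w" by auto
  let ?x = "cat (compl_words ws)"
  have "(\<forall>i<length (cat (compl_words (w # ws))). - int (Suc (length ws)) < level (take i (cat (compl_words (w # ws)))))
    \<longleftrightarrow> (\<forall>i\<le>length w. - int (Suc (length ws)) < level (take i (cat (compl_words (w # ws))))) \<and>
      (\<forall>j<length ?x. - int (Suc (length ws)) < level (take (length w + Suc j) (cat (compl_words (w # ws)))))"
    (is "?L \<longleftrightarrow> ?A \<and> ?B")
  proof
    assume "?A \<and> ?B"
    show ?L
    proof (intro allI impI)
      fix i assume i: "i < length (cat (compl_words (w # ws)))"
      show "- int (Suc (length ws)) < level (take i (cat (compl_words (w # ws))))"
      proof (cases "i \<le> length w")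
        case False
        then obtain j where "i = length w + Suc j" by (metis add_Suc_right less_imp_Suc_add not_le)
        with i \<open>?A \<and> ?B\<close> show ?thesis by auto
      qed (use \<open>?A \<and> ?B\<close> in blast)
    qed
  next
    assume L: ?L
    then show "?A \<and> ?B" by (intro conjI allI impI L[rule_format]) auto
  qed
  also have "?A \<longleftrightarrow> below (length ws) w"
  proof -
    have "?A \<longleftrightarrow> (\<forall>i\<le>length w. level (take i w) \<le> int (length ws))"
      by (auto simp: take_map)
    also have "\<dots> \<longleftrightarrow> below (length ws) w"
      unfolding below_def by (metis le_cases order_refl take_all)
    finally show ?thesis .
  qed
  also have "?B \<longleftrightarrow> (\<forall>j<length ?x. - int (length ws) < level (take j ?x))"
    using w by (auto simp: dyck_def)
  finally have "fits (Suc (length ws)) (cat (compl_words (w # ws))) \<longleftrightarrow> below (length ws) w \<and> fits (length ws) ?x"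
    using level_cat_comp[OF Cons.prems] level_cat_comp[OF ws] unfolding fits_def by simp
  with Cons.IH[OF ws] show ?case by (auto simp: nth_Cons less_Suc_eq_0_disj split: nat.splits)
qed (simp add: fits_def)

definition mirror :: "bool list list \<Rightarrow> bool list list" where
  "mirror ws = rev (map (\<lambda>w. rev (map Not w)) ws)"

lemma mirror_mirror [simp]: "mirror (mirror ws) = ws"
  by (simp add: mirror_def rev_map comp_def)

lemma length_mirror [simp]: "length (mirror ws) = length ws"
  by (simp add: mirror_def)

lemma dyck_mirror: "\<forall>w\<in>set ws. dyck w \<Longrightarrow> \<forall>w\<in>set (mirror ws). dyck w"
  by (auto simp: mirror_def dyck_rev_Not)

text \<open>The final separator stays in place, so that a reversed concatenation again ends with a
  separator.\<close>

definition backwards :: "bool list \<Rightarrow> bool list" where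
  "backwards x = rev (butlast x) @ [False]"

lemma backwards_backwards: "x \<noteq> [] \<Longrightarrow> \<not> last x \<Longrightarrow> backwards (backwards x) = x"
  by (cases x rule: rev_cases) (auto simp: backwards_def)

lemma last_cat: "ws \<noteq> [] \<Longrightarrow> cat ws \<noteq> [] \<and> \<not> last (cat ws)"
proof (induction ws)
  case (Cons w ws)
  then show ?case by (cases "ws = []") auto
qed simp

text \<open>The load of the carrier of infinite capacity, read backwards, is again such a load; the mirrored
  blocks describe it.\<close>

lemma cat_compl_words_eq:
  assumes "ws \<noteq> []"
  shows "cat (compl_words ws) = backwards (cat (mirror ws))"
proof -
  have shift: "concat (map ((#) False) us) @ [False] = False # cat us" for us
    by (induction us) auto
  have "rev (cat us) = concat (map (\<lambda>u. False # rev u) (rev us))" for us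
    by (induction us) auto
  then have "rev (cat (mirror ws)) = concat (map ((#) False) (compl_words ws))"
    by (simp add: mirror_def comp_def)
  then have "rev (cat (mirror ws)) @ [False] = False # cat (compl_words ws)"
    using shift[of "compl_words ws"] by simp
  moreover have "mirror ws \<noteq> []" using assms by (simp add: mirror_def)
  then obtain y where "cat (mirror ws) = y @ [False]"
    using last_cat[of "mirror ws"] by (cases "cat (mirror ws)" rule: rev_cases) auto
  ultimately show ?thesis by (simp add: backwards_def)
qed

lemma below_rev_Not: assumes "dyck w" shows "below h (rev (map Not w)) \<longleftrightarrow> below h w"
proof -
  have *: "below h (rev (map Not w))" if "below h w" "dyck w" for w
    unfolding below_def
  proof
    fix i
    have "level (take (length w - i) w) + level (drop (length w - i) w) = 0"
      using that(2) level_append[of "take (length w - i) w" "drop (length w - i) w"] by (simp add: dyck_def)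
    moreover have "level (take (length w - i) w) \<le> int h" using that by (simp add: below_def)
    ultimately show "level (take i (rev (map Not w))) \<le> int h"
      by (simp add: take_rev' drop_map del: rev_drop)
  qed
  have "rev (map Not (rev (map Not w))) = w" by (simp add: rev_map comp_def)
  then show ?thesis using *[of w] *[of "rev (map Not w)"] assms dyck_rev_Not by metis
qed

text \<open>By \<open>falling_iff\<close>, the sequences whose complemented concatenation splits
  into \<open>n\<close> excursions again. The set \<open>rising n\<close> consists of their mirror
  images (\<open>rising_iff_mirror\<close>).\<close>

definition falling :: "nat \<Rightarrow> bool list list set" where
  "falling n = {ws. length ws = n \<and> (\<forall>w\<in>set ws. dyck w) \<and> (\<forall>j<n. below (n - 1 - j) (ws ! j))}"

definition rising :: "nat \<Rightarrow> bool list list set" where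
  "rising n = {ws. length ws = n \<and> (\<forall>w\<in>set ws. dyck w) \<and> (\<forall>j<n. below j (ws ! j))}"

lemma falling_iff: "ws \<in> falling n \<longleftrightarrow> length ws = n \<and> (\<forall>w\<in>set ws. dyck w) \<and> fits n (cat (compl_words ws))"
  unfolding falling_def using fits_cat_comp by auto

lemma rising_iff_mirror: "ws \<in> rising n \<longleftrightarrow> mirror ws \<in> falling n"
proof (cases "length ws = n \<and> (\<forall>w\<in>set ws. dyck w)")
  case True
  have nth: "mirror ws ! j = rev (map Not (ws ! (n - 1 - j)))" if "j < n" for j
    using that True by (simp add: mirror_def rev_nth)
  have below: "below h (mirror ws ! j) \<longleftrightarrow> below h (ws ! (n - 1 - j))" if "j < n" for j h
    unfolding nth[OF that] by (rule below_rev_Not) (use that True in auto)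
  have "(\<forall>j<n. below (n - 1 - j) (mirror ws ! j)) \<longleftrightarrow> (\<forall>j<n. below (n - 1 - j) (ws ! (n - 1 - j)))"
    using below by blast
  also have "\<dots> \<longleftrightarrow> (\<forall>j<n. below j (ws ! j))"
  proof (intro iffI allI impI)
    fix j assume *: "\<forall>j<n. below (n - 1 - j) (ws ! (n - 1 - j))" and "j < n"
    then have "n - 1 - j < n" "n - 1 - (n - 1 - j) = j" by linarith+
    with *[rule_format, of "n - 1 - j"] show "below j (ws ! j)" by simp
  qed auto
  finally show ?thesis
    using True dyck_mirror[of ws] by (simp add: rising_def falling_def)
next
  case False
  then show ?thesis using dyck_mirror[of "mirror ws"] by (auto simp: rising_def falling_def)
qed

lemma rising_iff: 
  assumes "0 < n"
  shows "ws \<in> rising n \<longleftrightarrow> length ws = n \<and> (\<forall>w\<in>set ws. dyck w) \<and> fits n (backwards (cat ws))"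
proof -
  have "cat (compl_words (mirror ws)) = backwards (cat ws)" if "length ws = n"
  proof -
    have "mirror ws \<noteq> []" using that assms by (auto simp: mirror_def)
    from cat_compl_words_eq[OF this] show ?thesis by simp
  qed
  then show ?thesis unfolding rising_iff_mirror falling_iff
    using dyck_mirror[of ws] dyck_mirror[of "mirror ws"] by auto
qed

text \<open>The excursions after one step of the dynamics, for sequences in
  \<open>falling n\<close>; elsewhere a splitting need not exist.\<close>

definition evolve :: "bool list list \<Rightarrow> bool list list" where
  "evolve ws = (THE vs. (\<forall>v\<in>set vs. dyck v) \<and> cat vs = cat (compl_words ws))"

lemma evolveI: "\<forall>v\<in>set vs. dyck v \<Longrightarrow> cat vs = cat (compl_words ws) \<Longrightarrow> evolve ws = vs"
  unfolding evolve_def by (rule the_equality) (auto intro: cat_inject)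

lemma evolve:
  assumes "ws \<in> falling n"
  shows "cat (evolve ws) = cat (compl_words ws)" "length (evolve ws) = n" "\<forall>v\<in>set (evolve ws). dyck v"
proof -
  obtain vs where vs: "length vs = n" "\<forall>v\<in>set vs. dyck v" "cat (compl_words ws) = cat vs"
    using assms fits_obtain unfolding falling_iff by blast
  then have "evolve ws = vs" by (intro evolveI) auto
  with vs show "cat (evolve ws) = cat (compl_words ws)" "length (evolve ws) = n" "\<forall>v\<in>set (evolve ws). dyck v" by auto
qed

text \<open>The image read backwards is \<open>cat (mirror ws)\<close>, which determines
  \<open>ws\<close>. The inverse map is \<open>evolve\<close> conjugated by \<open>mirror\<close>:
  running backwards in time is running forwards in reversed space.\<close>

lemma bij_betw_evolve: assumes n: "0 < n" shows "bij_betw evolve (falling n) (rising n)"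
  unfolding bij_betw_def
proof
  have ne: "ws \<noteq> []" "mirror ws \<noteq> []" if "length ws = n" for ws using that n by (auto simp: mirror_def)
  have bb: "backwards (backwards (cat ws)) = cat ws" if "length ws = n" for ws
    using last_cat[OF ne(1)[OF that]] backwards_backwards by blast
  have fal: "length ws = n" "\<forall>w\<in>set ws. dyck w" if "ws \<in> falling n" for ws
    using that by (auto simp: falling_def)
  have key: "backwards (cat (evolve ws)) = cat (mirror ws)" if "ws \<in> falling n" for ws
    using evolve(1)[OF that] cat_compl_words_eq[OF ne(1)] bb[of "mirror ws"] fal[OF that] by simp
  show "inj_on evolve (falling n)"
  proof (rule inj_onI)
    fix ws vs assume *: "ws \<in> falling n" "vs \<in> falling n" "evolve ws = evolve vs"
    then have "cat (mirror ws) = cat (mirror vs)" using key by metis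
    then have "mirror ws = mirror vs" using cat_inject dyck_mirror fal * by metis
    then show "ws = vs" by (metis mirror_mirror)
  qed
  show "evolve ` falling n = rising n"
  proof (intro equalityI subsetI)
    fix vs assume "vs \<in> evolve ` falling n"
    then obtain ws where ws: "ws \<in> falling n" "vs = evolve ws" by blast
    have "fits n (cat (mirror ws))"
      using fits_cat[OF dyck_mirror[OF fal(2)[OF ws(1)]]] fal(1)[OF ws(1)] by simp
    with key[OF ws(1)] evolve[OF ws(1)] ws show "vs \<in> rising n" by (simp add: rising_iff[OF n])
  next
    fix vs assume vs: "vs \<in> rising n"
    then have v: "length vs = n" "\<forall>w\<in>set vs. dyck w" "fits n (backwards (cat vs))"
      by (auto simp: rising_iff[OF n])
    obtain us where us: "length us = n" "\<forall>w\<in>set us. dyck w" "backwards (cat vs) = cat us"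
      using fits_obtain[OF v(3)] by blast
    have "cat (compl_words (mirror us)) = backwards (cat us)"
      using cat_compl_words_eq[of "mirror us"] ne(2)[OF us(1)] by simp
    also have "\<dots> = cat vs" using bb[OF v(1)] us(3) by simp
    finally have c: "cat (compl_words (mirror us)) = cat vs" .
    have "mirror us \<in> falling n"
      using us dyck_mirror fits_cat[OF v(2)] c v(1) by (simp add: falling_iff)
    moreover have "evolve (mirror us) = vs" using v c by (intro evolveI) auto
    ultimately show "vs \<in> evolve ` falling n" by blast
  qed
qed

lemma spill_cat: "\<forall>w\<in>set ws. dyck w \<Longrightarrow> spill l 0 (cat ws) = (\<Sum>w\<leftarrow>ws. spill l 0 w)"
  by (induction ws) (auto simp: spill_append load_dyck_0)

text \<open>By \<open>spill_complement\<close> each complemented word contributes the energy of the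
  original whatever load it is met with, so the loads carried across the separators need not be
  known.\<close>

lemma spill_cat_comp:
  "\<forall>w\<in>set ws. dyck w \<Longrightarrow> d \<le> l \<Longrightarrow> spill l d (cat (compl_words ws)) = (\<Sum>w\<leftarrow>ws. spill l 0 w)"
proof (induction ws arbitrary: d)
  case (Cons w ws)
  have "load l d (map Not w) - 1 \<le> l" using load_le[OF Cons.prems(2), of "map Not w"] by simp
  with Cons show ?case by (simp add: spill_append spill_complement)
qed simp

text \<open>Both total energies are the energy of one concatenation, cut once into complemented
  words and once into excursions.\<close>

lemma prod_word_weight_evolve:
  assumes "ws \<in> falling n"
  shows "(\<Prod>w\<leftarrow>evolve ws. word_weight \<alpha> w) = (\<Prod>w\<leftarrow>ws. word_weight \<alpha> w)"
proof (rule prod_word_weight_eq)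
  have ws: "\<forall>w\<in>set ws. dyck w" using assms by (simp add: falling_def)
  then show "\<forall>w\<in>set ws. dyck w" .
  show "\<forall>w\<in>set (evolve ws). dyck w" by (rule evolve(3)[OF assms])
  show "(\<Sum>w\<leftarrow>evolve ws. spill l 0 w) = (\<Sum>w\<leftarrow>ws. spill l 0 w)" for l
    using spill_cat[OF evolve(3)[OF assms], of l] spill_cat_comp[OF ws, of 0 l] evolve(1)[OF assms] by simp
qed

section \<open>Measurability\<close>

lemma space_config_space [simp]: "space config_space = UNIV"
  by (auto simp: config_space_def space_PiM)

lemma measurable_discrete_binop:
  fixes f :: "'a \<Rightarrow> 'b::countable" and g :: "'a \<Rightarrow> 'c::countable"
  assumes "f \<in> measurable M (count_space UNIV)" "g \<in> measurable M (count_space UNIV)"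
  shows "(\<lambda>x. h (f x) (g x)) \<in> measurable M (count_space UNIV)"
  by (rule measurable_compose_countable[OF measurable_compose[OF assms(2)] assms(1)]) simp

lemma measurable_discrete_sum:
  fixes f :: "'b \<Rightarrow> 'a \<Rightarrow> int"
  assumes "\<And>i. i \<in> I \<Longrightarrow> f i \<in> measurable M (count_space UNIV)"
  shows "(\<lambda>x. \<Sum>i\<in>I. f i x) \<in> measurable M (count_space UNIV)"
  using assms
proof (induction I rule: infinite_finite_induct)
  case (insert i I)
  have "(\<lambda>x. f i x + (\<Sum>i\<in>I. f i x)) \<in> measurable M (count_space UNIV)"
    by (rule measurable_discrete_binop) (use insert in auto)
  with insert show ?case by simp
qed auto

lemma measurable_config_coordinate [measurable]: "(\<lambda>\<eta>. \<eta> z) \<in> measurable config_space (count_space UNIV)"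
  unfolding config_space_def by (rule measurable_component_singleton) simp

lemma measurable_into_config_space:
  assumes "\<And>z. (\<lambda>x. f x z) \<in> measurable M (count_space UNIV)"
  shows "f \<in> measurable M config_space"
  unfolding config_space_def
  by (rule measurable_PiM_single'[where f = "\<lambda>z x. f x z"]) (use assms in \<open>auto\<close>)

lemma measurable_walk [measurable]: "(\<lambda>\<eta>. walk \<eta> z) \<in> measurable config_space (count_space UNIV)"
proof -
  have *: "(\<lambda>\<eta>. 2 * of_bool (\<eta> x) - 1 :: int) \<in> measurable config_space (count_space UNIV)" for x
    by (rule measurable_compose[OF measurable_config_coordinate]) simp
  show ?thesis
  proof (cases "0 \<le> z")
    case True
    then show ?thesis unfolding walk_def by (simp add: measurable_discrete_sum[OF *])
  next
    case False
    then show ?thesis unfolding walk_def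
      by (simp del: sum_negf) (rule measurable_compose[OF measurable_discrete_sum[OF *]], simp)
  qed
qed

lemma measurable_records [measurable]: "Measurable.pred config_space (\<lambda>\<eta>. z \<in> records \<eta>)"
  unfolding records_def mem_Collect_eq
  by measurable

text \<open>Serves measurability: the event is expressed by countably many values of the walk. The
  second alternative is the value of \<open>LEAST\<close> without a minimum, one fixed integer for
  all configurations.\<close>

lemma record_pos_eq_iff:
  "record_pos \<eta> i = c \<longleftrightarrow> (walk \<eta> c = - i \<and> (\<forall>z. z < c \<longrightarrow> walk \<eta> z \<noteq> - i)) \<or>
    (\<not> (\<exists>c. walk \<eta> c = - i \<and> (\<forall>z. z < c \<longrightarrow> walk \<eta> z \<noteq> - i)) \<and> c = (THE x::int. False))"
    (is "_ \<longleftrightarrow> ?M c \<or> (\<not> (\<exists>c. ?M c) \<and> _)")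
proof -
  have iff: "walk \<eta> x = - i \<and> (\<forall>y. walk \<eta> y = - i \<longrightarrow> x \<le> y) \<longleftrightarrow> ?M x" for x
    unfolding not_less[symmetric] by blast
  have r: "record_pos \<eta> i = (THE x. ?M x)"
    unfolding record_pos_def Least_def iff ..
  show ?thesis
  proof (cases "\<exists>c. ?M c")
    case True
    then obtain d where d: "?M d" by blast
    have uniq: "x = d" if "?M x" for x
    proof (rule ccontr)
      assume "x \<noteq> d"
      then consider "x < d" | "d < x" by linarith
      then show False using that d by cases blast+
    qed
    then have "record_pos \<eta> i = d" unfolding r using d by (intro the_equality)
    then have "record_pos \<eta> i = c \<longleftrightarrow> ?M c" using d uniq by blast
    with True show ?thesis by blast
  next
    case False
    then have "\<And>x. ?M x \<longleftrightarrow> False" by blast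
    then have "?M = (\<lambda>x. False)" by (rule ext)
    then have "(THE x. ?M x) = (THE x::int. False)" by (rule arg_cong[where f = The])
    then have "record_pos \<eta> i = (THE x::int. False)" unfolding r .
    then have "record_pos \<eta> i = c \<longleftrightarrow> c = (THE x::int. False)" by (simp only: eq_commute)
    with False show ?thesis by blast
  qed
qed

lemma measurable_record_pos [measurable]:
  "(\<lambda>\<eta>. record_pos \<eta> i) \<in> measurable config_space (count_space UNIV)"
proof (rule measurable_count_space_eq2_countable[THEN iffD2], intro conjI ballI)
  fix c
  have "Measurable.pred config_space (\<lambda>\<eta>. record_pos \<eta> i = c)"
    unfolding record_pos_eq_iff by measurable
  then show "(\<lambda>\<eta>. record_pos \<eta> i) -` {c} \<inter> space config_space \<in> sets config_space"
    by (simp add: pred_def vimage_def)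
qed simp

lemma measurable_shift [measurable]: "shift y \<in> measurable config_space config_space"
  by (rule measurable_into_config_space) (simp add: shift_def)

lemma measurable_shift_by [measurable]:
  assumes "f \<in> measurable config_space (count_space UNIV)"
  shows "(\<lambda>\<eta>. shift (f \<eta>) \<eta>) \<in> measurable config_space config_space"
  by (rule measurable_compose_countable[OF _ assms]) measurable

lemma measurable_BBS [measurable]: "BBS \<in> measurable config_space config_space"
  by (rule measurable_into_config_space) (simp add: BBS_def)

lemma sets_density_class: "density_class l \<in> sets config_space"
proof -
  have *: "(\<lambda>\<eta>. (\<Sum>z\<in>A. of_bool (\<eta> z)) / real y) \<in> borel_measurable config_space" for A y
    by (intro borel_measurable_divide borel_measurable_sum borel_measurable_const
        measurable_compose[OF measurable_config_coordinate]) simp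
  have conv: "Measurable.pred config_space (\<lambda>\<eta>. (\<lambda>y. f y \<eta>) \<longlonglongrightarrow> l)"
    if [measurable]: "\<And>y. f y \<in> borel_measurable config_space" for f :: "nat \<Rightarrow> config \<Rightarrow> real"
  proof -
    \<comment> \<open>Countably many tolerances reduce convergence to countable set
      operations.\<close>
    have "(\<lambda>y. f y \<eta>) \<longlonglongrightarrow> l \<longleftrightarrow> (\<forall>n::nat. \<exists>N. \<forall>y\<ge>N. \<bar>f y \<eta> - l\<bar> < 1 / Suc n)" for \<eta>
    proof
      assume "(\<lambda>y. f y \<eta>) \<longlonglongrightarrow> l"
      show "\<forall>n::nat. \<exists>N. \<forall>y\<ge>N. \<bar>f y \<eta> - l\<bar> < 1 / Suc n"
      proof
        fix n :: nat
        show "\<exists>N. \<forall>y\<ge>N. \<bar>f y \<eta> - l\<bar> < 1 / Suc n"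
          using LIMSEQ_D[OF \<open>(\<lambda>y. f y \<eta>) \<longlonglongrightarrow> l\<close>, of "1 / Suc n"] by (simp add: real_norm_def)
      qed
    next
      assume *: "\<forall>n::nat. \<exists>N. \<forall>y\<ge>N. \<bar>f y \<eta> - l\<bar> < 1 / Suc n"
      show "(\<lambda>y. f y \<eta>) \<longlonglongrightarrow> l"
      proof (rule LIMSEQ_I)
        fix r :: real assume "0 < r"
        then obtain n where n: "1 / real (Suc n) < r" using nat_approx_posE by auto
        obtain N where N: "\<And>y. N \<le> y \<Longrightarrow> \<bar>f y \<eta> - l\<bar> < 1 / Suc n" using * by blast
        have "norm (f m \<eta> - l) < r" if "N \<le> m" for m
          using N[OF that] n by simp
        then show "\<exists>no. \<forall>n\<ge>no. norm (f n \<eta> - l) < r" by blast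
      qed
    qed
    then show ?thesis by simp
  qed
  have "Measurable.pred config_space (\<lambda>\<eta>. \<eta> \<in> density_class l)"
  proof -
    have [measurable]: "Measurable.pred config_space (\<lambda>\<eta>. (\<lambda>y. (\<Sum>z\<in>{- int y..0}. of_bool (\<eta> z)) / real y) \<longlonglongrightarrow> l)"
      "Measurable.pred config_space (\<lambda>\<eta>. (\<lambda>y. (\<Sum>z\<in>{0..int y}. of_bool (\<eta> z)) / real y) \<longlonglongrightarrow> l)"
      by (rule conv, rule *)+
    show ?thesis unfolding density_class_def mem_Collect_eq by measurable
  qed
  then show ?thesis by (simp add: pred_def)
qed

lemma sets_density_class_hat: "density_class_hat l \<in> sets config_space"
proof -
  have "density_class_hat l = density_class l \<inter> {\<eta> \<in> space config_space. 0 \<in> records \<eta>}"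
    by (auto simp: density_class_hat_def)
  with sets_density_class show ?thesis by simp
qed

section \<open>Shifts\<close>

lemma shift_shift: "shift x (shift y \<eta>) = shift (x + y) \<eta>"
  by (simp add: shift_def fun_eq_iff add.assoc)

lemma shift_0 [simp]: "shift 0 \<eta> = \<eta>"
  by (simp add: shift_def fun_eq_iff)

lemma walk_shift: "walk (shift y \<eta>) z = walk \<eta> (z + y) - walk \<eta> y"
proof (induction z rule: int_induct[where k = 0])
  case base
  show ?case by simp
next
  case (step1 i)
  then show ?case using walk_step[of "shift y \<eta>" "i + 1"] walk_step[of \<eta> "i + 1 + y"]
      shift_def[of y \<eta> "i + 1"]
    by (simp add: algebra_simps)
next
  case (step2 i)
  then show ?case using walk_step[of "shift y \<eta>" i] walk_step[of \<eta> "i + y"] shift_def[of y \<eta> i]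
    by (simp add: algebra_simps)
qed

lemma records_shift: "z \<in> records (shift y \<eta>) \<longleftrightarrow> z + y \<in> records \<eta>"
proof -
  have "(\<forall>z'<z. walk \<eta> (z + y) < walk \<eta> (z' + y)) \<longleftrightarrow> (\<forall>z'<z + y. walk \<eta> (z + y) < walk \<eta> z')"
    by (metis add_less_cancel_right diff_add_cancel)
  then show ?thesis by (simp add: records_def walk_shift)
qed

lemma BBS_shift: "BBS (shift y \<eta>) = shift y (BBS \<eta>)"
  by (simp add: fun_eq_iff BBS_def records_shift) (simp add: shift_def BBS_def)

lemma block_start_shift:
  "block_start (\<lambda>j. \<epsilon> (j + i)) k = block_start \<epsilon> (k + i) - block_start \<epsilon> i"
proof (induction k rule: int_induct[where k = 0])
  case base
  show ?case by (simp add: block_start_0)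
next
  case (step1 k)
  then show ?case using block_start_step[of "\<lambda>j. \<epsilon> (j + i)" k] block_start_step[of \<epsilon> "k + i"]
    by (simp add: algebra_simps)
next
  case (step2 k)
  then show ?case using block_start_step[of "\<lambda>j. \<epsilon> (j + i)" "k - 1"] block_start_step[of \<epsilon> "k - 1 + i"]
    by (simp add: algebra_simps)
qed

lemma config_of_shift: "config_of (\<lambda>j. \<epsilon> (j + i)) = shift (block_start \<epsilon> i) (config_of \<epsilon>)"
proof
  fix z
  have "config_of (\<lambda>j. \<epsilon> (j + i)) z \<longleftrightarrow> (\<exists>k. block_start \<epsilon> (k + i) \<le> z + block_start \<epsilon> i \<and>
     z + block_start \<epsilon> i < block_start \<epsilon> (k + i + 1) \<and>
     ball_config (\<epsilon> (k + i)) (z + block_start \<epsilon> i - block_start \<epsilon> (k + i)))"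
    unfolding config_of_def block_start_shift by (simp add: algebra_simps)
  also have "\<dots> \<longleftrightarrow> shift (block_start \<epsilon> i) (config_of \<epsilon>) z"
    unfolding config_of_def shift_def by (metis diff_add_cancel)
  finally show "config_of (\<lambda>j. \<epsilon> (j + i)) z = shift (block_start \<epsilon> i) (config_of \<epsilon>) z" .
qed

section \<open>The Palm measure and its inverse\<close>

abbreviation exc_seq :: "(nat \<Rightarrow> real) \<Rightarrow> (int \<Rightarrow> int list) measure" where
  "exc_seq \<alpha> \<equiv> PiM UNIV (\<lambda>_. exc_law \<alpha>)"

lemma space_exc_seq: "space (exc_seq \<alpha>) = {\<epsilon>. \<forall>i. \<epsilon> i \<in> excursions}"
  by (auto simp: space_PiM)

lemma measurable_exc_coordinate [measurable]:
  "(\<lambda>\<epsilon>. f (\<epsilon> i)) \<in> measurable (exc_seq \<alpha>) (count_space UNIV)"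
proof -
  have f: "f \<in> measurable (exc_law \<alpha>) (count_space UNIV)"
    by (simp add: measurable_exc_law)
  show ?thesis by (rule measurable_compose[OF _ f]) simp
qed

lemma measurable_block_start [measurable]:
  "(\<lambda>\<epsilon>. block_start \<epsilon> i) \<in> measurable (exc_seq \<alpha>) (count_space UNIV)"
proof -
  have *: "(\<lambda>\<epsilon>. \<Sum>j\<in>A. 2 * int (half_length (\<epsilon> j)) + 1) \<in> measurable (exc_seq \<alpha>) (count_space UNIV)" for A
    by (rule measurable_discrete_sum) (rule measurable_exc_coordinate)
  show ?thesis
  proof (cases "0 \<le> i")
    case True
    then show ?thesis unfolding block_start_def using * by simp
  next
    case False
    have "(\<lambda>\<epsilon>. - (\<Sum>j\<in>{i..<0}. 2 * int (half_length (\<epsilon> j)) + 1)) \<in> measurable (exc_seq \<alpha>) (count_space UNIV)"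
      by (rule measurable_compose[OF *]) simp
    then show ?thesis by (simp only: block_start_def False if_False)
  qed
qed

lemma measurable_config_of [measurable]: "config_of \<in> measurable (exc_seq \<alpha>) config_space"
proof (rule measurable_into_config_space)
  fix z
  have [measurable]: "(\<lambda>\<epsilon>. block_start \<epsilon> i \<le> z \<and> z < block_start \<epsilon> (i + 1) \<and>
      ball_config (\<epsilon> i) (z - block_start \<epsilon> i)) \<in> measurable (exc_seq \<alpha>) (count_space UNIV)" for i
  proof -
    have [measurable]: "(\<lambda>\<epsilon>. ball_config (\<epsilon> i) (z - block_start \<epsilon> i)) \<in> measurable (exc_seq \<alpha>) (count_space UNIV)"
      by (rule measurable_discrete_binop[where f = "\<lambda>\<epsilon>. \<epsilon> i" and h = "\<lambda>e b. ball_config e (z - b)"])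
         (use measurable_exc_coordinate[of id] in simp_all)
    show ?thesis by measurable
  qed
  show "(\<lambda>\<epsilon>. config_of \<epsilon> z) \<in> measurable (exc_seq \<alpha>) (count_space UNIV)"
    unfolding config_of_def by measurable
qed

lemma space_mu_hat [simp]: "space (mu_hat \<alpha>) = UNIV"
  and sets_mu_hat [simp, measurable_cong]: "sets (mu_hat \<alpha>) = sets config_space"
  by (simp_all add: mu_hat_def)

lemma prob_space_exc_seq: "\<alpha> \<in> A_set \<Longrightarrow> prob_space (exc_seq \<alpha>)"
  by (rule prob_space_PiM) (rule prob_space_exc_law)

lemma prob_space_mu_hat: "\<alpha> \<in> A_set \<Longrightarrow> prob_space (mu_hat \<alpha>)"
  unfolding mu_hat_def by (rule prob_space.prob_space_distr[OF prob_space_exc_seq]) measurable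

lemma AE_mu_hat:
  assumes "{\<eta>. P \<eta>} \<in> sets config_space" "AE \<epsilon> in exc_seq \<alpha>. P (config_of \<epsilon>)"
  shows "AE \<eta> in mu_hat \<alpha>. P \<eta>"
  unfolding mu_hat_def by (subst AE_distr_iff) (use assms in \<open>simp_all add: measurable_config_of\<close>)

lemma nn_integral_mu_hat:
  "f \<in> borel_measurable config_space \<Longrightarrow> (\<integral>\<^sup>+ \<eta>. f \<eta> \<partial>mu_hat \<alpha>) = (\<integral>\<^sup>+ \<epsilon>. f (config_of \<epsilon>) \<partial>exc_seq \<alpha>)"
  unfolding mu_hat_def by (rule nn_integral_distr[OF measurable_config_of]) simp

lemma block_start_1: "block_start \<epsilon> 1 = 2 * int (half_length (\<epsilon> 0)) + 1"
  using block_start_step[of \<epsilon> 0] by (simp add: block_start_0)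

lemma AE_record_pos_nonneg: "AE \<eta> in mu_hat \<alpha>. 0 \<le> record_pos \<eta> 1"
proof (rule AE_mu_hat)
  have "Measurable.pred config_space (\<lambda>\<eta>. 0 \<le> record_pos \<eta> 1)" by measurable
  then show "{\<eta>. 0 \<le> record_pos \<eta> 1} \<in> sets config_space" by (simp add: pred_def)
  show "AE \<epsilon> in exc_seq \<alpha>. 0 \<le> record_pos (config_of \<epsilon>) 1"
    by (rule AE_I2) (simp add: space_exc_seq record_pos_config_of block_start_1)
qed

lemma distr_exc_seq_shift:
  assumes "\<alpha> \<in> A_set"
  shows "distr (exc_seq \<alpha>) (exc_seq \<alpha>) (\<lambda>\<epsilon> j. \<epsilon> (j + i)) = exc_seq \<alpha>"
  using distr_PiM_reindex[of UNIV "\<lambda>_::int. exc_law \<alpha>" "\<lambda>j. j + i" UNIV] prob_space_exc_law[OF assms]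
  by (simp add: restrict_def)

lemma measurable_exc_seq_shift [measurable]:
  "(\<lambda>\<epsilon> j. \<epsilon> (j + i)) \<in> measurable (exc_seq \<alpha>) (exc_seq \<alpha>)"
  by (rule measurable_PiM_single'[where f = "\<lambda>j \<epsilon>. \<epsilon> (j + i)"]) (auto simp: space_PiM)

text \<open>Moving the origin to record \<open>i\<close> reindexes the excursions by
  \<open>i\<close>, which does not change a product of equal laws.\<close>

lemma distr_mu_hat_record:
  assumes "\<alpha> \<in> A_set"
  shows "distr (mu_hat \<alpha>) config_space (\<lambda>\<eta>. shift (record_pos \<eta> i) \<eta>) = mu_hat \<alpha>"
proof -
  have "distr (mu_hat \<alpha>) config_space (\<lambda>\<eta>. shift (record_pos \<eta> i) \<eta>)
    = distr (exc_seq \<alpha>) config_space ((\<lambda>\<eta>. shift (record_pos \<eta> i) \<eta>) \<circ> config_of)"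
    unfolding mu_hat_def by (rule distr_distr) measurable
  also have "\<dots> = distr (exc_seq \<alpha>) config_space (config_of \<circ> (\<lambda>\<epsilon> j. \<epsilon> (j + i)))"
    by (rule distr_cong) (simp_all add: space_exc_seq record_pos_config_of config_of_shift)
  also have "\<dots> = distr (distr (exc_seq \<alpha>) (exc_seq \<alpha>) (\<lambda>\<epsilon> j. \<epsilon> (j + i))) config_space config_of"
    by (rule distr_distr[symmetric]) measurable
  finally show ?thesis unfolding distr_exc_seq_shift[OF assms] mu_hat_def .
qed

lemma record_translation_invariant_mu_hat:
  assumes "\<alpha> \<in> A_set"
  shows "record_translation_invariant (mu_hat \<alpha>)"
  unfolding record_translation_invariant_def
proof (intro allI impI)
  fix i and f :: "config \<Rightarrow> real"
  assume f: "f \<in> borel_measurable config_space \<and> bounded (range f)"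
  have "(\<integral>\<eta>. f \<eta> \<partial>mu_hat \<alpha>) = (\<integral>\<eta>. f \<eta> \<partial>distr (mu_hat \<alpha>) config_space (\<lambda>\<eta>. shift (record_pos \<eta> i) \<eta>))"
    unfolding distr_mu_hat_record[OF assms] ..
  also have "\<dots> = (\<integral>\<eta>. f (shift (record_pos \<eta> i) \<eta>) \<partial>mu_hat \<alpha>)"
    by (rule integral_distr) (use f in \<open>measurable, blast\<close>)
  finally show "(\<integral>\<eta>. f (shift (record_pos \<eta> i) \<eta>) \<partial>mu_hat \<alpha>) = (\<integral>\<eta>. f \<eta> \<partial>mu_hat \<alpha>)" ..
qed

lemma nn_integral_exc_seq_component:
  assumes "\<alpha> \<in> A_set"
  shows "(\<integral>\<^sup>+ \<epsilon>. f (\<epsilon> i) \<partial>exc_seq \<alpha>) = (\<integral>\<^sup>+ e. f e \<partial>exc_law \<alpha>)"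
proof -
  interpret prob_space "exc_law \<alpha>" by (rule prob_space_exc_law[OF assms])
  interpret product_prob_space "\<lambda>_::int. exc_law \<alpha>" UNIV ..
  have f: "f \<in> borel_measurable (exc_law \<alpha>)"
    by (simp add: measurable_exc_law)
  have "(\<integral>\<^sup>+ e. f e \<partial>exc_law \<alpha>) = (\<integral>\<^sup>+ e. f e \<partial>distr (exc_seq \<alpha>) (exc_law \<alpha>) (\<lambda>\<epsilon>. \<epsilon> i))"
    by (subst PiM_component) simp_all
  also have "\<dots> = (\<integral>\<^sup>+ \<epsilon>. f (\<epsilon> i) \<partial>exc_seq \<alpha>)"
    by (rule nn_integral_distr) (use f in simp_all)
  finally show ?thesis ..
qed

lemma mean_record_distance_eq:
  assumes "\<alpha> \<in> A_plus"
  shows "mean_record_distance (mu_hat \<alpha>) = ennreal (mean_spacing \<alpha>)" "1 \<le> mean_spacing \<alpha>"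
proof -
  have A: "\<alpha> \<in> A_set" and fin: "(\<integral>\<^sup>+ e. of_nat (half_length e) \<partial>exc_law \<alpha>) < \<infinity>"
    using assms by (simp_all add: A_plus_iff)
  interpret prob_space "exc_law \<alpha>" by (rule prob_space_exc_law[OF A])
  have m: "f \<in> borel_measurable (exc_law \<alpha>)" for f :: "int list \<Rightarrow> ennreal"
    by (simp add: measurable_exc_law)
  have "mean_record_distance (mu_hat \<alpha>) = (\<integral>\<^sup>+ \<epsilon>. ennreal (of_int (record_pos (config_of \<epsilon>) 1)) \<partial>exc_seq \<alpha>)"
    unfolding mean_record_distance_def by (rule nn_integral_mu_hat) measurable
  also have "\<dots> = (\<integral>\<^sup>+ \<epsilon>. 1 + 2 * of_nat (half_length (\<epsilon> 0)) \<partial>exc_seq \<alpha>)"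
  proof (rule nn_integral_cong)
    fix \<epsilon> assume "\<epsilon> \<in> space (exc_seq \<alpha>)"
    then have "record_pos (config_of \<epsilon>) 1 = 1 + 2 * int (half_length (\<epsilon> 0))"
      by (simp add: space_exc_seq record_pos_config_of block_start_1)
    then have "ennreal (of_int (record_pos (config_of \<epsilon>) 1)) = ennreal (real (1 + 2 * half_length (\<epsilon> 0)))" by simp
    also have "\<dots> = 1 + 2 * of_nat (half_length (\<epsilon> 0))"
      by (simp only: ennreal_of_nat_eq_real_of_nat[symmetric]) simp
    finally show "ennreal (of_int (record_pos (config_of \<epsilon>) 1)) = 1 + 2 * of_nat (half_length (\<epsilon> 0))" .
  qed
  also have "\<dots> = (\<integral>\<^sup>+ e. 1 + 2 * of_nat (half_length e) \<partial>exc_law \<alpha>)"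
    by (rule nn_integral_exc_seq_component[OF A])
  also have "\<dots> = 1 + 2 * (\<integral>\<^sup>+ e. of_nat (half_length e) \<partial>exc_law \<alpha>)"
    by (subst nn_integral_add) (simp_all add: m nn_integral_cmult emeasure_space_1[simplified])
  also have "\<dots> = ennreal (mean_spacing \<alpha>)"
    using fin unfolding mean_spacing_eq by (simp add: ennreal_plus ennreal_mult)
  finally show "mean_record_distance (mu_hat \<alpha>) = ennreal (mean_spacing \<alpha>)" .
  show "1 \<le> mean_spacing \<alpha>" unfolding mean_spacing_eq by simp
qed

lemma measurable_record_sum [measurable]:
  assumes "\<And>z. f z \<in> borel_measurable config_space"
  shows "(\<lambda>\<eta>. \<Sum>z\<in>{1..record_pos \<eta> i}. f z \<eta> :: ennreal) \<in> borel_measurable config_space"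
  by (rule measurable_compose_countable[where f = "\<lambda>r \<eta>. \<Sum>z\<in>{1..r}. f z \<eta>"])
     (use assms in \<open>simp_all add: borel_measurable_sum measurable_record_pos\<close>)

section \<open>The inverse Palm measure and its translation invariance\<close>

lemma space_Palm_inv [simp]: "space (Palm_inv M) = UNIV"
  and sets_Palm_inv [simp, measurable_cong]: "sets (Palm_inv M) = sets config_space"
  unfolding Palm_inv_def
  using sets.sets_measure_of_eq[of config_space] sets.space_measure_of_eq[of config_space] by simp_all

lemma measurable_indicator_shift:
  "B \<in> sets config_space \<Longrightarrow> (\<lambda>\<eta>. indicator B (shift z \<eta>) :: ennreal) \<in> borel_measurable config_space"
  by (rule measurable_compose[OF measurable_shift borel_measurable_indicator])

text \<open>The prescribed values become those of a measure only through countable additivity,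
  obtained by exchanging series and integral.\<close>

lemma emeasure_Palm_inv:
  assumes M: "sets M = sets config_space" and B: "B \<in> sets config_space"
  shows "emeasure (Palm_inv M) B
    = (\<integral>\<^sup>+ \<eta>. (\<Sum>z\<in>{1..record_pos \<eta> 1}. indicator B (shift z \<eta>)) \<partial>M) / mean_record_distance M"
  unfolding Palm_inv_def
proof (rule emeasure_measure_of_sigma)
  show "sigma_algebra (space config_space) (sets config_space)" by (rule sets.sigma_algebra_axioms)
  show "B \<in> sets config_space" by fact
  let ?\<mu> = "\<lambda>B. (\<integral>\<^sup>+ \<eta>. (\<Sum>z\<in>{1..record_pos \<eta> 1}. indicator B (shift z \<eta>)) \<partial>M) / mean_record_distance M"
  show "positive (sets config_space) ?\<mu>" by (simp add: positive_def)
  show "countably_additive (sets config_space) ?\<mu>"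
  proof (rule countably_additiveI)
    fix A :: "nat \<Rightarrow> config set"
    assume A: "range A \<subseteq> sets config_space" "disjoint_family A" "(\<Union>i. A i) \<in> sets config_space"
    have m: "(\<lambda>\<eta>. \<Sum>z\<in>{1..record_pos \<eta> 1}. indicator (A i) (shift z \<eta>) :: ennreal) \<in> borel_measurable M" for i
      unfolding measurable_cong_sets[OF M refl]
      by (rule measurable_record_sum) (rule measurable_indicator_shift, use A in auto)
    have "(\<Sum>i. ?\<mu> (A i)) = (\<Sum>i. \<integral>\<^sup>+ \<eta>. (\<Sum>z\<in>{1..record_pos \<eta> 1}. indicator (A i) (shift z \<eta>)) \<partial>M) / mean_record_distance M"
      by (simp add: divide_ennreal_def ennreal_suminf_multc)
    also have "(\<Sum>i. \<integral>\<^sup>+ \<eta>. (\<Sum>z\<in>{1..record_pos \<eta> 1}. indicator (A i) (shift z \<eta>)) \<partial>M)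
      = (\<integral>\<^sup>+ \<eta>. (\<Sum>i. \<Sum>z\<in>{1..record_pos \<eta> 1}. indicator (A i) (shift z \<eta>)) \<partial>M)"
      by (rule nn_integral_suminf[symmetric]) (rule m)
    also have "\<dots> = (\<integral>\<^sup>+ \<eta>. (\<Sum>z\<in>{1..record_pos \<eta> 1}. indicator (\<Union>i. A i) (shift z \<eta>)) \<partial>M)"
      by (intro nn_integral_cong) (simp add: suminf_sum suminf_indicator[OF A(2)])
    finally show "(\<Sum>i. ?\<mu> (A i)) = ?\<mu> (\<Union>i. A i)" .
  qed
qed

lemma AE_Palm_inv:
  assumes M: "sets M = sets config_space" and S: "S \<in> sets config_space"
    and ae: "AE \<eta> in M. \<forall>z. shift z \<eta> \<in> S"
  shows "AE \<eta> in Palm_inv M. \<eta> \<in> S"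
proof (rule AE_I[where N = "UNIV - S"])
  have S': "UNIV - S \<in> sets config_space" using sets.compl_sets[OF S] by simp
  then show "UNIV - S \<in> sets (Palm_inv M)" by simp
  have "(\<integral>\<^sup>+ \<eta>. (\<Sum>z\<in>{1..record_pos \<eta> 1}. indicator (UNIV - S) (shift z \<eta>)) \<partial>M) = (\<integral>\<^sup>+ \<eta>. 0 \<partial>M)"
    by (rule nn_integral_cong_AE) (use ae in \<open>eventually_elim, auto\<close>)
  then show "emeasure (Palm_inv M) (UNIV - S) = 0"
    unfolding emeasure_Palm_inv[OF M S'] by simp
qed auto

lemma prob_space_Palm_inv:
  assumes "\<alpha> \<in> A_plus"
  shows "prob_space (Palm_inv (mu_hat \<alpha>))"
proof
  have "(\<integral>\<^sup>+ \<eta>. (\<Sum>z\<in>{1..record_pos \<eta> 1}. indicator UNIV (shift z \<eta>)) \<partial>mu_hat \<alpha>) = mean_record_distance (mu_hat \<alpha>)"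
    unfolding mean_record_distance_def
    by (rule nn_integral_cong_AE, rule AE_mp[OF AE_record_pos_nonneg], rule AE_I2)
       (simp add: ennreal_of_nat_eq_real_of_nat)
  moreover have "UNIV \<in> sets config_space" using sets.top[of config_space] by simp
  ultimately have "emeasure (Palm_inv (mu_hat \<alpha>)) UNIV = mean_record_distance (mu_hat \<alpha>) / mean_record_distance (mu_hat \<alpha>)"
    by (subst emeasure_Palm_inv) simp_all
  also have "\<dots> = 1"
    unfolding mean_record_distance_eq(1)[OF assms] using mean_record_distance_eq(2)[OF assms]
    by (intro ennreal_divide_self) auto
  finally show "emeasure (Palm_inv (mu_hat \<alpha>)) (space (Palm_inv (mu_hat \<alpha>))) = 1" by simp
qed

text \<open>The shift replaces box 1 by box \<open>record_pos \<eta> 1 + 1\<close> in the sum over a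
  spacing. Seen from record 1 the latter is box 1 again, so by record invariance both terms have the
  same mean.\<close>

lemma distr_Palm_inv_shift_1:
  assumes "\<alpha> \<in> A_plus"
  shows "distr (Palm_inv (mu_hat \<alpha>)) config_space (shift 1) = Palm_inv (mu_hat \<alpha>)"
proof (rule measure_eqI)
  have A: "\<alpha> \<in> A_set" using assms by (simp add: A_plus_iff)
  fix B assume "B \<in> sets (distr (Palm_inv (mu_hat \<alpha>)) config_space (shift 1))"
  then have B[measurable]: "B \<in> sets config_space" by simp
  have B': "shift 1 -` B \<in> sets config_space"
    using measurable_sets[OF measurable_shift B, of 1] by simp
  let ?f = "\<lambda>z \<eta>. indicator B (shift z \<eta>) :: ennreal"
  have mf: "?f z \<in> borel_measurable (mu_hat \<alpha>)" for z by measurable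
  have ms: "(\<lambda>\<eta>. \<Sum>z\<in>{1..record_pos \<eta> 1}. ?f (z + d) \<eta>) \<in> borel_measurable (mu_hat \<alpha>)" for d
    unfolding measurable_cong_sets[OF sets_mu_hat refl] by (rule measurable_record_sum) measurable
  have ml: "(\<lambda>\<eta>. ?f (record_pos \<eta> 1 + 1) \<eta>) \<in> borel_measurable (mu_hat \<alpha>)"
    by measurable
  have pointwise: "(\<Sum>z\<in>{1..r}. ?f (z + 1) \<eta>) + ?f 1 \<eta> = (\<Sum>z\<in>{1..r}. ?f z \<eta>) + ?f (r + 1) \<eta>" if "0 \<le> r" for r \<eta>
    using that
  proof (induction r rule: int_ge_induct)
    case (step r)
    have "{1..r + 1} = insert (r + 1) {1..r}" using step(1) by auto
    with step show ?case by (simp add: add_ac)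
  qed simp
  have "(\<integral>\<^sup>+ \<eta>. (\<Sum>z\<in>{1..record_pos \<eta> 1}. ?f (z + 1) \<eta>) \<partial>mu_hat \<alpha>) + (\<integral>\<^sup>+ \<eta>. ?f 1 \<eta> \<partial>mu_hat \<alpha>)
    = (\<integral>\<^sup>+ \<eta>. (\<Sum>z\<in>{1..record_pos \<eta> 1}. ?f (z + 1) \<eta>) + ?f 1 \<eta> \<partial>mu_hat \<alpha>)"
    by (rule nn_integral_add[symmetric]) (rule ms, rule mf)
  also have "\<dots> = (\<integral>\<^sup>+ \<eta>. (\<Sum>z\<in>{1..record_pos \<eta> 1}. ?f z \<eta>) + ?f (record_pos \<eta> 1 + 1) \<eta> \<partial>mu_hat \<alpha>)"
    by (rule nn_integral_cong_AE, rule AE_mp[OF AE_record_pos_nonneg], rule AE_I2) (simp add: pointwise)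
  also have "\<dots> = (\<integral>\<^sup>+ \<eta>. (\<Sum>z\<in>{1..record_pos \<eta> 1}. ?f z \<eta>) \<partial>mu_hat \<alpha>)
      + (\<integral>\<^sup>+ \<eta>. ?f (record_pos \<eta> 1 + 1) \<eta> \<partial>mu_hat \<alpha>)"
    by (rule nn_integral_add) (use ms[of 0] ml in simp_all)
  also have "(\<integral>\<^sup>+ \<eta>. ?f (record_pos \<eta> 1 + 1) \<eta> \<partial>mu_hat \<alpha>) = (\<integral>\<^sup>+ \<eta>. ?f 1 (shift (record_pos \<eta> 1) \<eta>) \<partial>mu_hat \<alpha>)"
    by (simp add: shift_shift add.commute)
  also have "\<dots> = (\<integral>\<^sup>+ \<eta>. ?f 1 \<eta> \<partial>distr (mu_hat \<alpha>) config_space (\<lambda>\<eta>. shift (record_pos \<eta> 1) \<eta>))"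
    by (rule nn_integral_distr[symmetric]) measurable
  also have "\<dots> = (\<integral>\<^sup>+ \<eta>. ?f 1 \<eta> \<partial>mu_hat \<alpha>)" unfolding distr_mu_hat_record[OF A] ..
  finally have eq: "(\<integral>\<^sup>+ \<eta>. (\<Sum>z\<in>{1..record_pos \<eta> 1}. ?f (z + 1) \<eta>) \<partial>mu_hat \<alpha>) + (\<integral>\<^sup>+ \<eta>. ?f 1 \<eta> \<partial>mu_hat \<alpha>)
      = (\<integral>\<^sup>+ \<eta>. (\<Sum>z\<in>{1..record_pos \<eta> 1}. ?f z \<eta>) \<partial>mu_hat \<alpha>) + (\<integral>\<^sup>+ \<eta>. ?f 1 \<eta> \<partial>mu_hat \<alpha>)" .
  have "(\<integral>\<^sup>+ \<eta>. ?f 1 \<eta> \<partial>mu_hat \<alpha>) \<le> (\<integral>\<^sup>+ \<eta>. 1 \<partial>mu_hat \<alpha>)"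
    by (rule nn_integral_mono) (auto split: split_indicator)
  also have "\<dots> = 1" using prob_space.emeasure_space_1[OF prob_space_mu_hat[OF A]] by simp
  \<comment> \<open>Cancelling the common term in \<open>ennreal\<close> requires its
    finiteness.\<close>
  finally have "(\<integral>\<^sup>+ \<eta>. ?f 1 \<eta> \<partial>mu_hat \<alpha>) \<noteq> \<infinity>" by (auto simp: top_unique)
  with eq have "(\<integral>\<^sup>+ \<eta>. (\<Sum>z\<in>{1..record_pos \<eta> 1}. ?f (z + 1) \<eta>) \<partial>mu_hat \<alpha>)
    = (\<integral>\<^sup>+ \<eta>. (\<Sum>z\<in>{1..record_pos \<eta> 1}. ?f z \<eta>) \<partial>mu_hat \<alpha>)"
    by (simp only: ennreal_add_left_cancel add.commute[of _ "\<integral>\<^sup>+ \<eta>. ?f 1 \<eta> \<partial>mu_hat \<alpha>"] simp_thms)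
  then have *: "(\<integral>\<^sup>+ \<eta>. (\<Sum>z\<in>{1..record_pos \<eta> 1}. indicator (shift 1 -` B) (shift z \<eta>)) \<partial>mu_hat \<alpha>)
    = (\<integral>\<^sup>+ \<eta>. (\<Sum>z\<in>{1..record_pos \<eta> 1}. ?f z \<eta>) \<partial>mu_hat \<alpha>)"
    by (simp only: indicator_vimage shift_shift add.commute[of 1])
  have "emeasure (distr (Palm_inv (mu_hat \<alpha>)) config_space (shift 1)) B = emeasure (Palm_inv (mu_hat \<alpha>)) (shift 1 -` B)"
    using emeasure_distr[of "shift 1" "Palm_inv (mu_hat \<alpha>)" config_space B] B
    by (simp add: measurable_cong_sets[OF sets_Palm_inv refl])
  then show "emeasure (distr (Palm_inv (mu_hat \<alpha>)) config_space (shift 1)) B = emeasure (Palm_inv (mu_hat \<alpha>)) B"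
    by (simp only: emeasure_Palm_inv[OF sets_mu_hat B] emeasure_Palm_inv[OF sets_mu_hat B'] *)
qed simp

lemma translation_invariant_Palm_inv:
  assumes "\<alpha> \<in> A_plus"
  shows "translation_invariant (Palm_inv (mu_hat \<alpha>))"
  unfolding translation_invariant_def
proof
  fix y :: int
  let ?P = "Palm_inv (mu_hat \<alpha>)"
  have comp: "distr (distr ?P config_space (shift x)) config_space (shift y) = distr ?P config_space (shift (y + x))" for x y
  proof -
    have "shift y \<circ> shift x = shift (y + x)" by (rule ext) (simp only: o_apply shift_shift)
    moreover have "shift x \<in> measurable ?P config_space"
      unfolding measurable_cong_sets[OF sets_Palm_inv refl] by (rule measurable_shift)
    ultimately show ?thesis using distr_distr[OF measurable_shift, of "shift x" ?P y] by (simp only:)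
  qed
  have id: "distr ?P config_space (shift 0) = ?P"
  proof -
    have "shift 0 = (\<lambda>\<eta>. \<eta>)" by (rule ext) (rule shift_0)
    then show ?thesis by (simp add: distr_id2)
  qed
  show "distr ?P config_space (shift y) = ?P"
  proof (induction y rule: int_induct[where k = 0])
    case base
    show ?case by (rule id)
  next
    case (step1 i)
    have "distr ?P config_space (shift (i + 1)) = distr (distr ?P config_space (shift 1)) config_space (shift i)"
      by (rule comp[symmetric])
    also have "\<dots> = ?P" unfolding distr_Palm_inv_shift_1[OF assms] by (rule step1)
    finally show ?case .
  next
    case (step2 i)
    have "distr ?P config_space (shift (i - 1)) = distr (distr ?P config_space (shift 1)) config_space (shift (i - 1))"
      by (simp only: distr_Palm_inv_shift_1[OF assms])
    also have "\<dots> = distr ?P config_space (shift (i - 1 + 1))" by (rule comp)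
    also have "\<dots> = ?P" using step2 by (simp only: diff_add_cancel)
    finally show ?case .
  qed
qed

section \<open>The strong law of large numbers\<close>

text \<open>The maximum of the partial sums of lengths 0 to \<open>n\<close>. The recursion on the
  tail exhibits the comparison of \<open>n + 1\<close> summands of a sequence with \<open>n\<close>
  summands of its tail.\<close>

fun max_partial_sum :: "('a \<Rightarrow> real) \<Rightarrow> nat \<Rightarrow> (nat \<Rightarrow> 'a) \<Rightarrow> real" where
  "max_partial_sum Y 0 \<omega> = 0"
| "max_partial_sum Y (Suc n) \<omega> = max 0 (Y (\<omega> 0) + max_partial_sum Y n (\<lambda>i. \<omega> (Suc i)))"

lemma max_partial_sum_nonneg: "0 \<le> max_partial_sum Y n \<omega>"
  by (cases n) auto

lemma max_partial_sum_mono_Suc: "max_partial_sum Y n \<omega> \<le> max_partial_sum Y (Suc n) \<omega>"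
proof (induction n arbitrary: \<omega>)
  case (Suc n)
  from Suc.IH[of "\<lambda>i. \<omega> (Suc i)"] show ?case by simp
qed simp

lemma max_partial_sum_mono: "m \<le> n \<Longrightarrow> max_partial_sum Y m \<omega> \<le> max_partial_sum Y n \<omega>"
  by (rule lift_Suc_mono_le[of "\<lambda>n. max_partial_sum Y n \<omega>"]) (rule max_partial_sum_mono_Suc)

lemma sum_le_max_partial_sum: "(\<Sum>i<n. Y (\<omega> i)) \<le> max_partial_sum Y n \<omega>"
proof (induction n arbitrary: \<omega>)
  case (Suc n)
  have "(\<Sum>i<Suc n. Y (\<omega> i)) = Y (\<omega> 0) + (\<Sum>i<n. Y (\<omega> (Suc i)))" by (rule sum.lessThan_Suc_shift)
  with Suc.IH[of "\<lambda>i. \<omega> (Suc i)"] show ?case by simp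
qed simp

lemma (in sequence_space) distr_tail: "distr S S (\<lambda>\<omega> i. \<omega> (Suc i)) = S"
  using distr_PiM_reindex[of UNIV "\<lambda>_. M" Suc UNIV] prob_space_axioms M.prob_space_axioms
  by (simp add: restrict_def)

lemma (in sequence_space) measurable_tail [measurable]: "(\<lambda>\<omega> i. \<omega> (Suc i)) \<in> measurable S S"
  by (rule measurable_PiM_single'[where f = "\<lambda>i \<omega>. \<omega> (Suc i)"]) (auto simp: space_PiM)

lemma (in sequence_space) integrable_tail:
  fixes f :: "_ \<Rightarrow> real"
  shows "integrable S f \<Longrightarrow> integrable S (\<lambda>\<omega>. f (\<lambda>i. \<omega> (Suc i)))"
  by (rule integrable_distr[OF measurable_tail]) (simp add: distr_tail)

lemma (in sequence_space) integral_tail: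
  fixes f :: "_ \<Rightarrow> real"
  assumes "f \<in> borel_measurable S"
  shows "(\<integral>\<omega>. f (\<lambda>i. \<omega> (Suc i)) \<partial>S) = (\<integral>\<omega>. f \<omega> \<partial>S)"
  using integral_distr[OF measurable_tail assms] by (simp add: distr_tail)

lemma (in sequence_space) integrable_component:
  fixes Y :: "_ \<Rightarrow> real"
  assumes "integrable M Y"
  shows "integrable S (\<lambda>\<omega>. Y (\<omega> i))"
proof (rule integrable_distr[of "\<lambda>\<omega>. \<omega> i" S M])
  show "integrable (distr S M (\<lambda>\<omega>. \<omega> i)) Y" using assms by (simp add: PiM_component)
qed simp

text \<open>On the event \<open>A\<close> that the partial sums are unbounded, the increment of the maximal partial sum
  over its value on the tail of the sequence converges to \<open>Y (\<omega> 0)\<close>. Its mean on \<open>A\<close> is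
  nonnegative because \<open>A\<close> is shift-invariant; since \<open>A\<close> does not depend on \<open>\<omega> 0\<close>,
  the limit has mean \<open>P(A) E Y\<close>.\<close>

lemma (in sequence_space) AE_partial_sums_bounded:
  fixes Y :: "_ \<Rightarrow> real"
  assumes Y: "integrable M Y" and neg: "(\<integral>x. Y x \<partial>M) < 0"
  shows "AE \<omega> in S. \<exists>C. \<forall>n. (\<Sum>i<n. Y (\<omega> i)) \<le> C"
proof -
  define A where "A = {\<omega> \<in> space S. \<forall>C::nat. \<exists>n. real C < max_partial_sum Y n \<omega>}"
  let ?m = "max_partial_sum Y"
  let ?t = "\<lambda>\<omega> i. \<omega> (Suc i)"
  have int: "integrable S (?m n)" for n
  proof (induction n)
    case (Suc n)
    have "integrable S (\<lambda>\<omega>. Y (\<omega> 0) + ?m n (?t \<omega>))"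
      by (intro Bochner_Integration.integrable_add integrable_component Y integrable_tail Suc)
    then show ?case by (simp add: integrable_max)
  qed simp
  have m[measurable]: "?m n \<in> borel_measurable S" for n using int by (rule borel_measurable_integrable)
  have A[measurable]: "A \<in> sets S" unfolding A_def by measurable
  have Y0: "integrable S (\<lambda>\<omega>. Y (\<omega> 0))" by (rule integrable_component[OF Y])
  \<comment> \<open>Adding or dropping the first summand changes the maxima by a bounded amount, so
    unboundedness passes to the tail and back.\<close>
  have tA: "?t \<omega> \<in> A \<longleftrightarrow> \<omega> \<in> A" if "\<omega> \<in> space S" for \<omega>
  proof -
    have sp: "?t \<omega> \<in> space S" using that measurable_space[OF measurable_tail] by blast
    have "(\<forall>C::nat. \<exists>n. real C < ?m n (?t \<omega>)) \<longleftrightarrow> (\<forall>C::nat. \<exists>n. real C < ?m n \<omega>)"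
    proof (intro iffI allI)
      fix C :: nat assume *: "\<forall>C::nat. \<exists>n. real C < ?m n (?t \<omega>)"
      obtain C' :: nat where C': "real C + \<bar>Y (\<omega> 0)\<bar> \<le> real C'" using real_arch_simple by blast
      obtain n where "real C' < ?m n (?t \<omega>)" using * by blast
      with C' have "real C < ?m (Suc n) \<omega>" by simp
      then show "\<exists>n. real C < ?m n \<omega>" by blast
    next
      fix C :: nat assume *: "\<forall>C::nat. \<exists>n. real C < ?m n \<omega>"
      obtain C' :: nat where C': "real C + \<bar>Y (\<omega> 0)\<bar> \<le> real C'" using real_arch_simple by blast
      obtain n where n: "real C' < ?m n \<omega>" using * by blast
      then obtain n' where "n = Suc n'" by (cases n) auto
      with n C' have "real C < ?m n' (?t \<omega>)" by (auto simp: max_def split: if_splits)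
      then show "\<exists>n. real C < ?m n (?t \<omega>)" by blast
    qed
    with sp that show ?thesis by (simp add: A_def)
  qed
  define f where "f n \<omega> = indicator A \<omega> * (?m (Suc n) \<omega> - ?m n (?t \<omega>))" for n \<omega>
  have f: "0 \<le> (\<integral>\<omega>. f n \<omega> \<partial>S)" for n
  proof -
    have i1: "integrable S (\<lambda>\<omega>. indicator A \<omega> * ?m k \<omega>)" for k
      using integrable_mult_indicator[OF A int[of k]] by simp
    have i2: "integrable S (\<lambda>\<omega>. indicator A (?t \<omega>) * ?m n (?t \<omega>))"
      by (rule integrable_tail[OF i1])
    have "(\<integral>\<omega>. f n \<omega> \<partial>S) = (\<integral>\<omega>. indicator A \<omega> * ?m (Suc n) \<omega> - indicator A (?t \<omega>) * ?m n (?t \<omega>) \<partial>S)"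
      by (rule Bochner_Integration.integral_cong)
         (auto simp: f_def tA algebra_simps simp del: max_partial_sum.simps split: split_indicator)
    also have "\<dots> = (\<integral>\<omega>. indicator A \<omega> * ?m (Suc n) \<omega> \<partial>S) - (\<integral>\<omega>. indicator A (?t \<omega>) * ?m n (?t \<omega>) \<partial>S)"
      by (rule Bochner_Integration.integral_diff[OF i1 i2])
    also have "(\<integral>\<omega>. indicator A (?t \<omega>) * ?m n (?t \<omega>) \<partial>S) = (\<integral>\<omega>. indicator A \<omega> * ?m n \<omega> \<partial>S)"
      by (rule integral_tail) (rule borel_measurable_integrable[OF i1])
    finally have eq: "(\<integral>\<omega>. f n \<omega> \<partial>S)
      = (\<integral>\<omega>. indicator A \<omega> * ?m (Suc n) \<omega> \<partial>S) - (\<integral>\<omega>. indicator A \<omega> * ?m n \<omega> \<partial>S)" .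
    have "(\<integral>\<omega>. indicator A \<omega> * ?m n \<omega> \<partial>S) \<le> (\<integral>\<omega>. indicator A \<omega> * ?m (Suc n) \<omega> \<partial>S)"
      by (rule integral_mono[OF i1 i1])
         (auto intro: max_partial_sum_mono_Suc simp del: max_partial_sum.simps split: split_indicator)
    then show ?thesis unfolding eq by (simp only: diff_ge_0_iff_ge)
  qed
  have "(\<lambda>n. \<integral>\<omega>. f n \<omega> \<partial>S) \<longlonglongrightarrow> (\<integral>\<omega>. indicator A \<omega> * Y (\<omega> 0) \<partial>S)"
  proof (rule integral_dominated_convergence[where w = "\<lambda>\<omega>. \<bar>Y (\<omega> 0)\<bar>"])
    have [measurable]: "(\<lambda>\<omega>. Y (\<omega> 0)) \<in> borel_measurable S" using Y0 by (rule borel_measurable_integrable)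
    show "(\<lambda>\<omega>. indicator A \<omega> * Y (\<omega> 0)) \<in> borel_measurable S" by measurable
    show "f n \<in> borel_measurable S" for n unfolding f_def[abs_def]
      by (intro borel_measurable_times borel_measurable_indicator A borel_measurable_diff m
          measurable_compose[OF measurable_tail m])
    show "integrable S (\<lambda>\<omega>. \<bar>Y (\<omega> 0)\<bar>)" using Y0 by (rule integrable_abs)
    \<comment> \<open>For \<open>m \<ge> 0\<close> the difference \<open>max 0 (y + m) - m\<close>
      is either \<open>y\<close> or \<open>- m\<close> with \<open>m \<le> - y\<close>.\<close>
    show "AE \<omega> in S. norm (f n \<omega>) \<le> \<bar>Y (\<omega> 0)\<bar>" for n
      by (rule AE_I2) (use max_partial_sum_nonneg[of Y n] in \<open>auto simp: f_def max_def split: split_indicator\<close>)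
    show "AE \<omega> in S. (\<lambda>n. f n \<omega>) \<longlonglongrightarrow> indicator A \<omega> * Y (\<omega> 0)"
    proof (rule AE_I2)
      fix \<omega> assume \<omega>: "\<omega> \<in> space S"
      show "(\<lambda>n. f n \<omega>) \<longlonglongrightarrow> indicator A \<omega> * Y (\<omega> 0)"
      proof (cases "\<omega> \<in> A")
        case True
        then have "?t \<omega> \<in> A" using tA[OF \<omega>] by simp
        obtain C :: nat where C: "\<bar>Y (\<omega> 0)\<bar> \<le> real C" using real_arch_simple by blast
        obtain k where k: "real C < ?m k (?t \<omega>)" using \<open>?t \<omega> \<in> A\<close> by (auto simp: A_def)
        have "eventually (\<lambda>n. f n \<omega> = Y (\<omega> 0)) sequentially"
        proof (rule eventually_sequentiallyI)
          fix n assume "k \<le> n"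
          then have "real C < ?m n (?t \<omega>)" using k max_partial_sum_mono[of k n Y "?t \<omega>"] by simp
          with C True show "f n \<omega> = Y (\<omega> 0)" by (simp add: f_def max_def)
        qed
        with True show ?thesis by (simp add: tendsto_eventually)
      qed (simp add: f_def)
    qed
  qed
  then have "0 \<le> (\<integral>\<omega>. indicator A \<omega> * Y (\<omega> 0) \<partial>S)"
    by (rule LIMSEQ_le_const) (use f in blast)
  also have "\<dots> = (\<integral>\<omega>. Y (\<omega> 0) * indicator A (?t \<omega>) \<partial>S)"
    by (rule Bochner_Integration.integral_cong) (auto simp: tA split: split_indicator)
  \<comment> \<open>With the first coordinate split off as an independent factor, \<open>A\<close>
    is an event of the tail alone.\<close>
  also have "\<dots> = (\<integral>x. Y x \<partial>M) * measure S A"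
  proof -
    let ?g = "\<lambda>\<omega>. Y (\<omega> 0) * indicator A (?t \<omega>)"
    let ?c = "\<lambda>(s, \<omega>). case_nat s \<omega>"
    have g: "integrable S ?g"
      using integrable_mult_indicator[OF measurable_sets[OF measurable_tail A] Y0]
      by (rule Bochner_Integration.integrable_cong[THEN iffD1, rotated -1]) (auto split: split_indicator)
    have c: "?c \<in> measurable (M \<Otimes>\<^sub>M S) S" by measurable
    interpret pair_sigma_finite M S ..
    have "integrable (distr (M \<Otimes>\<^sub>M S) S ?c) ?g" using g by (simp only: PiM_iter)
    then have gc: "integrable (M \<Otimes>\<^sub>M S) (\<lambda>x. ?g (?c x))" by (rule integrable_distr[OF c])
    have "(\<integral>\<omega>. ?g \<omega> \<partial>S) = (\<integral>\<omega>. ?g \<omega> \<partial>distr (M \<Otimes>\<^sub>M S) S ?c)" by (simp only: PiM_iter)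
    also have "\<dots> = (\<integral>x. ?g (?c x) \<partial>(M \<Otimes>\<^sub>M S))"
      by (rule integral_distr[OF c]) (rule borel_measurable_integrable[OF g])
    also have "\<dots> = (\<integral>(s, \<omega>). Y s * indicator A \<omega> \<partial>(M \<Otimes>\<^sub>M S))"
      by (rule Bochner_Integration.integral_cong) auto
    also have "\<dots> = (\<integral>s. (\<integral>\<omega>. Y s * indicator A \<omega> \<partial>S) \<partial>M)"
    proof -
      have "integrable (M \<Otimes>\<^sub>M S) (\<lambda>(s, \<omega>). Y s * indicator A \<omega>)"
        using gc by (rule Bochner_Integration.integrable_cong[THEN iffD1, rotated -1]) auto
      from integral_fst'[OF this] show ?thesis by simp
    qed
    also have "\<dots> = (\<integral>s. Y s * measure S A \<partial>M)" by simp
    finally show ?thesis by simp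
  qed
  finally have "measure S A = 0"
    using neg by (metis less_eq_real_def measure_nonneg mult_neg_pos not_less)
  then have "A \<in> null_sets S" using A by (simp add: emeasure_eq_measure null_setsI)
  then have "AE \<omega> in S. \<omega> \<notin> A" by (rule AE_not_in)
  then show ?thesis
  proof (rule AE_mp, intro AE_I2 impI)
    fix \<omega> assume "\<omega> \<in> space S" "\<omega> \<notin> A"
    then obtain C :: nat where "\<And>n. ?m n \<omega> \<le> real C" by (auto simp: A_def not_less)
    then show "\<exists>C. \<forall>n. (\<Sum>i<n. Y (\<omega> i)) \<le> C"
      using sum_le_max_partial_sum[of Y \<omega>] order_trans by blast
  qed
qed

lemma (in sequence_space) AE_eventually_average_le:
  fixes g :: "_ \<Rightarrow> real"
  assumes g: "integrable M g" and "0 < \<delta>"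
  shows "AE \<omega> in S. eventually (\<lambda>n. (\<Sum>i<n. g (\<omega> i)) / n \<le> (\<integral>x. g x \<partial>M) + \<delta>) sequentially"
proof -
  \<comment> \<open>One half of the margin makes the mean of \<open>g x - c\<close> negative, the
    other half absorbs the bounded error \<open>C / n\<close>.\<close>
  define c where "c = (\<integral>x. g x \<partial>M) + \<delta> / 2"
  have "(\<integral>x. g x - c \<partial>M) < 0"
    using g \<open>0 < \<delta>\<close> by (simp add: c_def M.prob_space)
  then have "AE \<omega> in S. \<exists>C. \<forall>n. (\<Sum>i<n. g (\<omega> i) - c) \<le> C"
    by (intro AE_partial_sums_bounded) (use g in auto)
  then show ?thesis
  proof (rule AE_mp, intro AE_I2 impI)
    fix \<omega> :: "nat \<Rightarrow> 'a" assume "\<exists>C. \<forall>n. (\<Sum>i<n. g (\<omega> i) - c) \<le> C"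
    then obtain C where C: "\<And>n. (\<Sum>i<n. g (\<omega> i)) - real n * c \<le> C"
      by (auto simp: sum_subtractf)
    have "(\<lambda>n. C / real n) \<longlonglongrightarrow> 0" by (rule lim_const_over_n)
    then have "eventually (\<lambda>n. C / real n < \<delta> / 2) sequentially"
      by (rule order_tendstoD) (use \<open>0 < \<delta>\<close> in simp)
    then show "eventually (\<lambda>n. (\<Sum>i<n. g (\<omega> i)) / n \<le> (\<integral>x. g x \<partial>M) + \<delta>) sequentially"
      using eventually_gt_at_top[of 0]
    proof eventually_elim
      case (elim n)
      have "(\<Sum>i<n. g (\<omega> i)) / n \<le> (C + real n * c) / n"
        using C[of n] by (intro divide_right_mono) auto
      also have "\<dots> = C / n + c" using elim by (simp add: field_simps)
      also have "\<dots> \<le> (\<integral>x. g x \<partial>M) + \<delta>" using elim by (simp only: c_def)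
      finally show ?case .
    qed
  qed
qed

theorem (in sequence_space) strong_law_of_large_numbers:
  fixes g :: "_ \<Rightarrow> real"
  assumes g: "integrable M g"
  shows "AE \<omega> in S. (\<lambda>n. (\<Sum>i<n. g (\<omega> i)) / n) \<longlonglongrightarrow> (\<integral>x. g x \<partial>M)"
proof -
  let ?E = "\<integral>x. g x \<partial>M"
  have "AE \<omega> in S. \<forall>k::nat. eventually (\<lambda>n. (\<Sum>i<n. g (\<omega> i)) / n \<le> ?E + 1 / Suc k) sequentially"
    unfolding AE_all_countable using AE_eventually_average_le[OF g] by simp
  moreover have "AE \<omega> in S. \<forall>k::nat. eventually (\<lambda>n. ?E - 1 / Suc k \<le> (\<Sum>i<n. g (\<omega> i)) / n) sequentially"
    unfolding AE_all_countable
  proof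
    fix k
    have "AE \<omega> in S. eventually (\<lambda>n. (\<Sum>i<n. - g (\<omega> i)) / n \<le> (\<integral>x. - g x \<partial>M) + 1 / Suc k) sequentially"
      by (rule AE_eventually_average_le) (use g in auto)
    then show "AE \<omega> in S. eventually (\<lambda>n. ?E - 1 / Suc k \<le> (\<Sum>i<n. g (\<omega> i)) / n) sequentially"
      by (rule AE_mp, intro AE_I2 impI) (auto simp: sum_negf elim!: eventually_mono)
  qed
  ultimately show ?thesis
  proof eventually_elim
    case (elim \<omega>)
    show ?case
    proof (rule LIMSEQ_I)
      fix r :: real assume "0 < r"
      then obtain k where k: "1 / real (Suc k) < r" using nat_approx_posE by auto
      have "eventually (\<lambda>n. norm ((\<Sum>i<n. g (\<omega> i)) / n - ?E) < r) sequentially"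
        using elim(1)[rule_format, of k] elim(2)[rule_format, of k]
        by eventually_elim (use k in auto)
      then show "\<exists>no. \<forall>n\<ge>no. norm ((\<Sum>i<n. g (\<omega> i)) / real n - ?E) < r"
        by (simp add: eventually_sequentially)
    qed
  qed
qed

section \<open>Ball densities\<close>

text \<open>In use, \<open>b n\<close> is the distance of the \<open>n\<close>-th record and
  \<open>B\<close> counts balls. Between two consecutive points \<open>b n\<close> the quotient is
  squeezed by quotients at these points, whose common limit uses that \<open>b (Suc n) / b n\<close>
  tends to 1.\<close>

lemma renewal_limit:
  fixes b :: "nat \<Rightarrow> nat" and B :: "nat \<Rightarrow> real"
  assumes b: "strict_mono b" "b 0 = 0" and B: "mono B" "\<And>n. 0 \<le> B n"
    and lim_b: "(\<lambda>n. b n / n) \<longlonglongrightarrow> \<kappa>" "0 < \<kappa>" and lim_B: "(\<lambda>n. B (b n) / n) \<longlonglongrightarrow> \<beta>"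
  shows "(\<lambda>y. B y / y) \<longlonglongrightarrow> \<beta> / \<kappa>"
proof -
  define N where "N y = (LEAST n. y < b (Suc n))" for y
  have ge: "n \<le> b n" for n using b(1) by (rule strict_mono_imp_increasing)
  have N1: "y < b (Suc (N y))" for y
    unfolding N_def by (rule LeastI[of _ y]) (use ge[of "Suc y"] in simp)
  have N2: "b (N y) \<le> y" for y
  proof (cases "N y")
    case (Suc n)
    then have "\<not> y < b (Suc n)" using not_less_Least[of n "\<lambda>n. y < b (Suc n)"] by (simp add: N_def)
    with Suc show ?thesis by simp
  qed (use b in simp)
  have N3: "m \<le> N y" if "b m \<le> y" for m y
  proof (rule ccontr)
    assume "\<not> m \<le> N y"
    then have "b (Suc (N y)) \<le> b m" using strict_mono_less_eq[OF b(1)] by simp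
    with that N1[of y] show False by simp
  qed
  have filt: "filterlim N at_top sequentially"
    unfolding filterlim_at_top
    by (intro allI eventually_sequentiallyI[of "b _"]) (rule N3)
  have r: "(\<lambda>n. real (Suc n) / real n) \<longlonglongrightarrow> 1"
    using LIMSEQ_Suc_n_over_n[where 'a = real] by simp
  have bS: "(\<lambda>n. b (Suc n) / Suc n) \<longlonglongrightarrow> \<kappa>" using LIMSEQ_Suc[OF lim_b(1)] .
  have BS: "(\<lambda>n. B (b (Suc n)) / Suc n) \<longlonglongrightarrow> \<beta>" using LIMSEQ_Suc[OF lim_B] .
  have up: "(\<lambda>n. B (b (Suc n)) / b n) \<longlonglongrightarrow> \<beta> / \<kappa>"
  proof -
    have "(\<lambda>n. (B (b (Suc n)) / Suc n) * (real (Suc n) / real n) / (b n / n)) \<longlonglongrightarrow> \<beta> * 1 / \<kappa>"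
      by (intro tendsto_intros BS r lim_b) (use lim_b(2) in simp)
    moreover have "eventually (\<lambda>n. (B (b (Suc n)) / Suc n) * (real (Suc n) / real n) / (b n / n)
        = B (b (Suc n)) / b n) sequentially"
      using eventually_gt_at_top[of 0]
    proof eventually_elim
      case (elim n)
      have "x / s * (s / a) / (c / a) = x / c" if "s \<noteq> 0" "a \<noteq> 0" for x s a c :: real
        using that by simp
      from this[of "real (Suc n)" "real n"] elim show ?case by simp
    qed
    ultimately have "(\<lambda>n. B (b (Suc n)) / b n) \<longlonglongrightarrow> \<beta> * 1 / \<kappa>" by (rule Lim_transform_eventually)
    then show ?thesis by simp
  qed
  have lo: "(\<lambda>n. B (b n) / b (Suc n)) \<longlonglongrightarrow> \<beta> / \<kappa>"
  proof -
    have "(\<lambda>n. (B (b n) / n) / (real (Suc n) / real n) / (b (Suc n) / Suc n)) \<longlonglongrightarrow> \<beta> / 1 / \<kappa>"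
      by (intro tendsto_intros bS r lim_B) (use lim_b(2) in simp_all)
    moreover have "eventually (\<lambda>n. (B (b n) / n) / (real (Suc n) / real n) / (b (Suc n) / Suc n)
        = B (b n) / b (Suc n)) sequentially"
      using eventually_gt_at_top[of 0]
    proof eventually_elim
      case (elim n)
      have "x / a / (s / a) / (c / s) = x / c" if "s \<noteq> 0" "a \<noteq> 0" for x s a c :: real
        using that by simp
      from this[of "real (Suc n)" "real n"] elim show ?case by simp
    qed
    ultimately have "(\<lambda>n. B (b n) / b (Suc n)) \<longlonglongrightarrow> \<beta> / 1 / \<kappa>" by (rule Lim_transform_eventually)
    then show ?thesis by simp
  qed
  show ?thesis
  proof (rule tendsto_sandwich)
    show "(\<lambda>y. B (b (N y)) / b (Suc (N y))) \<longlonglongrightarrow> \<beta> / \<kappa>" by (rule filterlim_compose[OF lo filt])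
    show "(\<lambda>y. B (b (Suc (N y))) / b (N y)) \<longlonglongrightarrow> \<beta> / \<kappa>" by (rule filterlim_compose[OF up filt])
    have ev: "eventually (\<lambda>y. b 1 \<le> y) sequentially" by (rule eventually_ge_at_top)
    show "eventually (\<lambda>y. B (b (N y)) / b (Suc (N y)) \<le> B y / y) sequentially"
      using ev
    proof eventually_elim
      case (elim y)
      have "0 < y" using ge[of 1] elim by simp
      then show ?case using N1[of y] N2[of y] B(2) monoD[OF B(1) N2[of y]]
        by (intro frac_le) auto
    qed
    show "eventually (\<lambda>y. B y / y \<le> B (b (Suc (N y))) / b (N y)) sequentially"
      using ev
    proof eventually_elim
      case (elim y)
      then have "1 \<le> N y" by (rule N3)
      then have "0 < b (N y)" using ge[of "N y"] by simp
      then show ?case using N1[of y] N2[of y] B(2) monoD[OF B(1), of y "b (Suc (N y))"]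
        by (intro frac_le) auto
    qed
  qed
qed

lemma sum_right_walk:
  "(\<Sum>z\<in>{0..int y}. of_bool (\<eta> z) :: real) = of_bool (\<eta> 0) + (real y + of_int (walk \<eta> (int y))) / 2"
proof (induction y)
  case (Suc y)
  have "{0..int (Suc y)} = insert (int (Suc y)) {0..int y}" by auto
  with Suc show ?case using walk_step[of \<eta> "int (Suc y)"] by (auto simp: field_simps simp del: sum_of_bool_eq)
qed simp

text \<open>The walk at \<open>- y\<close> accounts for the boxes from \<open>1 - y\<close> to 0, so
  box \<open>- y\<close> enters separately; to the right of the origin it is box 0 that
  does.\<close>

lemma sum_left_walk:
  "(\<Sum>z\<in>{- int y..0}. of_bool (\<eta> z) :: real) = of_bool (\<eta> (- int y)) + (real y - of_int (walk \<eta> (- int y))) / 2"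
proof (induction y)
  case (Suc y)
  have "{- int (Suc y)..0} = insert (- int (Suc y)) {- int y..0}" by auto
  moreover have "- 1 - int y = - int y - 1" by simp
  then have "walk \<eta> (- 1 - int y) = walk \<eta> (- int y) - (2 * of_bool (\<eta> (- int y)) - 1)"
    using walk_step[of \<eta> "- int y"] by (simp only:)
  ultimately show ?case using Suc
    by (cases "\<eta> (- int y)") (auto simp: field_simps simp del: sum_of_bool_eq)
qed simp

text \<open>Each of the two sums changes by at most one ball, which disappears upon division by
  \<open>y\<close>.\<close>

lemma density_class_shift_1: "shift 1 \<eta> \<in> density_class l \<longleftrightarrow> \<eta> \<in> density_class l"
proof -
  have equiv: "(\<lambda>y. f y / real y) \<longlonglongrightarrow> l \<longleftrightarrow> (\<lambda>y. g y / real y) \<longlonglongrightarrow> l"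
    if "\<And>y. \<bar>f y - g y\<bar> \<le> 1" for f g :: "nat \<Rightarrow> real"
  proof -
    have "(\<lambda>y. f y / real y - g y / real y) \<longlonglongrightarrow> 0"
    proof (rule Lim_null_comparison)
      show "eventually (\<lambda>y. norm (f y / real y - g y / real y) \<le> 1 / real y) sequentially"
        using that by (intro always_eventually) (auto simp: diff_divide_distrib[symmetric] intro!: divide_right_mono)
    qed (rule lim_const_over_n)
    then have d: "(\<lambda>y. f y / real y - g y / real y) \<longlonglongrightarrow> 0" .
    show ?thesis
      using tendsto_add[OF _ d, of "\<lambda>y. g y / real y" l] tendsto_diff[OF _ d, of "\<lambda>y. f y / real y" l] by auto
  qed
  have "(\<Sum>z\<in>{0..int y}. of_bool (shift 1 \<eta> z) :: real) - (\<Sum>z\<in>{0..int y}. of_bool (\<eta> z))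
      = of_bool (\<eta> (int y + 1)) - of_bool (\<eta> 0)" for y
  proof (induction y)
    case (Suc y)
    have "{0..int (Suc y)} = insert (int (Suc y)) {0..int y}" by auto
    with Suc show ?case by (simp add: shift_def[of 1 \<eta> "1 + int y"] add_ac del: sum_of_bool_eq)
  qed (simp add: shift_def[of 1 \<eta> 0])
  then have r: "\<bar>(\<Sum>z\<in>{0..int y}. of_bool (shift 1 \<eta> z) :: real) - (\<Sum>z\<in>{0..int y}. of_bool (\<eta> z))\<bar> \<le> 1" for y
    by simp
  have "(\<Sum>z\<in>{- int y..0}. of_bool (shift 1 \<eta> z) :: real) - (\<Sum>z\<in>{- int y..0}. of_bool (\<eta> z))
      = of_bool (\<eta> 1) - of_bool (\<eta> (- int y))" for y
  proof (induction y)
    case (Suc y)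
    have "{- int (Suc y)..0} = insert (- int (Suc y)) {- int y..0}" by auto
    with Suc show ?case by (simp add: shift_def[of 1 \<eta> "- 1 - int y"] add_ac del: sum_of_bool_eq)
  qed (simp add: shift_def[of 1 \<eta> 0])
  then have l: "\<bar>(\<Sum>z\<in>{- int y..0}. of_bool (shift 1 \<eta> z) :: real) - (\<Sum>z\<in>{- int y..0}. of_bool (\<eta> z))\<bar> \<le> 1" for y
    by simp
  show ?thesis unfolding density_class_def mem_Collect_eq equiv[OF r] equiv[OF l] ..
qed

lemma density_class_shift: "shift x \<eta> \<in> density_class l \<longleftrightarrow> \<eta> \<in> density_class l"
proof (induction x rule: int_induct[where k = 0])
  case base
  show ?case by simp
next
  case (step1 i)
  then show ?case using density_class_shift_1[of "shift i \<eta>" l] by (simp add: shift_shift add.commute)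
next
  case (step2 i)
  then show ?case using density_class_shift_1[of "shift (i - 1) \<eta>" l] by (simp add: shift_shift)
qed

text \<open>Within block \<open>j\<close> the walk is at least \<open>- j\<close>, a level that it
  attains first at the start of the block.\<close>

lemma records_config_of:
  assumes \<epsilon>: "\<forall>i. \<epsilon> i \<in> excursions"
  shows "z \<in> records (config_of \<epsilon>) \<longleftrightarrow> (\<exists>i. z = block_start \<epsilon> i)"
proof -
  have block: "\<exists>j x. z = block_start \<epsilon> j + int x \<and> x \<le> 2 * half_length (\<epsilon> j)
    \<and> walk (config_of \<epsilon>) z = - j + \<epsilon> j ! x \<and> 0 \<le> \<epsilon> j ! x" for z
  proof -
    obtain j where j: "block_start \<epsilon> j \<le> z" "z < block_start \<epsilon> (j + 1)"
      using block_exists by blast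
    define x where "x = nat (z - block_start \<epsilon> j)"
    have x: "z = block_start \<epsilon> j + int x" "x \<le> 2 * half_length (\<epsilon> j)"
      using j block_start_step[of \<epsilon> j] by (auto simp: x_def)
    have "0 \<le> \<epsilon> j ! x" using \<epsilon>[rule_format, of j] x(2) by (auto simp: excursions_def half_length_def)
    with x walk_block[OF \<epsilon> x(2)] walk_block_start[OF \<epsilon>, of j] show ?thesis by auto
  qed
  show ?thesis
  proof
    assume z: "z \<in> records (config_of \<epsilon>)"
    obtain j x where *: "z = block_start \<epsilon> j + int x" "walk (config_of \<epsilon>) z = - j + \<epsilon> j ! x" "0 \<le> \<epsilon> j ! x"
      using block[of z] by blast
    have "x = 0"
    proof (rule ccontr)
      assume "x \<noteq> 0"
      then have "block_start \<epsilon> j < z" using * by simp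
      with z have "walk (config_of \<epsilon>) z < walk (config_of \<epsilon>) (block_start \<epsilon> j)" by (simp add: records_def)
      with * walk_block_start[OF \<epsilon>, of j] show False by simp
    qed
    with * show "\<exists>i. z = block_start \<epsilon> i" by auto
  next
    assume "\<exists>i. z = block_start \<epsilon> i"
    then obtain i where z: "z = block_start \<epsilon> i" by blast
    have "walk (config_of \<epsilon>) z < walk (config_of \<epsilon>) z'" if "z' < z" for z'
    proof -
      obtain j x where *: "z' = block_start \<epsilon> j + int x" "walk (config_of \<epsilon>) z' = - j + \<epsilon> j ! x" "0 \<le> \<epsilon> j ! x"
        using block[of z'] by blast
      have "j < i"
      proof (rule ccontr)
        assume "\<not> j < i"
        then show False using block_start_diff[of i j \<epsilon>] * that z by simp
      qed
      with * z walk_block_start[OF \<epsilon>, of i] show ?thesis by simp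
    qed
    then show "z \<in> records (config_of \<epsilon>)" by (simp add: records_def)
  qed
qed

lemma config_of_block_start: "\<not> config_of \<epsilon> (block_start \<epsilon> i)"
  using config_of_block[of 0 \<epsilon> i] by (simp add: ball_config_def)

text \<open>At the \<open>n\<close>-th record to the right the walk is at \<open>- n\<close>, so the
  balls passed number half of the boxes in excess of \<open>n\<close>; to the left the count is the
  same. Divided by \<open>n\<close> it tends to \<open>(\<kappa> - 1) / 2\<close>, and passing from
  records to boxes divides by \<open>\<kappa>\<close>.\<close>

lemma density_config_of:
  assumes \<epsilon>: "\<forall>i. \<epsilon> i \<in> excursions" and \<kappa>: "1 \<le> \<kappa>"
    and right: "(\<lambda>n. (\<Sum>i<n. real (2 * half_length (\<epsilon> (int i)) + 1)) / n) \<longlonglongrightarrow> \<kappa>"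
    and left: "(\<lambda>n. (\<Sum>i<n. real (2 * half_length (\<epsilon> (- 1 - int i)) + 1)) / n) \<longlonglongrightarrow> \<kappa>"
  shows "config_of \<epsilon> \<in> density_class_hat ((\<kappa> - 1) / (2 * \<kappa>))"
proof -
  let ?\<eta> = "config_of \<epsilon>"
  have rec: "0 \<in> records ?\<eta>" unfolding records_config_of[OF \<epsilon>] using block_start_0[of \<epsilon>] by metis
  have \<eta>0: "\<not> ?\<eta> 0" using config_of_block_start[of \<epsilon> 0] by (simp add: block_start_0)
  have lim: "(\<lambda>y. B y / y) \<longlonglongrightarrow> (\<kappa> - 1) / (2 * \<kappa>)"
    if b: "\<And>n. b n = (\<Sum>i<n. 2 * c i + 1)" and lim: "(\<lambda>n. (\<Sum>i<n. real (2 * c i + 1)) / n) \<longlonglongrightarrow> \<kappa>"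
      and B: "mono B" "\<And>n. 0 \<le> B n" "\<And>n. B (b n) = (real (b n) - real n) / 2"
    for b c :: "nat \<Rightarrow> nat" and B :: "nat \<Rightarrow> real"
  proof -
    have lb: "(\<lambda>n. b n / n) \<longlonglongrightarrow> \<kappa>" using lim unfolding b of_nat_sum .
    have "(\<lambda>n. (b n / n - 1) / 2) \<longlonglongrightarrow> (\<kappa> - 1) / 2"
      by (intro tendsto_intros lb) simp
    moreover have "eventually (\<lambda>n. (b n / n - 1) / 2 = B (b n) / n) sequentially"
      using eventually_gt_at_top[of 0] by eventually_elim (simp add: B(3) field_simps)
    ultimately have "(\<lambda>n. B (b n) / n) \<longlonglongrightarrow> (\<kappa> - 1) / 2" by (rule Lim_transform_eventually)
    moreover have "strict_mono b" by (simp add: strict_mono_Suc_iff b)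
    moreover have "b 0 = 0" by (simp add: b)
    moreover have "0 < \<kappa>" using \<kappa> by simp
    ultimately have "(\<lambda>y. B y / y) \<longlonglongrightarrow> ((\<kappa> - 1) / 2) / \<kappa>"
      using renewal_limit B(1,2) lb by blast
    then show ?thesis by simp
  qed
  have bs_right: "int (\<Sum>i<n. 2 * half_length (\<epsilon> (int i)) + 1) = block_start \<epsilon> (int n)" for n
  proof (induction n)
    case (Suc n)
    then show ?case using block_start_step[of \<epsilon> "int n"] by (simp add: add_ac)
  qed (simp add: block_start_0)
  have bs_left: "int (\<Sum>i<n. 2 * half_length (\<epsilon> (- 1 - int i)) + 1) = - block_start \<epsilon> (- int n)" for n
  proof (induction n)
    case (Suc n)
    then show ?case using block_start_step[of \<epsilon> "- 1 - int n"] by simp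
  qed (simp add: block_start_0)
  have "(\<lambda>y. (\<Sum>z\<in>{0..int y}. of_bool (?\<eta> z)) / real y) \<longlonglongrightarrow> (\<kappa> - 1) / (2 * \<kappa>)"
  proof (rule lim[OF refl right])
    show "mono (\<lambda>y. \<Sum>z\<in>{0..int y}. of_bool (?\<eta> z) :: real)"
      by (intro monoI sum_mono2) auto
    show "0 \<le> (\<Sum>z\<in>{0..int n}. of_bool (?\<eta> z) :: real)" for n by (intro sum_nonneg) auto
    fix n
    show "(\<Sum>z\<in>{0..int (\<Sum>i<n. 2 * half_length (\<epsilon> (int i)) + 1)}. of_bool (?\<eta> z))
      = (real (\<Sum>i<n. 2 * half_length (\<epsilon> (int i)) + 1) - real n) / 2"
      using sum_right_walk[of ?\<eta> "\<Sum>i<n. 2 * half_length (\<epsilon> (int i)) + 1"] \<eta>0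
      unfolding bs_right walk_block_start[OF \<epsilon>] by (simp del: sum_of_bool_eq)
  qed
  moreover have "(\<lambda>y. (\<Sum>z\<in>{- int y..0}. of_bool (?\<eta> z)) / real y) \<longlonglongrightarrow> (\<kappa> - 1) / (2 * \<kappa>)"
  proof (rule lim[OF refl left])
    show "mono (\<lambda>y. \<Sum>z\<in>{- int y..0}. of_bool (?\<eta> z) :: real)"
      by (intro monoI sum_mono2) auto
    show "0 \<le> (\<Sum>z\<in>{- int n..0}. of_bool (?\<eta> z) :: real)" for n by (intro sum_nonneg) auto
    fix n
    show "(\<Sum>z\<in>{- int (\<Sum>i<n. 2 * half_length (\<epsilon> (- 1 - int i)) + 1)..0}. of_bool (?\<eta> z))
      = (real (\<Sum>i<n. 2 * half_length (\<epsilon> (- 1 - int i)) + 1) - real n) / 2"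
      using sum_left_walk[of ?\<eta> "\<Sum>i<n. 2 * half_length (\<epsilon> (- 1 - int i)) + 1"]
        config_of_block_start[of \<epsilon> "- int n"]
      unfolding bs_left minus_minus walk_block_start[OF \<epsilon>] by (simp del: sum_of_bool_eq)
  qed
  ultimately show ?thesis using rec by (simp add: density_class_hat_def density_class_def)
qed

lemma AE_density_config_of:
  assumes "\<alpha> \<in> A_plus"
  shows "AE \<epsilon> in exc_seq \<alpha>. config_of \<epsilon> \<in> density_class_hat (ball_density \<alpha>)"
proof -
  have A: "\<alpha> \<in> A_set" and fin: "(\<integral>\<^sup>+ e. of_nat (half_length e) \<partial>exc_law \<alpha>) < \<infinity>"
    using assms by (simp_all add: A_plus_iff)
  interpret K: prob_space "exc_law \<alpha>" by (rule prob_space_exc_law[OF A])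
  interpret sequence_space "exc_law \<alpha>" ..
  have m: "f \<in> borel_measurable (exc_law \<alpha>)" for f :: "int list \<Rightarrow> real"
    by (simp add: measurable_exc_law)
  let ?g = "\<lambda>e. real (2 * half_length e + 1)"
  have nn: "(\<integral>\<^sup>+ e. ennreal (real (half_length e)) \<partial>exc_law \<alpha>) = (\<integral>\<^sup>+ e. of_nat (half_length e) \<partial>exc_law \<alpha>)"
    by (simp add: ennreal_of_nat_eq_real_of_nat)
  have ih: "integrable (exc_law \<alpha>) (\<lambda>e. real (half_length e))"
    by (rule integrableI_bounded[OF m]) (use fin in \<open>simp add: nn\<close>)
  then have ig: "integrable (exc_law \<alpha>) ?g" by simp
  have "(\<integral>e. real (half_length e) \<partial>exc_law \<alpha>) = enn2real (\<integral>\<^sup>+ e. of_nat (half_length e) \<partial>exc_law \<alpha>)"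
    unfolding nn[symmetric] by (rule integral_eq_nn_integral[OF m]) simp
  then have \<kappa>: "(\<integral>e. ?g e \<partial>exc_law \<alpha>) = mean_spacing \<alpha>"
    unfolding mean_spacing_eq using ih K.prob_space by (simp add: add.commute)
  \<comment> \<open>An injective \<open>h\<close> extracts a one-sided i.i.d. sequence from the
    two-sided one; it is applied to the excursions on either side of the origin.\<close>
  have lln: "AE \<epsilon> in exc_seq \<alpha>. (\<lambda>n. (\<Sum>i<n. ?g (\<epsilon> (h i))) / n) \<longlonglongrightarrow> mean_spacing \<alpha>"
    if h: "inj h" for h :: "nat \<Rightarrow> int"
  proof -
    have d: "distr (exc_seq \<alpha>) S (\<lambda>\<epsilon> i. \<epsilon> (h i)) = S"
      using distr_PiM_reindex[of UNIV "\<lambda>_::int. exc_law \<alpha>" h UNIV] h prob_space_exc_law[OF A]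
      by (simp add: restrict_def)
    have mh: "(\<lambda>\<epsilon> i. \<epsilon> (h i)) \<in> measurable (exc_seq \<alpha>) S"
      by (rule measurable_PiM_single'[where f = "\<lambda>i \<epsilon>. \<epsilon> (h i)"]) (auto simp: space_PiM)
    have "AE \<omega> in distr (exc_seq \<alpha>) S (\<lambda>\<epsilon> i. \<epsilon> (h i)). (\<lambda>n. (\<Sum>i<n. ?g (\<omega> i)) / n) \<longlonglongrightarrow> mean_spacing \<alpha>"
      unfolding d using strong_law_of_large_numbers[OF ig] unfolding \<kappa> .
    then show ?thesis by (rule AE_distrD[OF mh])
  qed
  have "AE \<epsilon> in exc_seq \<alpha>. (\<lambda>n. (\<Sum>i<n. ?g (\<epsilon> (int i))) / n) \<longlonglongrightarrow> mean_spacing \<alpha>"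
    by (rule lln) (simp add: inj_def)
  moreover have "AE \<epsilon> in exc_seq \<alpha>. (\<lambda>n. (\<Sum>i<n. ?g (\<epsilon> (- 1 - int i))) / n) \<longlonglongrightarrow> mean_spacing \<alpha>"
    by (rule lln) (simp add: inj_def)
  ultimately show ?thesis
    using AE_space
  proof eventually_elim
    case (elim \<epsilon>)
    then show ?case unfolding ball_density_def
      by (intro density_config_of mean_record_distance_eq(2)[OF assms]) (simp_all add: space_exc_seq)
  qed
qed

lemma AE_mu_hat_density:
  assumes "\<alpha> \<in> A_plus"
  shows "AE \<eta> in mu_hat \<alpha>. \<eta> \<in> density_class_hat (ball_density \<alpha>)"
  by (rule AE_mu_hat[OF _ AE_density_config_of[OF assms]]) (use sets_density_class_hat in simp)

lemma AE_Palm_inv_density: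
  assumes "\<alpha> \<in> A_plus"
  shows "AE \<eta> in Palm_inv (mu_hat \<alpha>). \<eta> \<in> density_class (ball_density \<alpha>)"
proof (rule AE_Palm_inv[OF sets_mu_hat sets_density_class])
  show "AE \<eta> in mu_hat \<alpha>. \<forall>z. shift z \<eta> \<in> density_class (ball_density \<alpha>)"
    using AE_mu_hat_density[OF assms]
    by eventually_elim (simp add: density_class_shift density_class_hat_def)
qed

lemma ball_density_bounds: assumes "\<alpha> \<in> A_plus" shows "ball_density \<alpha> \<in> {0..<1/2}"
  using mean_record_distance_eq(2)[OF assms] by (auto simp: ball_density_def field_simps)

section \<open>Sequences of independent words\<close>

text \<open>Under the height conditions the words remain independent but are no longer identically
  distributed, hence a list of laws.\<close>

fun seq_pmf :: "'a pmf list \<Rightarrow> 'a list pmf" where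
  "seq_pmf [] = return_pmf []"
| "seq_pmf (p # ps) = map_pmf (\<lambda>(x, xs). x # xs) (pair_pmf p (seq_pmf ps))"

lemma pmf_seq_Cons: "pmf (seq_pmf (p # ps)) (x # xs) = pmf p x * pmf (seq_pmf ps) xs"
proof -
  have "inj (\<lambda>(x, xs). x # xs)" by (auto simp: inj_def)
  from pmf_map_inj'[OF this, of "pair_pmf p (seq_pmf ps)" "(x, xs)"] show ?thesis by (simp add: pmf_pair)
qed

lemma length_seq_pmf: "xs \<in> set_pmf (seq_pmf ps) \<Longrightarrow> length xs = length ps"
  by (induction ps arbitrary: xs) auto

lemma pmf_seq:
  "length xs = length ps \<Longrightarrow> pmf (seq_pmf ps) xs = (\<Prod>i<length ps. pmf (ps ! i) (xs ! i))"
proof (induction ps arbitrary: xs)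
  case (Cons p ps)
  then obtain x xs' where xs: "xs = x # xs'" by (cases xs) auto
  show ?case
    unfolding xs pmf_seq_Cons length_Cons prod.lessThan_Suc_shift using Cons xs by simp
qed simp

lemma map_take_seq_pmf: "map_pmf (take m) (seq_pmf ps) = seq_pmf (take m ps)"
proof (induction ps arbitrary: m)
  case (Cons p ps)
  show ?case
  proof (cases m)
    case (Suc m')
    have "map_pmf (take (Suc m')) (seq_pmf (p # ps)) = map_pmf (\<lambda>(x, xs). x # xs) (pair_pmf p (map_pmf (take m') (seq_pmf ps)))"
      by (simp add: map_pmf_comp pair_map_pmf2 case_prod_unfold)
    with Cons Suc show ?thesis by simp
  qed (simp add: map_pmf_const)
qed simp

lemma map_drop_seq_pmf: "map_pmf (drop m) (seq_pmf ps) = seq_pmf (drop m ps)"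
proof (induction ps arbitrary: m)
  case (Cons p ps)
  show ?case
  proof (cases m)
    case (Suc m')
    have "map_pmf (drop (Suc m')) (seq_pmf (p # ps)) = map_pmf (drop m') (map_pmf snd (pair_pmf p (seq_pmf ps)))"
      by (simp add: map_pmf_comp case_prod_unfold)
    with Cons Suc show ?thesis by (simp add: map_snd_pair_pmf)
  qed (simp add: map_pmf_ident)
qed simp

lemma map_hd_seq_pmf: "map_pmf hd (seq_pmf (p # ps)) = p"
proof -
  have "map_pmf hd (seq_pmf (p # ps)) = map_pmf fst (pair_pmf p (seq_pmf ps))"
    by (simp add: map_pmf_comp case_prod_unfold)
  then show ?thesis by (simp add: map_fst_pair_pmf)
qed

text \<open>Applied to \<open>l + 1\<close> words only, so the power of \<open>C\<close> does not
  grow with the number of excursions.\<close>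

lemma pmf_seq_le:
  assumes "list_all2 (\<lambda>p q. \<forall>x. pmf p x \<le> C * pmf q x) ps qs" "0 \<le> C"
  shows "pmf (seq_pmf ps) xs \<le> C ^ length ps * pmf (seq_pmf qs) xs"
  using assms(1)
proof (induction ps qs arbitrary: xs rule: list_all2_induct)
  case (Cons p ps q qs)
  show ?case
  proof (cases xs)
    case Nil
    then have "xs \<notin> set_pmf (seq_pmf (p # ps))" using length_seq_pmf by force
    then have "pmf (seq_pmf (p # ps)) xs = 0" by (simp only: pmf_eq_0_set_pmf not_False_eq_True)
    then show ?thesis using assms(2) by simp
  next
    case (Cons x xs')
    have "pmf p x * pmf (seq_pmf ps) xs' \<le> (C * pmf q x) * (C ^ length ps * pmf (seq_pmf qs) xs')"
      using Cons.hyps Cons.IH assms(2) by (intro mult_mono) auto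
    with Cons show ?thesis by (simp add: pmf_seq_Cons mult_ac del: seq_pmf.simps)
  qed
qed simp

lemma pmf_seq_ge:
  assumes "list_all2 (\<lambda>p q. \<forall>x\<in>A. pmf q x \<le> pmf p x) ps qs" "set xs \<subseteq> A"
  shows "pmf (seq_pmf qs) xs \<le> pmf (seq_pmf ps) xs"
  using assms
proof (induction ps qs arbitrary: xs rule: list_all2_induct)
  case (Cons p ps q qs)
  show ?case
  proof (cases xs)
    case Nil
    then have "xs \<notin> set_pmf (seq_pmf (q # qs))" using length_seq_pmf by force
    then have "pmf (seq_pmf (q # qs)) xs = 0" by (simp only: pmf_eq_0_set_pmf not_False_eq_True)
    then show ?thesis by simp
  next
    case (Cons x xs')
    have "pmf q x * pmf (seq_pmf qs) xs' \<le> pmf p x * pmf (seq_pmf ps) xs'"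
      using Cons.hyps Cons.IH[of xs'] Cons.prems Cons by (intro mult_mono) auto
    with Cons show ?thesis by (simp add: pmf_seq_Cons del: seq_pmf.simps)
  qed
qed simp

section \<open>Counting windows\<close>

text \<open>\<open>Q\<close> is evaluated on the window of length \<open>l\<close>, truncated at the end of the word, at every position.\<close>

definition windows :: "(bool list \<Rightarrow> bool) \<Rightarrow> nat \<Rightarrow> bool list \<Rightarrow> nat" where
  "windows Q l x = card {i. i < length x \<and> Q (take l (drop i x))}"

text \<open>The separator behind the first word is a starting position too, hence
  \<open>\<le>\<close>; so \<open>windows\<close> becomes a sum of these counts over all words
  (\<open>windows_cat\<close>).\<close>

definition first_windows :: "(bool list \<Rightarrow> bool) \<Rightarrow> nat \<Rightarrow> bool list list \<Rightarrow> nat" where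
  "first_windows Q l ws = card {i. i \<le> length (hd ws) \<and> Q (take l (drop i (cat ws)))}"

lemma windows_cat_Cons: "windows Q l (cat (w # ws)) = first_windows Q l (w # ws) + windows Q l (cat ws)"
proof -
  let ?x = "cat (w # ws)"
  have "{i. i < length ?x \<and> Q (take l (drop i ?x))} = {i. i \<le> length w \<and> Q (take l (drop i ?x))}
    \<union> (\<lambda>i. i + Suc (length w)) ` {i. i < length (cat ws) \<and> Q (take l (drop i (cat ws)))}" (is "?L = ?A \<union> ?g ` ?B")
  proof (intro equalityI subsetI)
    fix i assume i: "i \<in> ?L"
    show "i \<in> ?A \<union> ?g ` ?B"
    proof (cases "i \<le> length w")
      case False
      then obtain j where j: "i = j + Suc (length w)" by (metis add.commute le_add_diff_inverse not_less_eq_eq)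
      with i have "j \<in> ?B" by auto
      with j show ?thesis by blast
    qed (use i in auto)
  qed auto
  moreover have "card (?A \<union> ?g ` ?B) = card ?A + card (?g ` ?B)"
    by (rule card_Un_disjoint) (auto intro: finite_subset[of _ "{..length w}"])
  moreover have "card (?g ` ?B) = card ?B" by (rule card_image) (simp add: inj_on_def)
  ultimately show ?thesis by (simp add: windows_def first_windows_def)
qed

lemma windows_cat: "windows Q l (cat ws) = (\<Sum>j<length ws. first_windows Q l (drop j ws))"
proof (induction ws)
  case (Cons w ws)
  then show ?case by (simp only: windows_cat_Cons length_Cons sum.lessThan_Suc_shift) simp
qed (simp add: windows_def)

lemma length_cat_ge: "length ws \<le> length (cat ws)"
  by (induction ws) auto

text \<open>Every word brings a separator, so a window of length \<open>l\<close> that starts in the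
  first word or its separator ends at most \<open>l\<close> words later.\<close>

lemma first_windows_take: "first_windows Q l (take (Suc l) ws) = first_windows Q l ws"
proof (cases ws)
  case (Cons w ws')
  show ?thesis
  proof (cases "length ws' \<le> l")
    case False
    have "take l (drop i (cat (w # ws'))) = take l (drop i (cat (w # take l ws')))" if "i \<le> length w" for i
    proof -
      have "cat (w # ws') = cat (w # take l ws') @ cat (drop l ws')"
        by (simp flip: cat_append)
      moreover have "i + l \<le> length (cat (w # take l ws'))"
        using length_cat_ge[of "take l ws'"] that False by simp
      ultimately show ?thesis by (simp del: cat_simps)
    qed
    then show ?thesis using Cons by (auto simp: first_windows_def simp del: cat_simps intro!: arg_cong[where f = card])
  qed (use Cons in simp)
qed simp

lemma first_windows_le: "first_windows Q l ws \<le> Suc (length (hd ws))"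
proof -
  have "card {i. i \<le> length (hd ws) \<and> Q (take l (drop i (cat ws)))} \<le> card {..length (hd ws)}"
    by (rule card_mono) auto
  then show ?thesis by (simp add: first_windows_def)
qed

text \<open>By linearity only the joint laws of \<open>l + 1\<close> consecutive words matter. The
  length-preserving map \<open>c\<close> will be the identity or complementation.\<close>

lemma nn_integral_windows:
  assumes c: "\<And>w. length (c w) = length w"
  shows "(\<integral>\<^sup>+ ws. of_nat (windows Q l (cat (map c ws))) \<partial>seq_pmf ps)
    = (\<Sum>j<length ps. \<integral>\<^sup>+ ws. of_nat (first_windows Q l (map c ws)) \<partial>seq_pmf (take (Suc l) (drop j ps)))"
proof -
  have "(\<integral>\<^sup>+ ws. of_nat (windows Q l (cat (map c ws))) \<partial>seq_pmf ps)
    = (\<integral>\<^sup>+ ws. (\<Sum>j<length ps. of_nat (first_windows Q l (map c (take (Suc l) (drop j ws))))) \<partial>seq_pmf ps)"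
    by (rule nn_integral_cong_AE)
       (auto simp: AE_measure_pmf_iff windows_cat length_seq_pmf drop_map take_map[symmetric] first_windows_take)
  also have "\<dots> = (\<Sum>j<length ps. \<integral>\<^sup>+ ws. of_nat (first_windows Q l (map c (take (Suc l) (drop j ws)))) \<partial>seq_pmf ps)"
    by (rule nn_integral_sum) simp
  also have "\<dots> = (\<Sum>j<length ps. \<integral>\<^sup>+ ws. of_nat (first_windows Q l (map c ws)) \<partial>seq_pmf (take (Suc l) (drop j ps)))"
    by (simp flip: map_take_seq_pmf map_drop_seq_pmf)
  finally show ?thesis .
qed

section \<open>Words conditioned on their height\<close>

definition low_law :: "(nat \<Rightarrow> real) \<Rightarrow> nat \<Rightarrow> bool list pmf" where
  "low_law \<alpha> h = cond_pmf (word_law \<alpha>) {w. below h w}"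

definition low_prob :: "(nat \<Rightarrow> real) \<Rightarrow> nat \<Rightarrow> real" where
  "low_prob \<alpha> h = measure (measure_pmf (word_law \<alpha>)) {w. below h w}"

lemma below_Nil: "below h []"
  by (simp add: below_def)

lemma below_mono: "below h w \<Longrightarrow> h \<le> h' \<Longrightarrow> below h' w"
  unfolding below_def by (meson of_nat_le_iff order_trans)

lemma below_length: "below (length w) w"
proof -
  have "level (take i w) \<le> int (length w)" for i
  proof -
    have "count_list (take i w) True \<le> length (take i w)" "length (take i w) \<le> length w"
      by (rule count_le_length) simp
    with level_count[of "take i w"] show ?thesis by linarith
  qed
  then show ?thesis by (simp add: below_def)
qed

lemma Nil_in_word_law: assumes "\<alpha> \<in> A_set" shows "[] \<in> set_pmf (word_law \<alpha>)"
proof -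
  show ?thesis using partition_fun_pos[OF assms] by (simp add: set_pmf_iff pmf_word_law[OF assms])
qed

lemma pmf_low_law:
  assumes "\<alpha> \<in> A_set"
  shows "pmf (low_law \<alpha> h) w = (if below h w then pmf (word_law \<alpha>) w / low_prob \<alpha> h else 0)"
proof -
  have "set_pmf (word_law \<alpha>) \<inter> {w. below h w} \<noteq> {}" using Nil_in_word_law[OF assms] below_Nil by blast
  then show ?thesis by (simp add: low_law_def low_prob_def pmf_cond)
qed

lemma low_prob_mono: "h \<le> h' \<Longrightarrow> low_prob \<alpha> h \<le> low_prob \<alpha> h'"
  unfolding low_prob_def by (rule measure_pmf.finite_measure_mono) (auto intro: below_mono)

lemma low_prob_le_1: "low_prob \<alpha> h \<le> 1"
  by (simp add: low_prob_def)

lemma low_prob_pos: assumes "\<alpha> \<in> A_set" shows "0 < low_prob \<alpha> h"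
proof -
  have "0 < pmf (word_law \<alpha>) []" using Nil_in_word_law[OF assms] by (simp add: pmf_positive_iff)
  also have "pmf (word_law \<alpha>) [] \<le> low_prob \<alpha> h"
    unfolding low_prob_def by (subst pmf.rep_eq) (rule measure_pmf.finite_measure_mono, auto simp: below_Nil)
  finally show ?thesis .
qed

text \<open>Every word has a finite height, so the increasing events exhaust the whole
  space.\<close>

lemma low_prob_tendsto: "(\<lambda>h. low_prob \<alpha> h) \<longlonglongrightarrow> 1"
proof -
  have "w \<in> (\<Union>h. {w. below h w})" for w using below_length[of w] by blast
  then have U: "(\<Union>h. {w. below h w}) = UNIV" by blast
  have "(\<lambda>h. measure (measure_pmf (word_law \<alpha>)) {w. below h w}) \<longlonglongrightarrow> measure (measure_pmf (word_law \<alpha>)) (\<Union>h. {w. below h w})"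
    by (rule measure_pmf.finite_Lim_measure_incseq) (auto simp: incseq_def intro: below_mono)
  then show ?thesis unfolding U low_prob_def by simp
qed

lemma prod_list_nth: "prod_list (map f xs) = (\<Prod>i<length xs. f (xs ! i) :: real)"
  by (induction xs) (simp_all only: list.map prod_list.Nil prod_list.Cons length_Cons
    prod.lessThan_Suc_shift nth_Cons_0 nth_Cons_Suc, simp)

lemma pmf_word_law_prod:
  assumes "\<alpha> \<in> A_set" "\<forall>w\<in>set ws. dyck w"
  shows "(\<Prod>i<length ws. pmf (word_law \<alpha>) (ws ! i))
    = (\<Prod>w\<leftarrow>ws. word_weight \<alpha> w) / enn2real (partition_fun \<alpha>) ^ length ws"
  unfolding prod_list_nth using assms
  by (simp add: pmf_word_law prod_dividef)

text \<open>Both laws give each admissible sequence its total weight times a constant. The constants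
  agree, because each of the bounds 0 to \<open>n - 1\<close> occurs once on either side, and
  \<open>evolve\<close> is a bijection that preserves total weights.\<close>

lemma map_evolve_seq_pmf:
  assumes \<alpha>: "\<alpha> \<in> A_set" and n: "0 < n"
  shows "map_pmf evolve (seq_pmf (map (\<lambda>j. low_law \<alpha> (n - 1 - j)) [0..<n])) = seq_pmf (map (low_law \<alpha>) [0..<n])"
      (is "map_pmf _ ?F = ?R")
    and "set_pmf (seq_pmf (map (\<lambda>j. low_law \<alpha> (n - 1 - j)) [0..<n])) \<subseteq> falling n"
proof -
  define C where "C = (\<Prod>j<n. low_prob \<alpha> j)"
  have C': "(\<Prod>j<n. low_prob \<alpha> (n - 1 - j)) = C"
    unfolding C_def by (rule prod.reindex_bij_witness[of _ "\<lambda>j. n - 1 - j" "\<lambda>j. n - 1 - j"]) auto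
  have dyck0: "pmf (word_law \<alpha>) w = 0" if "\<not> dyck w" for w using that by (simp add: pmf_word_law[OF \<alpha>])
  define W where "W ws = (\<Prod>w\<leftarrow>ws. word_weight \<alpha> w) / enn2real (partition_fun \<alpha>) ^ n / C" for ws
  have pmf_gen: "pmf (seq_pmf (map (\<lambda>j. low_law \<alpha> (g j)) [0..<n])) ws =
      (if length ws = n \<and> (\<forall>w\<in>set ws. dyck w) \<and> (\<forall>j<n. below (g j) (ws ! j)) then W ws else 0)"
    if g: "(\<Prod>j<n. low_prob \<alpha> (g j)) = C" for g ws
  proof (cases "length ws = n")
    case True
    have "pmf (seq_pmf (map (\<lambda>j. low_law \<alpha> (g j)) [0..<n])) ws
      = (\<Prod>i<n. if below (g i) (ws ! i) then pmf (word_law \<alpha>) (ws ! i) / low_prob \<alpha> (g i) else 0)"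
      using True by (subst pmf_seq) (simp_all add: pmf_low_law[OF \<alpha>])
    also have "\<dots> = (if (\<forall>w\<in>set ws. dyck w) \<and> (\<forall>j<n. below (g j) (ws ! j)) then W ws else 0)"
    proof (cases "(\<forall>w\<in>set ws. dyck w) \<and> (\<forall>j<n. below (g j) (ws ! j))")
      case good: True
      then have "(\<Prod>i<n. if below (g i) (ws ! i) then pmf (word_law \<alpha>) (ws ! i) / low_prob \<alpha> (g i) else 0)
        = (\<Prod>i<length ws. pmf (word_law \<alpha>) (ws ! i)) / C"
        using True by (simp add: prod_dividef g)
      with good show ?thesis using pmf_word_law_prod[OF \<alpha>, of ws] True by (simp add: W_def)
    next
      case False
      then have "\<exists>i<n. \<not> dyck (ws ! i) \<or> \<not> below (g i) (ws ! i)"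
        using True by (auto simp: in_set_conv_nth)
      then have "(\<Prod>i<n. if below (g i) (ws ! i) then pmf (word_law \<alpha>) (ws ! i) / low_prob \<alpha> (g i) else 0) = 0"
        using dyck0 by (intro prod_zero) auto
      then show ?thesis unfolding if_not_P[OF False] .
    qed
    finally show ?thesis using True by simp
  next
    case False
    then have "ws \<notin> set_pmf (seq_pmf (map (\<lambda>j. low_law \<alpha> (g j)) [0..<n]))" using length_seq_pmf by force
    with False show ?thesis by (simp add: pmf_eq_0_set_pmf)
  qed
  have F: "pmf ?F ws = (if ws \<in> falling n then W ws else 0)" for ws
    using pmf_gen[OF C'] by (simp add: falling_def)
  have R: "pmf ?R ws = (if ws \<in> rising n then W ws else 0)" for ws
    using pmf_gen[OF C_def[symmetric]] by (simp add: rising_def)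
  show sub: "set_pmf ?F \<subseteq> falling n" using F by (auto simp: set_pmf_iff split: if_splits)
  have bij: "bij_betw evolve (falling n) (rising n)" by (rule bij_betw_evolve[OF n])
  have W: "W (evolve ws) = W ws" if "ws \<in> falling n" for ws
    using prod_word_weight_evolve[OF that] by (simp add: W_def)
  show "map_pmf evolve ?F = ?R"
  proof (rule pmf_eqI)
    fix vs
    show "pmf (map_pmf evolve ?F) vs = pmf ?R vs"
    proof (cases "vs \<in> evolve ` set_pmf ?F")
      case True
      then obtain ws where ws: "ws \<in> set_pmf ?F" "vs = evolve ws" by blast
      have "inj_on evolve (set_pmf ?F)" using bij sub by (meson bij_betw_def inj_on_subset)
      then have "pmf (map_pmf evolve ?F) vs = pmf ?F ws" using ws by (simp add: pmf_map_inj)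
      also have "\<dots> = pmf ?R vs"
        using ws sub F R W bij_betwE[OF bij] by auto
      finally show ?thesis .
    next
      case False
      have "pmf ?R vs = 0"
      proof (rule ccontr)
        assume nz: "pmf ?R vs \<noteq> 0"
        then have vs: "vs \<in> rising n" "W vs \<noteq> 0" using R by (auto split: if_splits)
        then obtain ws where ws: "ws \<in> falling n" "vs = evolve ws" using bij by (auto simp: bij_betw_def)
        then have "pmf ?F ws \<noteq> 0" using F W vs by simp
        then have "ws \<in> set_pmf ?F" by (simp add: set_pmf_iff)
        with ws False show False by blast
      qed
      with False show ?thesis by (simp add: pmf_map_outside)
    qed
  qed
qed

section \<open>Invariance under the dynamics\<close>

lemma distr_exc_law_steps:
  assumes "\<alpha> \<in> A_set"
  shows "distr (exc_law \<alpha>) (count_space UNIV) steps = measure_pmf (word_law \<alpha>)"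
proof (rule measure_eqI_countable[of _ UNIV])
  fix w
  have m: "steps \<in> measurable (exc_law \<alpha>) (count_space UNIV)"
    by (simp add: measurable_exc_law)
  have "steps -` {w} \<inter> space (exc_law \<alpha>) = {e \<in> excursions. steps e = w}" by auto
  then show "emeasure (distr (exc_law \<alpha>) (count_space UNIV) steps) {w} = emeasure (measure_pmf (word_law \<alpha>)) {w}"
    by (simp add: emeasure_distr[OF m] emeasure_exc_law_steps[OF assms] emeasure_pmf_single)
qed simp_all

definition first_words :: "nat \<Rightarrow> (int \<Rightarrow> int list) \<Rightarrow> bool list list" where
  "first_words m \<epsilon> = map (\<lambda>j. steps (\<epsilon> (int j))) [0..<m]"

lemma length_first_words [simp]: "length (first_words m \<epsilon>) = m"
  by (simp add: first_words_def)

lemma measurable_first_words [measurable]: "first_words m \<in> measurable (exc_seq \<alpha>) (count_space UNIV)"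
proof (induction m)
  case (Suc m)
  have "(\<lambda>\<epsilon>. first_words m \<epsilon> @ [steps (\<epsilon> (int m))]) \<in> measurable (exc_seq \<alpha>) (count_space UNIV)"
    by (rule measurable_discrete_binop[OF Suc measurable_exc_coordinate])
  moreover have "first_words (Suc m) = (\<lambda>\<epsilon>. first_words m \<epsilon> @ [steps (\<epsilon> (int m))])"
    by (rule ext) (simp add: first_words_def)
  ultimately show ?case by (simp only:)
next
  case 0
  have "first_words 0 = (\<lambda>\<epsilon>. [])" by (rule ext) (simp add: first_words_def)
  then show ?case by (simp only: measurable_const space_count_space UNIV_I)
qed

lemma distr_first_words:
  assumes "\<alpha> \<in> A_set"
  shows "distr (exc_seq \<alpha>) (count_space UNIV) (first_words m) = measure_pmf (seq_pmf (replicate m (word_law \<alpha>)))"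
proof (rule measure_eqI_countable[of _ UNIV])
  fix ws :: "bool list list"
  interpret K: prob_space "exc_law \<alpha>" by (rule prob_space_exc_law[OF assms])
  interpret product_prob_space "\<lambda>_::int. exc_law \<alpha>" UNIV ..
  have d: "emeasure (distr (exc_seq \<alpha>) (count_space UNIV) (first_words m)) {ws}
    = emeasure (exc_seq \<alpha>) (first_words m -` {ws} \<inter> space (exc_seq \<alpha>))"
    by (rule emeasure_distr[OF measurable_first_words]) simp
  show "emeasure (distr (exc_seq \<alpha>) (count_space UNIV) (first_words m)) {ws}
    = emeasure (measure_pmf (seq_pmf (replicate m (word_law \<alpha>)))) {ws}"
  proof (cases "length ws = m")
    case True
    have "first_words m -` {ws} \<inter> space (exc_seq \<alpha>)
      = {x \<in> space (exc_seq \<alpha>). \<forall>i\<in>int ` {..<m}. x i \<in> {e \<in> excursions. steps e = ws ! nat i}}"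
    proof -
      have "first_words m x = ws \<longleftrightarrow> (\<forall>i<m. steps (x (int i)) = ws ! i)" for x
        using True by (simp add: first_words_def list_eq_iff_nth_eq)
      then show ?thesis by (auto simp: space_exc_seq)
    qed
    also have "emeasure (exc_seq \<alpha>) \<dots> = (\<Prod>i\<in>int ` {..<m}. emeasure (exc_law \<alpha>) {e \<in> excursions. steps e = ws ! nat i})"
      by (rule emeasure_PiM_Collect) auto
    also have "\<dots> = (\<Prod>i<m. ennreal (pmf (word_law \<alpha>) (ws ! i)))"
      by (subst prod.reindex) (simp_all add: emeasure_exc_law_steps[OF assms])
    also have "\<dots> = ennreal (pmf (seq_pmf (replicate m (word_law \<alpha>))) ws)"
      using True by (subst pmf_seq) (simp_all add: prod_ennreal)
    finally show ?thesis unfolding d by (simp add: emeasure_pmf_single)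
  next
    case False
    then have "first_words m -` {ws} \<inter> space (exc_seq \<alpha>) = {}" by auto
    moreover have "ws \<notin> set_pmf (seq_pmf (replicate m (word_law \<alpha>)))" using False length_seq_pmf by force
    ultimately show ?thesis unfolding d by (simp add: emeasure_pmf_single pmf_eq_0_set_pmf)
  qed
qed simp_all

lemma nn_integral_first_words:
  assumes "\<alpha> \<in> A_set"
  shows "(\<integral>\<^sup>+ \<epsilon>. f (first_words m \<epsilon>) \<partial>exc_seq \<alpha>) = (\<integral>\<^sup>+ ws. f ws \<partial>seq_pmf (replicate m (word_law \<alpha>)))"
  unfolding distr_first_words[OF assms, symmetric]
  by (rule nn_integral_distr[symmetric]) simp_all

text \<open>The configuration and the positions of its separators are arbitrary, as the lemma serves
  both a configuration and its image under \<open>BBS\<close>. Letter \<open>i\<close> sits in box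
  \<open>i + 1\<close> because box 0 is the record at the origin.\<close>

lemma nth_cat:
  assumes "b 0 = 0" "\<And>j. j < length ws \<Longrightarrow> b (Suc j) = b j + int (length (ws ! j)) + 1"
    "\<And>j x. j < length ws \<Longrightarrow> x < length (ws ! j) \<Longrightarrow> \<zeta> (b j + 1 + int x) = ws ! j ! x"
    "\<And>j. j < length ws \<Longrightarrow> \<not> \<zeta> (b (Suc j))"
  shows "b (length ws) = int (length (cat ws)) \<and> (\<forall>i<length (cat ws). \<zeta> (1 + int i) = cat ws ! i)"
  using assms(2-4)
proof (induction ws rule: rev_induct)
  case Nil
  with assms(1) show ?case by simp
next
  case (snoc w ws)
  have IH: "b (length ws) = int (length (cat ws))" "\<And>i. i < length (cat ws) \<Longrightarrow> \<zeta> (1 + int i) = cat ws ! i"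
  proof -
    have "b (length ws) = int (length (cat ws)) \<and> (\<forall>i<length (cat ws). \<zeta> (1 + int i) = cat ws ! i)"
    proof (rule snoc.IH)
      fix j assume j: "j < length ws"
      then have nth: "(ws @ [w]) ! j = ws ! j" and j': "j < length (ws @ [w])" by (simp_all add: nth_append)
      show "b (Suc j) = b j + int (length (ws ! j)) + 1" using snoc.prems(1)[OF j'] unfolding nth .
      show "\<not> \<zeta> (b (Suc j))" using snoc.prems(3)[OF j'] .
      show "\<zeta> (b j + 1 + int x) = ws ! j ! x" if "x < length (ws ! j)" for x
        using snoc.prems(2)[OF j', of x] that unfolding nth .
    qed
    then show "b (length ws) = int (length (cat ws))" "\<And>i. i < length (cat ws) \<Longrightarrow> \<zeta> (1 + int i) = cat ws ! i" by auto
  qed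
  have last: "(ws @ [w]) ! length ws = w" "length ws < length (ws @ [w])" by simp_all
  have b: "b (Suc (length ws)) = int (length (cat ws)) + int (length w) + 1"
    using snoc.prems(1)[OF last(2)] unfolding last(1) IH(1) .
  have "\<zeta> (1 + int i) = cat (ws @ [w]) ! i" if "i < length (cat (ws @ [w]))" for i
  proof -
    have "i < length (cat ws) + Suc (length w)" using that by simp
    then consider "i < length (cat ws)" | x where "i = length (cat ws) + x" "x < length w"
      | "i = length (cat ws) + length w"
    proof -
      assume "i < length (cat ws) + Suc (length w)"
      then have "i < length (cat ws) \<or> (\<exists>x. i = length (cat ws) + x \<and> x < length w) \<or> i = length (cat ws) + length w"
        by presburger
      then show ?thesis using that by blast
    qed
    then show ?thesis
    proof cases
      case 1
      with IH(2) show ?thesis by (simp add: nth_append)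
    next
      case 2
      then have "\<zeta> (1 + int i) = w ! x"
        using snoc.prems(2)[OF last(2), of x] unfolding last(1) IH(1) by (simp add: add_ac)
      with 2 show ?thesis by (simp add: nth_append)
    next
      case 3
      then have "1 + int i = b (Suc (length ws))" using b by simp
      with snoc.prems(3)[OF last(2)] 3 show ?thesis by (simp add: nth_append)
    qed
  qed
  then show ?case using b by simp
qed

text \<open>The dynamics complements the boxes that are not records and leaves the records empty, so
  the separators survive as boxes even where they cease to be records.\<close>

lemma config_of_cat:
  assumes \<epsilon>: "\<forall>i. \<epsilon> i \<in> excursions"
  shows "i < length (cat (first_words m \<epsilon>)) \<Longrightarrow> config_of \<epsilon> (1 + int i) = cat (first_words m \<epsilon>) ! i"
    and "i < length (cat (compl_words (first_words m \<epsilon>))) \<Longrightarrow>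
      BBS (config_of \<epsilon>) (1 + int i) = cat (compl_words (first_words m \<epsilon>)) ! i"
proof -
  let ?b = "\<lambda>j. block_start \<epsilon> (int j)"
  have len: "length (steps (\<epsilon> j)) = 2 * half_length (\<epsilon> j)" for j using \<epsilon> by (simp add: length_steps)
  have b: "?b 0 = 0" "?b (Suc j) = ?b j + 2 * int (half_length (\<epsilon> (int j))) + 1" for j
    using block_start_step[of \<epsilon> "int j"] by (simp_all add: block_start_0 add.commute)
  have inside: "config_of \<epsilon> (?b j + 1 + int x) = steps (\<epsilon> (int j)) ! x"
    "?b j + 1 + int x \<notin> records (config_of \<epsilon>)"
    if "x < 2 * half_length (\<epsilon> (int j))" for j x
  proof -
    have "config_of \<epsilon> (?b j + (1 + int x)) = ball_config (\<epsilon> (int j)) (1 + int x)"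
      by (rule config_of_block) (use that in auto)
    also have "\<dots> = steps (\<epsilon> (int j)) ! x" using that \<epsilon> by (simp add: ball_config_steps)
    finally show "config_of \<epsilon> (?b j + 1 + int x) = steps (\<epsilon> (int j)) ! x" by (simp add: add.assoc)
    show "?b j + 1 + int x \<notin> records (config_of \<epsilon>)"
    proof
      assume "?b j + 1 + int x \<in> records (config_of \<epsilon>)"
      then obtain i where i: "?b j + 1 + int x = block_start \<epsilon> i" unfolding records_config_of[OF \<epsilon>] by blast
      have "block_start \<epsilon> i < block_start \<epsilon> (int j + 1)"
        using that block_start_step[of \<epsilon> "int j"] unfolding i[symmetric] by simp
      then have "i < int j + 1" using block_start_diff[of "int j + 1" i \<epsilon>] by (cases "int j + 1 \<le> i") auto
      then have "i \<le> int j" by simp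
      with block_start_diff[OF this, of \<epsilon>] i show False by simp
    qed
  qed
  have rec: "?b j \<in> records (config_of \<epsilon>)" for j unfolding records_config_of[OF \<epsilon>] by blast
  have "?b (length (first_words m \<epsilon>)) = int (length (cat (first_words m \<epsilon>))) \<and>
    (\<forall>i<length (cat (first_words m \<epsilon>)). config_of \<epsilon> (1 + int i) = cat (first_words m \<epsilon>) ! i)"
  proof (rule nth_cat)
    show "\<not> config_of \<epsilon> (?b (Suc j))" for j by (rule config_of_block_start)
  qed (auto simp: first_words_def len b block_start_0 inside(1) simp del: of_nat_Suc)
  then show "i < length (cat (first_words m \<epsilon>)) \<Longrightarrow> config_of \<epsilon> (1 + int i) = cat (first_words m \<epsilon>) ! i" by blast
  have "?b (length (compl_words (first_words m \<epsilon>))) = int (length (cat (compl_words (first_words m \<epsilon>)))) \<and>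
    (\<forall>i<length (cat (compl_words (first_words m \<epsilon>))).
      BBS (config_of \<epsilon>) (1 + int i) = cat (compl_words (first_words m \<epsilon>)) ! i)"
  proof (rule nth_cat)
    show "\<not> BBS (config_of \<epsilon>) (?b (Suc j))" for j using rec[of "Suc j"] by (simp add: BBS_def)
  qed (auto simp: first_words_def len b block_start_0 inside BBS_def simp del: of_nat_Suc)
  then show "i < length (cat (compl_words (first_words m \<epsilon>))) \<Longrightarrow>
      BBS (config_of \<epsilon>) (1 + int i) = cat (compl_words (first_words m \<epsilon>)) ! i" by blast
qed

definition window :: "nat \<Rightarrow> config \<Rightarrow> bool list" where
  "window l \<eta> = map (\<lambda>i. \<eta> (int i)) [0..<l]"

lemma measurable_window: "window l \<in> measurable config_space (count_space UNIV)"
proof (induction l)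
  case (Suc l)
  have "(\<lambda>\<eta>. window l \<eta> @ [\<eta> (int l)]) \<in> measurable config_space (count_space UNIV)"
    by (rule measurable_discrete_binop[OF Suc measurable_config_coordinate])
  moreover have "window (Suc l) = (\<lambda>\<eta>. window l \<eta> @ [\<eta> (int l)])"
    by (rule ext) (simp add: window_def)
  ultimately show ?case by (simp only:)
next
  case 0
  have "window 0 = (\<lambda>\<eta>. [])" by (rule ext) (simp add: window_def)
  then show ?case by (simp only: measurable_const space_count_space UNIV_I)
qed

lemma sets_window: "{\<eta>. Q (window l \<eta>)} \<in> sets config_space"
  using measurable_sets[OF measurable_window, of "{v. Q v}" l] by (simp add: vimage_def)

text \<open>The boxes from 1 to record 1 are those of the first word and its separator. As
  \<open>G\<close> commutes with shifts, the pattern seen from such a box is a window of the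
  concatenation, and \<open>l + 1\<close> words contain all these windows.\<close>

lemma emeasure_Palm_inv_window:
  assumes \<alpha>: "\<alpha> \<in> A_set" and G: "G \<in> measurable config_space config_space"
    "\<And>y \<eta>. G (shift y \<eta>) = shift y (G \<eta>)"
    and c: "\<And>w. length (c w) = length w"
    "\<And>\<epsilon> i. \<forall>i. \<epsilon> i \<in> excursions \<Longrightarrow> i < length (cat (map c (first_words (Suc l) \<epsilon>))) \<Longrightarrow>
        G (config_of \<epsilon>) (1 + int i) = cat (map c (first_words (Suc l) \<epsilon>)) ! i"
  shows "emeasure (Palm_inv (mu_hat \<alpha>)) {\<eta>. Q (window l (G \<eta>))}
    = (\<integral>\<^sup>+ ws. of_nat (first_windows Q l (map c ws)) \<partial>seq_pmf (replicate (Suc l) (word_law \<alpha>)))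
      / mean_record_distance (mu_hat \<alpha>)"
proof -
  let ?B = "{\<eta>. Q (window l (G \<eta>))}"
  have B: "?B \<in> sets config_space"
    using measurable_sets[OF G(1) sets_window[of Q l]] by (simp add: vimage_def)
  have "(\<Sum>z\<in>{1..record_pos (config_of \<epsilon>) 1}. indicator ?B (shift z (config_of \<epsilon>)))
    = (of_nat (first_windows Q l (map c (first_words (Suc l) \<epsilon>))) :: ennreal)"
    if \<epsilon>: "\<forall>i. \<epsilon> i \<in> excursions" for \<epsilon>
  proof -
    let ?ws = "map c (first_words (Suc l) \<epsilon>)"
    define n where "n = 2 * half_length (\<epsilon> 0)"
    have hd: "length (hd ?ws) = n"
      using \<epsilon> c(1) by (simp add: first_words_def upt_conv_Cons length_steps n_def del: upt_Suc)
    have "length (cat ?ws) = Suc n + length (cat (tl ?ws))"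
      using hd by (cases ?ws) (auto simp: first_words_def)
    then have len: "n + l < length (cat ?ws)"
      using length_cat_ge[of "tl ?ws"] by simp
    have r: "record_pos (config_of \<epsilon>) 1 = int n + 1"
      using record_pos_config_of[OF \<epsilon>] by (simp add: block_start_1 n_def)
    have w: "window l (G (shift (1 + int i) (config_of \<epsilon>))) = take l (drop i (cat ?ws))" if "i \<le> n" for i
    proof (rule nth_equalityI)
      show "length (window l (G (shift (1 + int i) (config_of \<epsilon>)))) = length (take l (drop i (cat ?ws)))"
        using that len by (simp add: window_def)
      fix k assume "k < length (window l (G (shift (1 + int i) (config_of \<epsilon>))))"
      then have k: "k < l" by (simp add: window_def)
      have "window l (G (shift (1 + int i) (config_of \<epsilon>))) ! k = G (config_of \<epsilon>) (int k + (1 + int i))"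
        using k unfolding G(2) by (simp add: window_def shift_def[of "1 + int i"])
      also have "int k + (1 + int i) = 1 + int (i + k)" by simp
      also have "G (config_of \<epsilon>) (1 + int (i + k)) = cat ?ws ! (i + k)"
        by (rule c(2)[OF \<epsilon>]) (use k that len in simp)
      also have "\<dots> = take l (drop i (cat ?ws)) ! k" using k that len by simp
      finally show "window l (G (shift (1 + int i) (config_of \<epsilon>))) ! k = take l (drop i (cat ?ws)) ! k" .
    qed
    have "(\<Sum>z\<in>{1..record_pos (config_of \<epsilon>) 1}. indicator ?B (shift z (config_of \<epsilon>)) :: ennreal)
      = (\<Sum>i\<in>{..n}. indicator ?B (shift (1 + int i) (config_of \<epsilon>)))"
      unfolding r by (rule sum.reindex_bij_witness[of _ "\<lambda>i. 1 + int i" "\<lambda>z. nat (z - 1)"]) auto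
    also have "\<dots> = (\<Sum>i\<in>{..n}. if Q (take l (drop i (cat ?ws))) then 1 else 0)"
      by (intro sum.cong) (simp_all add: w indicator_def)
    also have "\<dots> = of_nat (card {i \<in> {..n}. Q (take l (drop i (cat ?ws)))})"
      by (simp add: sum.If_cases Int_def)
    finally show ?thesis by (simp add: first_windows_def hd)
  qed
  then have "(\<integral>\<^sup>+ \<eta>. (\<Sum>z\<in>{1..record_pos \<eta> 1}. indicator ?B (shift z \<eta>)) \<partial>mu_hat \<alpha>)
    = (\<integral>\<^sup>+ \<epsilon>. of_nat (first_windows Q l (map c (first_words (Suc l) \<epsilon>))) \<partial>exc_seq \<alpha>)"
    by (subst nn_integral_mu_hat, intro measurable_record_sum measurable_indicator_shift B)
       (intro nn_integral_cong, simp add: space_exc_seq)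
  also have "\<dots> = (\<integral>\<^sup>+ ws. of_nat (first_windows Q l (map c ws)) \<partial>seq_pmf (replicate (Suc l) (word_law \<alpha>)))"
    by (rule nn_integral_first_words[OF \<alpha>])
  finally show ?thesis by (simp add: emeasure_Palm_inv[OF sets_mu_hat B])
qed

section \<open>Window statistics with and without height conditions\<close>

lemma nn_integral_pmf_le:
  assumes "\<And>x. pmf p x \<le> C * pmf q x" "0 \<le> C"
  shows "(\<integral>\<^sup>+ x. f x \<partial>measure_pmf p) \<le> ennreal C * (\<integral>\<^sup>+ x. f x \<partial>measure_pmf q)"
proof -
  have "(\<integral>\<^sup>+ x. ennreal (pmf p x) * f x \<partial>count_space UNIV)
    \<le> (\<integral>\<^sup>+ x. ennreal C * (ennreal (pmf q x) * f x) \<partial>count_space UNIV)"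
    using assms by (intro nn_integral_mono)
      (auto simp: mult.assoc[symmetric] ennreal_mult[symmetric] intro!: mult_right_mono ennreal_leI)
  then show ?thesis by (simp add: nn_integral_measure_pmf nn_integral_cmult)
qed

definition mean_windows where
  "mean_windows \<alpha> Q l c = (\<integral>\<^sup>+ ws. of_nat (first_windows Q l (map c ws)) \<partial>seq_pmf (replicate (Suc l) (word_law \<alpha>)))"

text \<open>On words of height at most \<open>H\<close>, conditioning with a bound of at least
  \<open>H\<close> only raises the probabilities (\<open>pmf_low_law_ge\<close>); the truncation
  thus yields lower bounds.\<close>

definition mean_low_windows where
  "mean_low_windows \<alpha> Q l c H = (\<integral>\<^sup>+ ws. of_nat (first_windows Q l (map c ws)) * indicator {ws. \<forall>w\<in>set ws. below H w} ws
     \<partial>seq_pmf (replicate (Suc l) (word_law \<alpha>)))"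

definition mean_length where
  "mean_length \<alpha> = (\<integral>\<^sup>+ w. of_nat (Suc (length w)) \<partial>word_law \<alpha>)"

lemma mean_length_finite:
  assumes "\<alpha> \<in> A_plus"
  shows "mean_length \<alpha> < \<infinity>"
proof -
  have A: "\<alpha> \<in> A_set" and fin: "(\<integral>\<^sup>+ e. of_nat (half_length e) \<partial>exc_law \<alpha>) < \<infinity>"
    using assms by (simp_all add: A_plus_iff)
  interpret K: prob_space "exc_law \<alpha>" by (rule prob_space_exc_law[OF A])
  have m: "f \<in> borel_measurable (exc_law \<alpha>)" for f :: "int list \<Rightarrow> ennreal"
    by (simp add: measurable_exc_law)
  have ms: "steps \<in> measurable (exc_law \<alpha>) (count_space UNIV)"
    by (simp add: measurable_exc_law)
  have "mean_length \<alpha> = (\<integral>\<^sup>+ e. of_nat (Suc (length (steps e))) \<partial>exc_law \<alpha>)"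
    unfolding mean_length_def distr_exc_law_steps[OF A, symmetric] by (rule nn_integral_distr[OF ms]) simp
  also have "\<dots> = (\<integral>\<^sup>+ e. 1 + 2 * of_nat (half_length e) \<partial>exc_law \<alpha>)"
    by (intro nn_integral_cong) (simp add: length_steps)
  also have "\<dots> = 1 + 2 * (\<integral>\<^sup>+ e. of_nat (half_length e) \<partial>exc_law \<alpha>)"
    by (subst nn_integral_add) (simp_all add: m nn_integral_cmult K.emeasure_space_1[simplified])
  finally show ?thesis using fin by (auto simp: ennreal_mult_less_top)
qed

context
  fixes c :: "bool list \<Rightarrow> bool list" and \<alpha> :: "nat \<Rightarrow> real"
  assumes c: "\<And>w. length (c w) = length w" and \<alpha>: "\<alpha> \<in> A_plus"
begin

lemma first_windows_hd_le:
  "ws \<noteq> [] \<Longrightarrow> first_windows Q l (map c ws) \<le> Suc (length (hd ws))"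
  using first_windows_le[of Q l "map c ws"] by (simp add: hd_map c)

lemma nn_integral_first_windows_le:
  "(\<integral>\<^sup>+ ws. of_nat (first_windows Q l (map c ws)) \<partial>seq_pmf (p # ps)) \<le> (\<integral>\<^sup>+ w. of_nat (Suc (length w)) \<partial>p)"
proof -
  have "(\<integral>\<^sup>+ ws. of_nat (first_windows Q l (map c ws)) \<partial>seq_pmf (p # ps))
    \<le> (\<integral>\<^sup>+ ws. of_nat (Suc (length (hd ws))) \<partial>seq_pmf (p # ps))"
  proof (rule nn_integral_mono_AE, unfold AE_measure_pmf_iff, rule ballI)
    fix ws assume "ws \<in> set_pmf (seq_pmf (p # ps))"
    then have "ws \<noteq> []" using length_seq_pmf by force
    then show "of_nat (first_windows Q l (map c ws)) \<le> (of_nat (Suc (length (hd ws))) :: ennreal)"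
      by (intro of_nat_mono first_windows_hd_le)
  qed
  also have "\<dots> = (\<integral>\<^sup>+ w. of_nat (Suc (length w)) \<partial>map_pmf hd (seq_pmf (p # ps)))" by simp
  finally show ?thesis unfolding map_hd_seq_pmf .
qed

lemma mean_windows_finite: "mean_windows \<alpha> Q l c < \<infinity>"
proof -
  have "mean_windows \<alpha> Q l c \<le> mean_length \<alpha>"
    unfolding mean_windows_def mean_length_def replicate_Suc by (rule nn_integral_first_windows_le)
  with mean_length_finite[OF \<alpha>] show ?thesis by simp
qed

lemma pmf_low_law_le: "h \<le> k \<Longrightarrow> pmf (low_law \<alpha> k) w \<le> (1 / low_prob \<alpha> h) * pmf (word_law \<alpha>) w"
  using low_prob_pos[OF A_plus_imp_A_set[OF \<alpha>], of h] low_prob_mono[of h k \<alpha>]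
  by (auto simp: pmf_low_law[OF A_plus_imp_A_set[OF \<alpha>]] intro!: divide_left_mono mult_pos_pos)

lemma pmf_low_law_ge: "below h w \<Longrightarrow> h \<le> k \<Longrightarrow> pmf (word_law \<alpha>) w \<le> pmf (low_law \<alpha> k) w"
  using low_prob_pos[OF A_plus_imp_A_set[OF \<alpha>], of k] low_prob_le_1[of \<alpha> k] below_mono[of h w k]
    mult_left_mono[of "low_prob \<alpha> k" 1 "pmf (word_law \<alpha>) w"]
  by (simp add: pmf_low_law[OF A_plus_imp_A_set[OF \<alpha>]] pos_le_divide_eq)

text \<open>The set \<open>G\<close> holds positions whose \<open>l + 1\<close> words all have
  height bounds of at least \<open>H\<close>, where conditioned and unconditioned laws are
  comparable. Each of the other \<open>B\<close> positions costs a constant independent of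
  \<open>n\<close>, since conditioning raises no probability by more than the factor
  \<open>1 / low_prob \<alpha> 0\<close>.\<close>

lemma windows_bounds:
  fixes Q :: "bool list \<Rightarrow> bool"
  assumes hs: "length hs = n" and G: "G \<subseteq> {..<n}" "card G = n - B" "B \<le> n"
    and good: "\<And>j i. j \<in> G \<Longrightarrow> j \<le> i \<Longrightarrow> i \<le> j + l \<Longrightarrow> i < n \<and> H \<le> hs ! i"
  defines "S \<equiv> (\<integral>\<^sup>+ ws. of_nat (windows Q l (cat (map c ws))) \<partial>seq_pmf (map (low_law \<alpha>) hs))"
  shows "of_nat (n - B) * mean_low_windows \<alpha> Q l c H \<le> S" (is ?lower)
    and "S \<le> of_nat n * (ennreal ((1 / low_prob \<alpha> H) ^ Suc l) * mean_windows \<alpha> Q l c)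
      + of_nat B * (ennreal (1 / low_prob \<alpha> 0) * mean_length \<alpha>)" (is ?upper)
proof -
  define e where "e j = (\<integral>\<^sup>+ ws. of_nat (first_windows Q l (map c ws))
    \<partial>seq_pmf (map (low_law \<alpha>) (take (Suc l) (drop j hs))))" for j
  have S: "S = (\<Sum>j<n. e j)"
    unfolding S_def e_def nn_integral_windows[OF c] by (simp add: hs take_map drop_map)
  let ?K = "ennreal (1 / low_prob \<alpha> 0) * mean_length \<alpha>"
  let ?U = "ennreal ((1 / low_prob \<alpha> H) ^ Suc l) * mean_windows \<alpha> Q l c"
  let ?V = "replicate (Suc l) (word_law \<alpha>)"
  have P: "0 < low_prob \<alpha> h" for h by (rule low_prob_pos[OF A_plus_imp_A_set[OF \<alpha>]])
  have K: "e j \<le> ?K" if "j < n" for j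
  proof -
    have "take (Suc l) (drop j hs) = hs ! j # take l (drop (Suc j) hs)"
      using that hs by (simp add: Cons_nth_drop_Suc[symmetric])
    then have "e j \<le> (\<integral>\<^sup>+ w. of_nat (Suc (length w)) \<partial>low_law \<alpha> (hs ! j))"
      unfolding e_def by (simp only: list.map) (rule nn_integral_first_windows_le)
    also have "\<dots> \<le> ?K"
      unfolding mean_length_def
      by (rule nn_integral_pmf_le) (use pmf_low_law_le[of 0] P[of 0] in auto)
    finally show ?thesis .
  qed
  have U: "e j \<le> ?U" and L: "mean_low_windows \<alpha> Q l c H \<le> e j" if "j \<in> G" for j
  proof -
    have lt: "j + l < n" using good[OF that, of "j + l"] by simp
    let ?hs = "take (Suc l) (drop j hs)"
    have len: "length ?hs = Suc l" using lt hs by simp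
    have ge: "H \<le> h" if h: "h \<in> set ?hs" for h
    proof -
      obtain i where "i < Suc l" "h = hs ! (j + i)" using h len by (auto simp: in_set_conv_nth)
      with good[OF \<open>j \<in> G\<close>, of "j + i"] show ?thesis by simp
    qed
    have "pmf (seq_pmf (map (low_law \<alpha>) ?hs)) ws \<le> (1 / low_prob \<alpha> H) ^ Suc l * pmf (seq_pmf ?V) ws" for ws
    proof -
      have "list_all2 (\<lambda>p q. \<forall>x. pmf p x \<le> (1 / low_prob \<alpha> H) * pmf q x) (map (low_law \<alpha>) ?hs) ?V"
        unfolding list_all2_conv_all_nth
      proof (intro conjI allI impI)
        fix i x assume i: "i < length (map (low_law \<alpha>) ?hs)"
        then have "H \<le> ?hs ! i" by (intro ge nth_mem) simp
        with i len show "pmf (map (low_law \<alpha>) ?hs ! i) x \<le> (1 / low_prob \<alpha> H) * pmf (?V ! i) x"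
          using pmf_low_law_le[of H "?hs ! i" x] by (simp only: nth_map nth_replicate length_map)
      qed (use len in simp)
      from pmf_seq_le[OF this] P[of H] show ?thesis by (simp only: length_map len) simp
    qed
    then show "e j \<le> ?U" unfolding e_def mean_windows_def
      by (rule nn_integral_pmf_le) (use P[of H] in simp)
    have "pmf (seq_pmf ?V) ws \<le> pmf (seq_pmf (map (low_law \<alpha>) ?hs)) ws" if "\<forall>w\<in>set ws. below H w" for ws
    proof (rule pmf_seq_ge)
      show "list_all2 (\<lambda>p q. \<forall>x\<in>{w. below H w}. pmf q x \<le> pmf p x) (map (low_law \<alpha>) ?hs) ?V"
        unfolding list_all2_conv_all_nth
      proof (intro conjI allI impI ballI)
        fix i x assume i: "i < length (map (low_law \<alpha>) ?hs)" and x: "x \<in> {w. below H w}"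
        then have "H \<le> ?hs ! i" by (intro ge nth_mem) simp
        with i x len show "pmf (?V ! i) x \<le> pmf (map (low_law \<alpha>) ?hs ! i) x"
          using pmf_low_law_ge[of H x "?hs ! i"] by (simp only: nth_map nth_replicate length_map mem_Collect_eq)
      qed (use len in simp)
      show "set ws \<subseteq> {w. below H w}" using that by auto
    qed
    then show "mean_low_windows \<alpha> Q l c H \<le> e j"
      unfolding e_def mean_low_windows_def nn_integral_measure_pmf
      by (intro nn_integral_mono) (auto split: split_indicator intro!: mult_right_mono ennreal_leI)
  qed
  have "of_nat (n - B) * mean_low_windows \<alpha> Q l c H = (\<Sum>j\<in>G. mean_low_windows \<alpha> Q l c H)"
    using G by simp
  also have "\<dots> \<le> (\<Sum>j\<in>G. e j)" by (intro sum_mono L)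
  also have "\<dots> \<le> S" unfolding S by (intro sum_mono2 G) auto
  finally show ?lower .
  have fin: "finite G" using G finite_subset by blast
  have "S = (\<Sum>j\<in>G. e j) + (\<Sum>j\<in>{..<n} - G. e j)"
    unfolding S using sum.subset_diff[OF G(1), of e] by (simp add: add.commute)
  also have "\<dots> \<le> (\<Sum>j\<in>G. ?U) + (\<Sum>j\<in>{..<n} - G. ?K)"
    by (intro add_mono sum_mono U K) auto
  also have "\<dots> = of_nat (n - B) * ?U + of_nat B * ?K"
    using G fin by (simp add: card_Diff_subset)
  also have "\<dots> \<le> of_nat n * ?U + of_nat B * ?K"
    by (intro add_mono mult_right_mono of_nat_mono) auto
  finally show ?upper .
qed

text \<open>Every finite list of words lies below some \<open>H\<close>, so the truncation
  disappears by monotone convergence.\<close>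

lemma mean_low_windows_le_imp:
  assumes "\<And>H. mean_low_windows \<alpha> Q l c H \<le> x"
  shows "mean_windows \<alpha> Q l c \<le> x"
proof -
  let ?f = "\<lambda>ws. of_nat (first_windows Q l (map c ws)) :: ennreal"
  have below: "\<exists>H. \<forall>w\<in>set ws. below H w" for ws
  proof (induction ws)
    case (Cons w ws)
    then obtain H where H: "\<forall>w\<in>set ws. below H w" by blast
    with below_length[of w] show ?case by (intro exI[of _ "max H (length w)"]) (auto intro: below_mono)
  qed simp
  have "mean_windows \<alpha> Q l c = (\<integral>\<^sup>+ ws. (SUP H. ?f ws * indicator {ws. \<forall>w\<in>set ws. below H w} ws)
     \<partial>seq_pmf (replicate (Suc l) (word_law \<alpha>)))"
    unfolding mean_windows_def
  proof (rule nn_integral_cong)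
    fix ws
    obtain H where "\<forall>w\<in>set ws. below H w" using below by blast
    then show "?f ws = (SUP H. ?f ws * indicator {ws. \<forall>w\<in>set ws. below H w} ws)"
      by (intro antisym SUP_upper2[of H] SUP_least) (auto split: split_indicator)
  qed
  also have "\<dots> = (SUP H. mean_low_windows \<alpha> Q l c H)"
    unfolding mean_low_windows_def
    by (rule nn_integral_monotone_convergence_SUP)
       (auto simp: incseq_def le_fun_def intro: below_mono split: split_indicator)
  also have "\<dots> \<le> x" by (rule SUP_least) (rule assms)
  finally show ?thesis .
qed

lemma mean_low_windows_mono: "H \<le> H' \<Longrightarrow> mean_low_windows \<alpha> Q l c H \<le> mean_low_windows \<alpha> Q l c H'"
  unfolding mean_low_windows_def
  by (intro nn_integral_mono) (auto intro: below_mono split: split_indicator)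

end

text \<open>The terms with \<open>B\<close> and \<open>K\<close> are boundary terms, which vanish
  upon division by \<open>n\<close>.\<close>

lemma ennreal_le_by_averages:
  fixes S :: "nat \<Rightarrow> ennreal"
  assumes "\<And>n. B < n \<Longrightarrow> of_nat (n - B) * x \<le> S n" "\<And>n. B < n \<Longrightarrow> S n \<le> of_nat n * y + of_nat B * K"
    and "y < \<infinity>" "K < \<infinity>"
  shows "x \<le> y"
proof -
  have le: "of_nat m * x \<le> of_nat (m + B) * y + of_nat B * K" if "0 < m" for m
    using order_trans[OF assms(1)[of "m + B"] assms(2)[of "m + B"]] that by simp
  \<comment> \<open>A single instance already shows that \<open>x\<close> is finite, so the limit
    can be taken in the reals.\<close>
  have "x \<le> of_nat (1 + B) * y + of_nat B * K" using le[of 1] by simp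
  also have "\<dots> < \<infinity>" using assms(3,4) by (simp add: ennreal_mult_less_top ennreal_add_eq_top less_top of_nat_less_top)
  finally have x: "x < \<infinity>" .
  obtain x' y' K' where r: "x = ennreal x'" "0 \<le> x'" "y = ennreal y'" "0 \<le> y'" "K = ennreal K'" "0 \<le> K'"
    using x assms(3,4) by (metis ennreal_cases infinity_ennreal_def less_irrefl)
  have le': "real m * x' \<le> real (m + B) * y' + real B * K'" if "0 < m" for m
  proof -
    have "ennreal (real m * x') \<le> ennreal (real (m + B) * y' + real B * K')"
      using le[OF that] r by (simp add: ennreal_of_nat_eq_real_of_nat ennreal_mult' ennreal_plus del: of_nat_add)
    then show ?thesis by (rule ennreal_le_iff[THEN iffD1, rotated]) (use r in simp)
  qed
  have "x' \<le> y' + (real B * (y' + K')) / real m" if "0 < m" for m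
  proof -
    have "x' \<le> (real (m + B) * y' + real B * K') / real m"
      using le'[OF that] that by (simp add: pos_le_divide_eq mult.commute)
    also have "\<dots> = y' + (real B * (y' + K')) / real m" using that by (simp add: field_simps)
    finally show ?thesis .
  qed
  moreover have "(\<lambda>m. y' + (real B * (y' + K')) / real m) \<longlonglongrightarrow> y' + 0"
    by (intro tendsto_add tendsto_const lim_const_over_n)
  ultimately have "x' \<le> y' + 0"
    by (intro LIMSEQ_le_const[of "\<lambda>m. y' + (real B * (y' + K')) / real m"]) (auto intro: exI[of _ 1])
  then show ?thesis using r by (simp add: ennreal_leI)
qed

text \<open>Three limits in this order: \<open>n\<close> to infinity at a fixed height; then the
  height in the correction factor, with the truncation on the left held fixed by monotonicity;
  finally the truncation itself.\<close>

lemma mean_windows_le: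
  assumes \<alpha>: "\<alpha> \<in> A_plus" and c: "\<And>w. length (c w) = length w" and d: "\<And>w. length (d w) = length w"
    and low: "\<And>H n. H + l < n \<Longrightarrow> of_nat (n - (H + l)) * mean_low_windows \<alpha> Q l c H \<le> S n"
    and up: "\<And>H n. H + l < n \<Longrightarrow> S n \<le> of_nat n * (ennreal ((1 / low_prob \<alpha> H) ^ Suc l) * mean_windows \<alpha> Q l d)
      + of_nat (H + l) * (ennreal (1 / low_prob \<alpha> 0) * mean_length \<alpha>)"
  shows "mean_windows \<alpha> Q l c \<le> mean_windows \<alpha> Q l d"
proof (rule mean_low_windows_le_imp[OF c \<alpha>])
  have A: "\<alpha> \<in> A_set" using \<alpha> by (simp add: A_plus_iff)
  let ?a = "mean_windows \<alpha> Q l d"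
  have a: "?a < \<infinity>" by (rule mean_windows_finite[OF d \<alpha>])
  have K: "ennreal (1 / low_prob \<alpha> 0) * mean_length \<alpha> < \<infinity>"
    using mean_length_finite[OF \<alpha>] by (simp add: ennreal_mult_less_top)
  have le: "mean_low_windows \<alpha> Q l c H \<le> ennreal ((1 / low_prob \<alpha> H) ^ Suc l) * ?a" for H
    by (rule ennreal_le_by_averages[OF low up _ K]) (use a in \<open>auto simp: ennreal_mult_less_top\<close>)
  fix H
  show "mean_low_windows \<alpha> Q l c H \<le> ?a"
  proof (rule LIMSEQ_le_const)
    have "(\<lambda>k. (1 / low_prob \<alpha> k) ^ Suc l) \<longlonglongrightarrow> (1 / 1) ^ Suc l"
      by (intro tendsto_intros low_prob_tendsto) simp
    then have "(\<lambda>k. ?a * ennreal ((1 / low_prob \<alpha> k) ^ Suc l)) \<longlonglongrightarrow> ?a * ennreal ((1 / 1) ^ Suc l)"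
      using a by (intro ennreal_tendsto_cmult tendsto_ennrealI) auto
    then show "(\<lambda>k. ennreal ((1 / low_prob \<alpha> k) ^ Suc l) * ?a) \<longlonglongrightarrow> ?a" by (simp add: mult.commute)
    show "\<exists>N. \<forall>k\<ge>N. mean_low_windows \<alpha> Q l c H \<le> ennreal ((1 / low_prob \<alpha> k) ^ Suc l) * ?a"
      using mean_low_windows_mono[OF c \<alpha>] le order_trans by blast
  qed
qed

text \<open>The number \<open>S n\<close> is the mean count after the dynamics. Through the words
  after the step, with rising bounds, it is compared with the identity; through the words before the
  step, with falling bounds, with complementation.\<close>

lemma mean_windows_complement:
  assumes \<alpha>: "\<alpha> \<in> A_plus"
  shows "mean_windows \<alpha> Q l (map Not) = mean_windows \<alpha> Q l id"
proof -
  have A: "\<alpha> \<in> A_set" using \<alpha> by (simp add: A_plus_iff)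
  let ?fall = "\<lambda>n. map (\<lambda>j. n - 1 - j) [0..<n]"
  define S where "S n = (\<integral>\<^sup>+ ws. of_nat (windows Q l (cat (map id ws))) \<partial>seq_pmf (map (low_law \<alpha>) [0..<n]))" for n
  have S: "S n = (\<integral>\<^sup>+ ws. of_nat (windows Q l (cat (compl_words ws))) \<partial>seq_pmf (map (low_law \<alpha>) (?fall n)))"
    if "0 < n" for n
  proof -
    have fall: "map (low_law \<alpha>) (?fall n) = map (\<lambda>j. low_law \<alpha> (n - 1 - j)) [0..<n]" by simp
    have "S n = (\<integral>\<^sup>+ ws. of_nat (windows Q l (cat (evolve ws))) \<partial>seq_pmf (map (low_law \<alpha>) (?fall n)))"
      unfolding S_def fall map_evolve_seq_pmf(1)[OF A that, symmetric] by simp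
    also have "\<dots> = (\<integral>\<^sup>+ ws. of_nat (windows Q l (cat (compl_words ws))) \<partial>seq_pmf (map (low_law \<alpha>) (?fall n)))"
      unfolding fall using map_evolve_seq_pmf(2)[OF A that]
      by (intro nn_integral_cong_AE) (auto simp: AE_measure_pmf_iff evolve(1))
    finally show ?thesis .
  qed
  have l: "length (map Not w) = length w" "length (id w) = length w" for w by simp_all
  have rise: "of_nat (n - (H + l)) * mean_low_windows \<alpha> Q l id H \<le> S n"
    "S n \<le> of_nat n * (ennreal ((1 / low_prob \<alpha> H) ^ Suc l) * mean_windows \<alpha> Q l id)
      + of_nat (H + l) * (ennreal (1 / low_prob \<alpha> 0) * mean_length \<alpha>)" if "H + l < n" for H n
  proof -
    \<comment> \<open>Rising bounds are too small at the first \<open>H\<close> positions, and the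
      last \<open>l\<close> positions lack a full window of words.\<close>
    have good: "i < n \<and> H \<le> [0..<n] ! i" if "j \<in> {H..<n - l}" "j \<le> i" "i \<le> j + l" for i j
      using that by auto
    show "of_nat (n - (H + l)) * mean_low_windows \<alpha> Q l id H \<le> S n"
      unfolding S_def
      by (rule windows_bounds(1)[OF l(2) \<alpha>, where G = "{H..<n - l}"]) (use good that in auto)
    show "S n \<le> of_nat n * (ennreal ((1 / low_prob \<alpha> H) ^ Suc l) * mean_windows \<alpha> Q l id)
      + of_nat (H + l) * (ennreal (1 / low_prob \<alpha> 0) * mean_length \<alpha>)"
      unfolding S_def
      by (rule windows_bounds(2)[OF l(2) \<alpha>, where G = "{H..<n - l}"]) (use good that in auto)
  qed
  have fall: "of_nat (n - (H + l)) * mean_low_windows \<alpha> Q l (map Not) H \<le> S n"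
    "S n \<le> of_nat n * (ennreal ((1 / low_prob \<alpha> H) ^ Suc l) * mean_windows \<alpha> Q l (map Not))
      + of_nat (H + l) * (ennreal (1 / low_prob \<alpha> 0) * mean_length \<alpha>)" if "H + l < n" for H n
  proof -
    have "0 < n" using that by simp
    note S = S[OF this]
    \<comment> \<open>With falling bounds both exclusions occur at the same end.\<close>
    have good: "i < n \<and> H \<le> ?fall n ! i" if "j \<in> {..<n - (H + l)}" "i \<le> j + l" for i j
      using that by auto
    show "of_nat (n - (H + l)) * mean_low_windows \<alpha> Q l (map Not) H \<le> S n"
      unfolding S by (rule windows_bounds(1)[OF l(1) \<alpha>, where G = "{..<n - (H + l)}"]) (use good that in auto)
    show "S n \<le> of_nat n * (ennreal ((1 / low_prob \<alpha> H) ^ Suc l) * mean_windows \<alpha> Q l (map Not))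
      + of_nat (H + l) * (ennreal (1 / low_prob \<alpha> 0) * mean_length \<alpha>)"
      unfolding S by (rule windows_bounds(2)[OF l(1) \<alpha>, where G = "{..<n - (H + l)}"]) (use good that in auto)
  qed
  show ?thesis
  proof (rule antisym)
    show "mean_windows \<alpha> Q l (map Not) \<le> mean_windows \<alpha> Q l id"
      by (rule mean_windows_le[OF \<alpha> l fall(1) rise(2)])
    show "mean_windows \<alpha> Q l id \<le> mean_windows \<alpha> Q l (map Not)"
      by (rule mean_windows_le[OF \<alpha> l(2,1) rise(1) fall(2)])
  qed
qed

section \<open>Invariance of the inverse Palm measure\<close>

lemma emeasure_Palm_inv_BBS_window:
  assumes \<alpha>: "\<alpha> \<in> A_plus"
  shows "emeasure (Palm_inv (mu_hat \<alpha>)) {\<eta>. Q (window l (BBS \<eta>))} = emeasure (Palm_inv (mu_hat \<alpha>)) {\<eta>. Q (window l \<eta>)}"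
proof -
  have A: "\<alpha> \<in> A_set" using \<alpha> by (simp add: A_plus_iff)
  have "emeasure (Palm_inv (mu_hat \<alpha>)) {\<eta>. Q (window l (BBS \<eta>))}
    = mean_windows \<alpha> Q l (map Not) / mean_record_distance (mu_hat \<alpha>)"
    unfolding mean_windows_def
    by (rule emeasure_Palm_inv_window[OF A measurable_BBS BBS_shift _ config_of_cat(2)]) simp_all
  moreover have "emeasure (Palm_inv (mu_hat \<alpha>)) {\<eta>. Q (window l (id \<eta>))}
    = mean_windows \<alpha> Q l id / mean_record_distance (mu_hat \<alpha>)"
    unfolding mean_windows_def
    by (rule emeasure_Palm_inv_window[OF A]) (simp_all add: config_of_cat(1))
  ultimately show ?thesis using mean_windows_complement[OF \<alpha>] by simp
qed

text \<open>Cylinder sets determine a finite measure. Translation invariance moves the boxes of a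
  cylinder into a window that starts at box 0, and this is compatible with \<open>BBS\<close>
  because \<open>BBS\<close> commutes with shifts.\<close>

lemma distr_Palm_inv_BBS:
  assumes \<alpha>: "\<alpha> \<in> A_plus"
  shows "distr (Palm_inv (mu_hat \<alpha>)) config_space BBS = Palm_inv (mu_hat \<alpha>)"
proof -
  let ?P = "Palm_inv (mu_hat \<alpha>)"
  interpret prob_space ?P by (rule prob_space_Palm_inv[OF \<alpha>])
  have mB: "BBS \<in> measurable ?P config_space"
    unfolding measurable_cong_sets[OF sets_Palm_inv refl] by (rule measurable_BBS)
  have inv: "emeasure ?P (shift y -` Y) = emeasure ?P Y" if Y: "Y \<in> sets config_space" for y Y
  proof -
    have "emeasure ?P Y = emeasure (distr ?P config_space (shift y)) Y"
      using translation_invariant_Palm_inv[OF \<alpha>] by (simp add: translation_invariant_def)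
    also have "\<dots> = emeasure ?P (shift y -` Y \<inter> space ?P)"
      by (rule emeasure_distr[OF _ Y]) (unfold measurable_cong_sets[OF sets_Palm_inv refl], rule measurable_shift)
    finally show ?thesis by simp
  qed
  have cs: "sets config_space = sets (PiM UNIV (\<lambda>_::int. count_space (UNIV :: bool set)))" by (simp add: config_space_def)
  show ?thesis
  proof (rule measure_eqI_PiM_infinite[symmetric])
    show "sets ?P = sets (PiM UNIV (\<lambda>_::int. count_space (UNIV :: bool set)))" using cs by simp
    show "sets (distr ?P config_space BBS) = sets (PiM UNIV (\<lambda>_::int. count_space (UNIV :: bool set)))" using cs by simp
    show "finite_measure ?P" by (rule finite_measure_axioms)
    fix A :: "int \<Rightarrow> bool set" and J :: "int set"
    assume J: "finite J"
    obtain lo where lo: "\<And>i. i \<in> J \<Longrightarrow> lo \<le> i" using bdd_below_finite[OF J] by (auto simp: bdd_below_def)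
    obtain hi where hi: "\<And>i. i \<in> J \<Longrightarrow> i < hi"
      using bdd_above_finite[OF J] by (auto simp: bdd_above_def intro: that[of "_ + 1"] zle_add1_eq_le[THEN iffD2])
    define l where "l = nat (hi - lo)"
    define Q where "Q v \<longleftrightarrow> (\<forall>i\<in>J. v ! nat (i - lo) \<in> A i)" for v :: "bool list"
    let ?X = "prod_emb UNIV (\<lambda>_::int. count_space (UNIV :: bool set)) J (Pi\<^sub>E J A)"
    let ?Y = "{\<eta>. Q (window l \<eta>)}"
    have "Q (window l (shift lo \<eta>)) \<longleftrightarrow> (\<forall>i\<in>J. \<eta> i \<in> A i)" for \<eta>
    proof -
      have "window l (shift lo \<eta>) ! nat (i - lo) = \<eta> i" if "i \<in> J" for i
        using lo[OF that] hi[OF that] by (simp add: window_def l_def shift_def[of lo \<eta> "i - lo"])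
      then show ?thesis by (simp add: Q_def)
    qed
    then have X: "?X = shift lo -` ?Y" by (auto simp: prod_emb_def PiE_iff)
    have Y: "?Y \<in> sets config_space" by (rule sets_window)
    have XS: "?X \<in> sets config_space"
      unfolding X using measurable_sets[OF measurable_shift Y, of lo] by simp
    have BY: "BBS -` ?Y \<in> sets config_space" using measurable_sets[OF measurable_BBS Y] by simp
    have "emeasure (distr ?P config_space BBS) ?X = emeasure ?P (BBS -` ?X)"
      using emeasure_distr[OF mB XS] by simp
    also have "BBS -` ?X = shift lo -` (BBS -` ?Y)" unfolding X by (auto simp: BBS_shift)
    also have "emeasure ?P \<dots> = emeasure ?P (BBS -` ?Y)" by (rule inv[OF BY])
    also have "\<dots> = emeasure ?P ?Y" using emeasure_Palm_inv_BBS_window[OF \<alpha>, of Q l] by (simp add: vimage_def)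
    also have "\<dots> = emeasure ?P ?X" unfolding X by (rule inv[OF Y, symmetric])
    finally show "emeasure ?P ?X = emeasure (distr ?P config_space BBS) ?X" ..
  qed
qed

lemma BBS_invariant_Palm_inv:
  assumes "\<alpha> \<in> A_plus"
  shows "BBS_invariant (Palm_inv (mu_hat \<alpha>))"
  unfolding BBS_invariant_def
proof
  show "AE \<eta> in Palm_inv (mu_hat \<alpha>). \<eta> \<in> subcritical"
    using AE_Palm_inv_density[OF assms]
    by eventually_elim (use ball_density_bounds[OF assms] in \<open>auto simp: subcritical_def\<close>)
  show "distr (Palm_inv (mu_hat \<alpha>)) config_space BBS = Palm_inv (mu_hat \<alpha>)"
    by (rule distr_Palm_inv_BBS[OF assms])
qed

theorem theorem12:
  shows "(\<forall>\<alpha>\<in>A_plus.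
            concentrates_on (mu_hat \<alpha>) (density_class_hat (ball_density \<alpha>)) \<and>
            record_translation_invariant (mu_hat \<alpha>) \<and>
            concentrates_on (Palm_inv (mu_hat \<alpha>)) (density_class (ball_density \<alpha>)) \<and>
            translation_invariant (Palm_inv (mu_hat \<alpha>)) \<and>
            BBS_invariant (Palm_inv (mu_hat \<alpha>))) \<and>
         (\<forall>q\<in>Q_plus.
            concentrates_on (mu_hat (alpha_of q)) (density_class_hat (ball_density (alpha_of q))) \<and>
            translation_invariant (Palm_inv (mu_hat (alpha_of q))) \<and>
            concentrates_on (Palm_inv (mu_hat (alpha_of q))) (density_class (ball_density (alpha_of q))) \<and>
            BBS_invariant (Palm_inv (mu_hat (alpha_of q))))"
proof -
  have A: "\<alpha> \<in> A_set" if "\<alpha> \<in> A_plus" for \<alpha> using that by (simp add: A_plus_iff)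
  \<comment> \<open>The second half is the first at \<open>alpha_of q\<close>, which lies in
    \<open>A_plus\<close> by \<open>alpha_of_Q_plus\<close>.\<close>
  show ?thesis
    using A alpha_of_Q_plus prob_space_mu_hat AE_mu_hat_density record_translation_invariant_mu_hat
      prob_space_Palm_inv AE_Palm_inv_density translation_invariant_Palm_inv BBS_invariant_Palm_inv
    by (simp add: concentrates_on_def)
qed

end
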